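(* Let $D$ be an effective divisor of degree $n$ on $\mathbb P^1$ and let $\Lambda$ be local formal data with polar divisor $D$ satisfying the Fuchs relation for degree $1$. Given a divisor $Q=q_1+\dots+q_{n-3}\in W\subset|\mathcal O(n-3)|$ and a lift $$\{\mathbf p_1,\ldots,\mathbf p_{n-3}\}\in\Pi^{-1}(Q)\subset\mathrm{Hilb}^{(n-3)}(\mathbf\Omega_D),$$ (with $\mathbf p_j$ lying over $q_j$), there is a unique connection $\nabla_0$ on $E_0=\mathcal O\oplus\Omega^1(D)$ such that: (1) $\nabla_0$ has polar divisor $D+Q$; (2) $\nabla_0$ satisfies the normalizations $\nabla_0|_{\mathcal O}\equiv0$ and $\varphi_{\nabla_0}=\mathrm{id}_{\Omega^1(D)}$; (3) the local formal data of $\nabla_0$ at $D$ is $\Lambda$; (4) at each pole $q_j\in Q$, $\nabla_0$ has an apparent singular point with residual eigenvalues $-1$ and $0$, and eigenspaces respectively given by $\Omega^1(D)\subset E_0$ and $\mathbf p_j$.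
   Context: Everything is over $\mathbb C$. Write $\mathcal O,\mathcal O(k),\Omega^1$ for the line bundles on $\mathbb P^1$. **Formal data.** $D=\sum_i n_i[t_i]$ with distinct points $t_i$, $n_i\ge 1$, $n=\deg D\geq 3$. A rank $2$ meromorphic connection is a rank $2$ holomorphic vector bundle $E\to\mathbb P^1$ with a $\mathbb C$-linear map $\nabla:E\to E\otimes\Omega^1(D')$ ($D'$ the polar divisor) satisfying $\nabla(fs)=s\otimes df+f\nabla s$; locally $\nabla=d+\Omega$ with $\Omega$ a $2\times2$ matrix of meromorphic $1$-forms. The formal data at a pole $t_i$ of order $n_i$ is $\Lambda_{t_i}(\nabla)=(\mathrm{tr}(\nabla)^{<0}_{t_i},\det(\nabla)^{<-n_i}_{t_i})$, where the first term is the class of $\mathrm{tr}\,\Omega$ in germs of $\Omega^1(D)/\Omega^1$ and the second is the class of $\det\Omega$ in germs of $(\Omega^1(D))^{\otimes2}/(\Omega^1)^{\otimes 2}(D)$. $\Lambda$ is a fixed collection of such data at all $t_i$, satisfying the Fuchs relation (for bundles of degree $1$) $\sum_i\mathrm{Res}_{t_i}\mathrm{tr}(\nabla)^{<0}_{t_i}=-1$. Poles are assumed reduced: leading coefficients are non-scalar, and at poles with $n_i>1$ the discriminant $\mathrm{tr}^2-4\det$ has pole order $2n_i$ or $2n_i-1$. **Notation.** $W\subset|\mathcal O(n-3)|$ is the set of reduced divisors with support disjoint from $D$. $\mathbf\Omega_D$ is the total space of $\Omega^1(D)$; it is embedded in $\mathbb P(E_0)$ by sending $v\in\Omega^1(D)_q$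 to the line spanned by $(1,v)$, so $\mathbf p_j$ is viewed as a line in the fiber of $E_0$ at $q_j$. The projection $\mathbf\Omega_D\to\mathbb P^1$ induces $\Pi:\mathrm{Hilb}^{(n-3)}(\mathbf\Omega_D)\to\mathrm{Hilb}^{(n-3)}(\mathbb P^1)\simeq|\mathcal O(n-3)|$. **Normalizations.** $\nabla_0|_{\mathcal O}\equiv0$ means that the composition $\mathcal O\hookrightarrow E_0\xrightarrow{\nabla_0}E_0\otimes\Omega^1(D+Q)\to\mathcal O\otimes\Omega^1(D+Q)$ (projection to the first factor) is the trivial connection $d$. $\varphi_{\nabla_0}$ is the composition $\Omega^1(D)\hookrightarrow E_0\xrightarrow{\nabla_0}E_0\otimes\Omega^1(D+Q)\to(E_0/\Omega^1(D))\otimes\Omega^1(D+Q)\simeq\Omega^1(D+Q)$, required to be the identity onto $\Omega^1(D)\subset\Omega^1(D+Q)$. A simple pole with residual eigenvalues $-1,0$ is an apparent singular point if local horizontal sections are holomorphic (no logarithms), equivalently the pole disappears after an elementary transformation directed by the $0$-eigendirection. *)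

theory Defs
  imports "HOL-Complex_Analysis.Complex_Analysis" "HOL-Library.Multiset"
begin

type_synonym P1 = "complex option"

abbreviation P1_top :: "P1 topology" where
  "P1_top \<equiv> Alexandroff_compactification euclidean"

text \<open>An effective divisor is a finite multiset of points: \<open>size\<close> is the degree, \<open>count D p\<close> the
  multiplicity of \<open>p\<close>, and \<open>set_mset D\<close> the support.\<close>

type_synonym divisor = "P1 multiset"

text \<open>\<open>from_local p w\<close> is the point whose value under the local parameter at \<open>p\<close> is \<open>w\<close>.  The local
  parameter is \<open>z - a\<close> at \<open>Some a\<close> and \<open>1/z\<close> at infinity (\<open>None\<close>).\<close>

definition from_local :: "P1 \<Rightarrow> complex \<Rightarrow> P1" where
  "from_local p w = (case p of Some a \<Rightarrow> Some (a + w)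
                             | None \<Rightarrow> if w = 0 then None else Some (1 / w))"

text \<open>Every meromorphic section of the \<open>k\<close>-th power of \<open>\<Omega>\<^sup>1\<close> on an open set is \<open>f dz^k\<close> with \<open>f\<close>
  meromorphic, also near infinity; it is encoded by \<open>f\<close>.  So that equality of sections over \<open>U\<close> is
  equality in HOL, \<open>f\<close> is continuous where it has no pole, and vanishes at its poles and outside
  \<open>U\<close>.\<close>

definition mero :: "P1 set \<Rightarrow> (P1 \<Rightarrow> complex) set" where
  "mero U = {f. (\<forall>p\<in>U. (\<lambda>w. f (from_local p w)) nicely_meromorphic_on {0}) \<and> (\<forall>p. p \<notin> U \<longrightarrow> f p = 0)}"

text \<open>The representative in \<open>mero U\<close> of a function given up to its values on a discrete set.\<close>

definition mero_of :: "P1 set \<Rightarrow> (P1 \<Rightarrow> complex) \<Rightarrow> P1 \<Rightarrow> complex" where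
  "mero_of U f = (\<lambda>p. if p \<in> U then remove_sings (\<lambda>w. f (from_local p w)) 0 else 0)"

text \<open>\<open>dz/dw\<close> for the local parameter \<open>w\<close> at \<open>p\<close>.\<close>

definition jac :: "P1 \<Rightarrow> complex \<Rightarrow> complex" where
  "jac p w = (case p of Some _ \<Rightarrow> 1 | None \<Rightarrow> - (1 / w ^ 2))"

text \<open>If \<open>f dz^k = F(w) dw^k\<close> near \<open>p\<close>, with \<open>w\<close> the local parameter at \<open>p\<close>, then \<open>germ k p f\<close> is the
  Laurent series of \<open>F\<close>.\<close>

definition germ :: "nat \<Rightarrow> P1 \<Rightarrow> (P1 \<Rightarrow> complex) \<Rightarrow> complex fls" where
  "germ k p f = laurent_expansion (\<lambda>w. f (from_local p w) * jac p w ^ k) 0"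

text \<open>The sections over \<open>U\<close> of the \<open>k\<close>-th power of \<open>\<Omega>\<^sup>1\<close> twisted by \<open>D\<close>.  The zero
  series has \<open>fls_subdegree\<close> 0 and so satisfies the condition.\<close>

definition sect :: "nat \<Rightarrow> divisor \<Rightarrow> P1 set \<Rightarrow> (P1 \<Rightarrow> complex) set" where
  "sect k D U = {f \<in> mero U. \<forall>p\<in>U. fls_subdegree (germ k p f) \<ge> - int (count D p)}"

abbreviation hol :: "P1 set \<Rightarrow> (P1 \<Rightarrow> complex) set" where
  "hol \<equiv> sect 0 {#}"

definition exterior_d :: "P1 set \<Rightarrow> (P1 \<Rightarrow> complex) \<Rightarrow> P1 \<Rightarrow> complex" where
  "exterior_d U h =
     mero_of U (\<lambda>p. case p of Some a \<Rightarrow> deriv (\<lambda>z. h (Some z)) a | None \<Rightarrow> 0)"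

type_synonym E0_section = "(P1 \<Rightarrow> complex) \<times> (P1 \<Rightarrow> complex)"

definition E0 :: "divisor \<Rightarrow> P1 set \<Rightarrow> E0_section set" where
  "E0 D U = hol U \<times> sect 1 D U"

text \<open>The sections of the tensor product of \<open>E\<^sub>0\<close> with \<open>\<Omega>\<^sup>1(D')\<close>, whose second summand
  \<open>\<Omega>\<^sup>1(D) \<otimes> \<Omega>\<^sup>1(D')\<close> consists of the quadratic differentials with poles bounded by \<open>D + D'\<close>.\<close>

definition E0_forms :: "divisor \<Rightarrow> divisor \<Rightarrow> P1 set \<Rightarrow> E0_section set" where
  "E0_forms D D' U = sect 1 D' U \<times> sect 2 (D + D') U"

definition zero_section :: E0_section where
  "zero_section = ((\<lambda>_. 0), (\<lambda>_. 0))"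

definition add_section :: "P1 set \<Rightarrow> E0_section \<Rightarrow> E0_section \<Rightarrow> E0_section" where
  "add_section U s t =
     (mero_of U (\<lambda>p. fst s p + fst t p), mero_of U (\<lambda>p. snd s p + snd t p))"

text \<open>With \<open>h\<close> standing for the form \<open>h dz\<close>, this is also the tensor product of a section of \<open>E\<^sub>0\<close>
  with a 1-form.\<close>

definition mult_section :: "P1 set \<Rightarrow> (P1 \<Rightarrow> complex) \<Rightarrow> E0_section \<Rightarrow> E0_section" where
  "mult_section U h s = (mero_of U (\<lambda>p. h p * fst s p), mero_of U (\<lambda>p. h p * snd s p))"

definition restrict_section :: "P1 set \<Rightarrow> E0_section \<Rightarrow> E0_section" where
  "restrict_section V s =
     ((\<lambda>p. if p \<in> V then fst s p else 0), (\<lambda>p. if p \<in> V then snd s p else 0))"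

text \<open>A morphism of sheaves of complex vector spaces satisfying the Leibniz rule.  The last clause
  fixes the value of \<open>nabla\<close> on arguments that are not sections.\<close>

type_synonym connection = "P1 set \<Rightarrow> E0_section \<Rightarrow> E0_section"

definition is_connection :: "divisor \<Rightarrow> divisor \<Rightarrow> connection \<Rightarrow> bool" where
  "is_connection D D' nabla \<longleftrightarrow>
     (\<forall>U s. openin P1_top U \<and> s \<in> E0 D U \<longrightarrow> nabla U s \<in> E0_forms D D' U) \<and>
     (\<forall>U V s. openin P1_top U \<and> openin P1_top V \<and> V \<subseteq> U \<and> s \<in> E0 D U \<longrightarrow>
        nabla V (restrict_section V s) = restrict_section V (nabla U s)) \<and>
     (\<forall>U s t. openin P1_top U \<and> s \<in> E0 D U \<and> t \<in> E0 D U \<longrightarrow>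
        nabla U (add_section U s t) = add_section U (nabla U s) (nabla U t)) \<and>
     (\<forall>U c s. openin P1_top U \<and> s \<in> E0 D U \<longrightarrow>
        nabla U (mult_section U (\<lambda>_. c) s) = mult_section U (\<lambda>_. c) (nabla U s)) \<and>
     (\<forall>U h s. openin P1_top U \<and> h \<in> hol U \<and> s \<in> E0 D U \<longrightarrow>
        nabla U (mult_section U h s) =
          add_section U (mult_section U (exterior_d U h) s) (mult_section U h (nabla U s))) \<and>
     (\<forall>U s. \<not> (openin P1_top U \<and> s \<in> E0 D U) \<longrightarrow> nabla U s = undefined)"

text \<open>Near \<open>p\<close>, with local parameter \<open>w\<close> and \<open>n = count D p\<close>, the standard local frame of \<open>E\<^sub>0\<close> is
  \<open>e\<^sub>1 = (1, 0)\<close>, \<open>e\<^sub>2 = (0, dw / w^n)\<close>; it is a frame over \<open>frame_nhd D p\<close>.\<close>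

definition frame_nhd :: "divisor \<Rightarrow> P1 \<Rightarrow> P1 set" where
  "frame_nhd D p = insert p (- (set_mset D \<union> {None, Some 0}))"

definition frame1 :: "divisor \<Rightarrow> P1 \<Rightarrow> E0_section" where
  "frame1 D p = (mero_of (frame_nhd D p) (\<lambda>_. 1), (\<lambda>_. 0))"

text \<open>At infinity \<open>dw / w^n = - z^n / z^2 dz\<close>.\<close>

definition frame2 :: "divisor \<Rightarrow> P1 \<Rightarrow> E0_section" where
  "frame2 D p = ((\<lambda>_. 0), mero_of (frame_nhd D p)
     (\<lambda>x. case x of None \<Rightarrow> 0
        | Some z \<Rightarrow> (case p of Some a \<Rightarrow> 1 / (z - a) ^ count D p
                           | None \<Rightarrow> - (z ^ count D p / z ^ 2))))"

text \<open>The Laurent expansion \<open>A\<close> of the matrix \<open>\<Omega> = A(w) dw\<close> given by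
  \<open>\<nabla> e\<^sub>j = \<Sum>\<^sub>i \<Omega>\<^sub>i\<^sub>j e\<^sub>i\<close>, that is, \<open>\<nabla> = d + \<Omega>\<close> on columns.  The second component \<open>F(w) dw^2\<close> of
  \<open>\<nabla> e\<^sub>j\<close> equals \<open>w^n F(w) dw \<otimes> dw / w^n\<close>.\<close>

definition conn_matrix :: "divisor \<Rightarrow> connection \<Rightarrow> P1 \<Rightarrow> complex fls ^ 2 ^ 2" where
  "conn_matrix D nabla p =
     (let s1 = nabla (frame_nhd D p) (frame1 D p);
          s2 = nabla (frame_nhd D p) (frame2 D p);
          u = fls_X ^ count D p
      in vector [vector [germ 1 p (fst s1), germ 1 p (fst s2)],
                 vector [germ 2 p (snd s1) * u, germ 2 p (snd s2) * u]])"

definition pole_order :: "divisor \<Rightarrow> connection \<Rightarrow> P1 \<Rightarrow> nat" where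
  "pole_order D nabla p = Max {nat (- fls_subdegree (conn_matrix D nabla p $ i $ j)) |i j. True}"

definition connection_with_polar_divisor :: "divisor \<Rightarrow> divisor \<Rightarrow> connection \<Rightarrow> bool" where
  "connection_with_polar_divisor D D' nabla \<longleftrightarrow>
     is_connection D D' nabla \<and> (\<forall>p. pole_order D nabla p = count D' p)"

definition trivial_on_O :: "divisor \<Rightarrow> connection \<Rightarrow> bool" where
  "trivial_on_O D nabla \<longleftrightarrow>
     (\<forall>U f. openin P1_top U \<and> f \<in> hol U \<longrightarrow> fst (nabla U (f, (\<lambda>_. 0))) = exterior_d U f)"

text \<open>\<open>E\<^sub>0 / \<Omega>\<^sup>1(D)\<close> is identified with \<open>\<O>\<close> by the first projection.\<close>

definition phi_is_id :: "divisor \<Rightarrow> connection \<Rightarrow> bool" where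
  "phi_is_id D nabla \<longleftrightarrow>
     (\<forall>U \<omega>. openin P1_top U \<and> \<omega> \<in> sect 1 D U \<longrightarrow> fst (nabla U ((\<lambda>_. 0), \<omega>)) = \<omega>)"

text \<open>Laurent tails: \<open>fls_below m F\<close>, the part of \<open>F\<close> with exponents \<open>< m\<close>, is the canonical
  representative of the class of \<open>F\<close> modulo series with exponents \<open>\<ge> m\<close>.\<close>

definition fls_below :: "int \<Rightarrow> complex fls \<Rightarrow> complex fls" where
  "fls_below m F = Abs_fls (\<lambda>k. if k < m then fls_nth F k else 0)"

type_synonym formal_data = "P1 \<Rightarrow> complex fls \<times> complex fls"

definition formal_data_at :: "divisor \<Rightarrow> connection \<Rightarrow> P1 \<Rightarrow> complex fls \<times> complex fls" where
  "formal_data_at D nabla t =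
     (fls_below 0 (trace (conn_matrix D nabla t)),
      fls_below (- int (count D t)) (det (conn_matrix D nabla t)))"

definition is_formal_data :: "divisor \<Rightarrow> formal_data \<Rightarrow> bool" where
  "is_formal_data D \<Lambda> \<longleftrightarrow> (\<forall>t\<in>#D. let (a, b) = \<Lambda> t; n = int (count D t) in
     fls_subdegree a \<ge> - n \<and> fls_below 0 a = a \<and>
     fls_subdegree b \<ge> - 2 * n \<and> fls_below (- n) b = b)"

text \<open>For \<open>n > 1\<close> the coefficients of the discriminant in degrees \<open>-2n\<close> and \<open>-2n + 1\<close> depend only on
  the classes of trace and determinant, and the condition forces the leading coefficient of the
  connection matrix to be non-scalar.\<close>

definition reduced_data :: "divisor \<Rightarrow> formal_data \<Rightarrow> bool" where
  "reduced_data D \<Lambda> \<longleftrightarrow> (\<forall>t\<in>#D. count D t > 1 \<longrightarrow> (let (a, b) = \<Lambda> t; n = int (count D t) in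
     fls_subdegree (a ^ 2 - 4 * b) \<in> {- 2 * n, - 2 * n + 1}))"

definition fuchs_relation :: "int \<Rightarrow> divisor \<Rightarrow> formal_data \<Rightarrow> bool" where
  "fuchs_relation d D \<Lambda> \<longleftrightarrow> (\<Sum>t\<in>set_mset D. fls_nth (fst (\<Lambda> t)) (- 1)) = - of_int d"

definition residue_matrix :: "divisor \<Rightarrow> connection \<Rightarrow> P1 \<Rightarrow> complex ^ 2 ^ 2" where
  "residue_matrix D nabla q = (\<chi> i j. fls_nth (conn_matrix D nabla q $ i $ j) (- 1))"

definition eigenspace :: "complex ^ 2 ^ 2 \<Rightarrow> complex \<Rightarrow> (complex ^ 2) set" where
  "eigenspace R \<mu> = {x. R *v x = \<mu> *s x}"

text \<open>The local horizontal sections near \<open>q\<close> are those over connected open subsets (for instance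
  small discs) of a punctured neighbourhood of \<open>q\<close>.\<close>

definition horizontal_sections_holomorphic :: "divisor \<Rightarrow> connection \<Rightarrow> P1 \<Rightarrow> bool" where
  "horizontal_sections_holomorphic D nabla q \<longleftrightarrow>
     (\<exists>V. openin P1_top V \<and> q \<in> V \<and>
        (\<forall>U s. openin P1_top U \<and> connectedin P1_top U \<and> U \<subseteq> V - {q} \<and>
               s \<in> E0 D U \<and> nabla U s = zero_section \<longrightarrow>
               (\<exists>t \<in> E0 D V. restrict_section U t = s)))"

definition apparent_singular_point :: "divisor \<Rightarrow> connection \<Rightarrow> P1 \<Rightarrow> bool" where
  "apparent_singular_point D nabla q \<longleftrightarrow>
     pole_order D nabla q = 1 \<and>
     {\<mu>. eigenspace (residue_matrix D nabla q) \<mu> \<noteq> {0}} = {- 1, 0} \<and>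
     horizontal_sections_holomorphic D nabla q"

text \<open>\<open>W\<close>, with the projective space of sections of \<open>\<O>(n - 3)\<close> identified with the set of effective
  divisors of degree \<open>n - 3\<close>.\<close>

definition W :: "divisor \<Rightarrow> divisor set" where
  "W D = {Q. size Q = size D - 3 \<and> (\<forall>q. count Q q \<le> 1) \<and> set_mset Q \<inter> set_mset D = {}}"

text \<open>The pair \<open>(q, v)\<close> is the point \<open>v dw / w^n\<close> of the fibre of \<open>\<Omega>\<^sup>1(D)\<close> at \<open>q\<close>, where \<open>w\<close> is the
  local parameter at \<open>q\<close> and \<open>n = count D q\<close>.\<close>

type_synonym Omega_point = "P1 \<times> complex"

text \<open>A zero-dimensional subscheme of the total space lying over a reduced divisor \<open>Q\<close> is reduced,
  hence a finite set of points; its image under \<open>\<Pi>\<close> is the push-forward divisor.\<close>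

definition Pi_fibre :: "divisor \<Rightarrow> Omega_point set set" where
  "Pi_fibre Q = {P. finite P \<and> image_mset fst (mset_set P) = Q}"

text \<open>Lines in the fibre of \<open>E\<^sub>0\<close> at a point, in the standard local frame.\<close>

definition line_Omega :: "(complex ^ 2) set" where
  "line_Omega = vec.span {vector [0, 1]}"

definition line_of_point :: "Omega_point \<Rightarrow> (complex ^ 2) set" where
  "line_of_point P = vec.span {vector [1, snd P]}"

end

theory Submission
  imports Defs
begin

text \<open>
  In the frame \<open>(1, dz)\<close> the normalizations leave only two unknown functions: a normalized connection
  is \<open>(f, g dz) \<mapsto> ((f' + g) dz, (\<gamma> f + g' + \<delta> g) dz\<^sup>2)\<close>
  (\<open>normalized_connection_eq_conn\<close>), where \<open>\<delta> dz\<close> describes the connection induced on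
  \<open>\<Omega>\<^sup>1(D)\<close> and \<open>\<gamma> dz\<^sup>2\<close> is a global quadratic differential.  Existence and uniqueness of the
  connection become existence and uniqueness of \<open>\<delta>\<close> and of \<open>\<gamma>\<close>, each of which is an interpolation
  problem on the projective line, stated for Laurent expansions in the local parameters.

  The trace part of the formal data fixes the principal parts of \<open>\<delta> dz\<close> at \<open>D\<close>, and the eigenvalues
  \<open>-1, 0\<close> fix them at \<open>Q\<close>.  The Fuchs relation says that the prescribed residues add up to zero,
  which is the only obstruction to finding \<open>\<delta> dz\<close>; it is unique because there is no nonzero
  holomorphic 1-form.

  Given \<open>\<delta>\<close>, the conditions on \<open>\<gamma>\<close> are local as well.  The determinant part of the formal data fixes
  the expansion of \<open>\<gamma>\<close> at \<open>t \<in> D\<close> up to order \<open>-n\<^sub>t\<close>.  At a point \<open>q\<close> of \<open>Q\<close> the eigenspace fixes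
  the residue \<open>v\<close> of \<open>\<gamma>\<close>, and absence of logarithms fixes the next coefficient:
  horizontal sections satisfy \<open>f'' + \<delta> f' - \<gamma> f = 0\<close>, with exponents \<open>0\<close> and \<open>2\<close>, and the recursion
  for the coefficients of \<open>f\<close> can be solved at the second exponent exactly when
  \<open>\<gamma>\<^sub>0 = v\<^sup>2 - \<delta>\<^sub>0 v\<close> (\<open>horizontal_sections_holomorphicI\<close>, \<open>horizontal_sections_holomorphicD\<close>).
  These are \<open>n + 2 (n - 3)\<close> conditions on a section of a line bundle of degree \<open>3 n - 7\<close>, as many as the
  dimension of the space of its sections.
  The difference of two solutions is a section of \<open>(\<Omega>\<^sup>1)\<^sup>2(D - Q)\<close>, of degree \<open>-1\<close>, hence zero
  (\<open>vanishing_of_negative_degree\<close>), and since \<open>H\<^sup>1(\<O>(-1)) = 0\<close> a solution exists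
  (\<open>interpolation_of_differentials\<close>).
\<close>

section \<open>Local parameters and germs\<close>

text \<open>Unlike \<open>germ\<close>, which has a value for every function, this relation also asserts that \<open>f dz^k\<close> is
  meromorphic at \<open>p\<close>.  It depends on \<open>f\<close> only in a punctured neighbourhood of \<open>p\<close>.\<close>

definition has_germ :: "nat \<Rightarrow> P1 \<Rightarrow> (P1 \<Rightarrow> complex) \<Rightarrow> complex fls \<Rightarrow> bool" where
  "has_germ k p f F \<longleftrightarrow> (\<lambda>w. f (from_local p w) * jac p w ^ k) has_laurent_expansion F"

definition near :: "P1 \<Rightarrow> (P1 \<Rightarrow> bool) \<Rightarrow> bool" where
  "near p Pr \<longleftrightarrow> eventually (\<lambda>w. Pr (from_local p w)) (at 0)"

lemma near_mono: "near p A \<Longrightarrow> (\<And>x. A x \<Longrightarrow> B x) \<Longrightarrow> near p B"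
  unfolding near_def by (auto elim: eventually_mono)

lemma near_conj: "near p A \<Longrightarrow> near p B \<Longrightarrow> near p (\<lambda>x. A x \<and> B x)"
  unfolding near_def by (auto intro: eventually_conj)

lemma from_local_0 [simp]: "from_local p 0 = p"
  by (auto simp: from_local_def split: option.splits)

lemma from_local_Some [simp]: "from_local (Some a) w = Some (a + w)"
  by (simp add: from_local_def)

lemma jac_Some [simp]: "jac (Some a) w = 1"
  by (simp add: jac_def)

lemma inj_from_local: "inj (from_local p)"
  by (auto simp: inj_def from_local_def split: option.splits if_splits)

lemma from_local_eq_iff [simp]: "from_local p w = from_local p w' \<longleftrightarrow> w = w'"
  using inj_from_local by (auto simp: inj_def)

text \<open>At infinity, neighbourhoods are complements of compact sets, so this amounts to \<open>1/w\<close> leaving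
  every bounded set as \<open>w\<close> tends to 0.\<close>

lemma continuous_from_local: "continuous_map euclidean P1_top (from_local p)"
proof (cases p)
  case (Some a)
  have "continuous_map euclidean euclidean (\<lambda>w. a + w :: complex)"
    by (simp add: continuous_map_iff_continuous2 continuous_intros)
  then have "continuous_map euclidean P1_top (Some \<circ> (\<lambda>w. a + w))"
    using continuous_map_Some by (rule continuous_map_compose)
  then show ?thesis
    by (rule continuous_map_eq) (simp add: Some)
next
  case None
  show ?thesis unfolding continuous_map_def
  proof (intro conjI allI impI)
    show "from_local p \<in> topspace euclidean \<rightarrow> topspace P1_top"
      by (auto simp: None from_local_def split: if_splits)
    fix U assume U: "openin P1_top U"
    show "openin euclidean {x \<in> topspace euclidean. from_local p x \<in> U}"
    proof (cases "None \<in> U")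
      case False
      then obtain V where V: "open V" "U = Some ` V"
        using U by (auto simp: openin_Alexandroff_compactification)
      have "{x \<in> topspace euclidean. from_local p x \<in> U} = (\<lambda>x. 1 / x) -` V \<inter> (- {0})"
        by (auto simp: V None from_local_def)
      moreover have "open ((\<lambda>x. 1 / x) -` V \<inter> (- {0::complex}))"
        by (intro continuous_open_preimage[THEN open_Int] \<open>open V\<close> | 
            subst Int_commute, intro continuous_open_preimage \<open>open V\<close> continuous_intros) auto
      ultimately show ?thesis by simp
    next
      case True
      then obtain C where C: "compact C" "U = insert None (Some ` (- C))"
        using U by (auto simp: openin_Alexandroff_compactification Compl_eq_Diff_UNIV)
      obtain B where B: "B > 0" "\<And>z. z \<in> C \<Longrightarrow> norm z \<le> B"
        using compact_imp_bounded[OF C(1)] bounded_pos by blast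
      have eq: "{x \<in> topspace euclidean. from_local p x \<in> U} =
          ((- {0}) \<inter> (\<lambda>x. 1 / x) -` (- C)) \<union> ball 0 (1 / B)"
      proof -
        have "1 / x \<notin> C" if "x \<noteq> 0" "norm x < 1 / B" for x
        proof
          assume "1 / x \<in> C"
          then have "norm (1 / x) \<le> B" by (rule B)
          then have "1 / norm x \<le> B" by (simp add: norm_divide)
          then have "1 \<le> B * norm x" using that by (simp add: field_simps)
          moreover have "B * norm x < 1" using that B(1) by (simp add: field_simps)
          ultimately show False by simp
        qed
        then show ?thesis
          using B(1) by (auto simp: C None from_local_def)
      qed
      have "open ((- {0}) \<inter> (\<lambda>x::complex. 1 / x) -` (- C))"
        by (intro continuous_open_preimage continuous_intros) (use C(1) in \<open>auto simp: compact_imp_closed\<close>)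
      then show ?thesis unfolding eq by auto
    qed
  qed
qed

lemma open_from_local_image:
  assumes "open S"
  shows "openin P1_top (from_local p ` S)"
proof (cases p)
  case (Some a)
  have "from_local p ` S = Some ` ((+) a ` S)"
    by (auto simp: Some)
  then show ?thesis using assms by (simp add: open_translation)
next
  case None
  show ?thesis
  proof (cases "0 \<in> S")
    case False
    have "from_local p ` S = Some ` {z. z \<noteq> 0 \<and> 1 / z \<in> S}"
    proof -
      have "x \<in> S \<Longrightarrow> from_local p x \<in> Some ` {z. z \<noteq> 0 \<and> 1 / z \<in> S}" for x
        using False by (auto simp: None from_local_def)
      moreover have "Some z \<in> from_local p ` S" if "z \<noteq> 0" "1 / z \<in> S" for z
        using that by (auto simp: None from_local_def image_iff intro!: bexI[of _ "1/z"])
      ultimately show ?thesis by auto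
    qed
    moreover have "{z. z \<noteq> 0 \<and> 1 / z \<in> S} = (- {0}) \<inter> (\<lambda>z. 1 / z) -` S"
      by auto
    moreover have "open ((- {0}) \<inter> (\<lambda>z::complex. 1 / z) -` S)"
      by (intro continuous_open_preimage continuous_intros) (use assms in auto)
    ultimately show ?thesis by simp
  next
    case True
    define C where "C = {z. z \<noteq> 0 \<longrightarrow> 1 / z \<in> S} \<inter> {z. z \<noteq> 0}"
    define K where "K = - C"
    have 1: "from_local p ` S = insert None (Some ` (- K))"
    proof -
      have "x \<in> S \<Longrightarrow> from_local p x \<in> insert None (Some ` (- K))" for x
        by (auto simp: None from_local_def K_def C_def)
      moreover have "Some z \<in> from_local p ` S" if "z \<in> C" for z
        using that by (auto simp: C_def None from_local_def image_iff intro!: bexI[of _ "1/z"])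
      moreover have "None \<in> from_local p ` S"
        using True by (auto simp: None from_local_def image_iff intro!: bexI[of _ 0])
      ultimately show ?thesis by (auto simp: K_def)
    qed
    have "C = (- {0}) \<inter> (\<lambda>z. 1 / z) -` S" by (auto simp: C_def)
    moreover have "open ((- {0}) \<inter> (\<lambda>z::complex. 1 / z) -` S)"
      by (intro continuous_open_preimage continuous_intros) (use assms in auto)
    ultimately have "open C" by simp
    then have "closed K" unfolding K_def by blast
    obtain e where e: "e > 0" "ball 0 e \<subseteq> S"
      by (rule openE[OF assms True])
    have "norm z \<le> 1 / e" if "z \<in> K" for z
    proof (rule ccontr)
      assume a: "\<not> norm z \<le> 1 / e"
      then have "z \<noteq> 0" using e(1) by auto
      then have "norm (1 / z) < e" using a e(1) by (simp add: norm_divide field_simps)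
      then have "z \<in> C" using e(2) \<open>z \<noteq> 0\<close> by (auto simp: C_def)
      then show False using that by (simp add: K_def)
    qed
    then have "compact K"
      using \<open>closed K\<close> by (auto simp: compact_eq_bounded_closed bounded_iff)
    then show ?thesis
      using \<open>closed K\<close> by (auto simp: 1 openin_Alexandroff_compactification Compl_eq_Diff_UNIV)
  qed
qed

lemma eventually_from_local_in:
  assumes "openin P1_top U" "p \<in> U"
  shows "eventually (\<lambda>w. from_local p w \<in> U) (nhds 0)"
proof -
  have "open {w. from_local p w \<in> U}"
    using continuous_from_local[of p] assms(1) by (auto simp: continuous_map_def)
  then show ?thesis
    unfolding eventually_nhds using assms(2) by (intro exI[of _ "{w. from_local p w \<in> U}"]) auto
qed

lemma near_in: "openin P1_top U \<Longrightarrow> p \<in> U \<Longrightarrow> near p (\<lambda>x. x \<in> U)"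
  unfolding near_def using eventually_from_local_in eventually_nhds_conv_at by blast

lemma near_not_in_finite:
  assumes "finite S"
  shows "near p (\<lambda>x. x \<notin> S)"
proof -
  have "finite (from_local p -` S)"
    using assms inj_from_local by (simp add: finite_vimageI)
  then have "\<not> 0 islimpt (from_local p -` S)"
    by (rule islimpt_finite)
  then show ?thesis
    unfolding near_def islimpt_iff_eventually by simp
qed

lemma openin_Compl_finite:
  assumes "finite S"
  shows "openin P1_top (- S)"
proof -
  have "closedin P1_top S"
  proof (rule t1_space_closedin_finite[THEN iffD1, rule_format])
    show "t1_space P1_top"
      by (simp add: Hausdorff_imp_t1_space)
    show "finite S \<and> S \<subseteq> topspace P1_top"
      using assms by auto (metis option.exhaust rangeI)
  qed
  moreover have "topspace P1_top = UNIV"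
    by auto (metis option.exhaust rangeI)
  ultimately show ?thesis
    by (metis closedin_def Compl_eq_Diff_UNIV)
qed

text \<open>Local parameters at nearby points are related by a holomorphic change of variable.  Infinity is the
  only point whose parameter is not a translate of \<open>z\<close>.\<close>

lemma from_local_transition:
  assumes "p = None \<Longrightarrow> w0 \<noteq> 0"
  obtains \<tau> where "\<tau> analytic_on {0}" "\<tau> 0 = w0"
    "eventually (\<lambda>u. from_local (from_local p w0) u = from_local p (\<tau> u)) (nhds 0)"
proof (cases p)
  case (Some a)
  show ?thesis
    by (rule that[of "\<lambda>u. w0 + u"]) (auto simp: Some add_ac intro!: analytic_intros)
next
  case None
  with assms have [simp]: "w0 \<noteq> 0" by simp
  have "eventually (\<lambda>u. u \<in> - {- (1 / w0)}) (nhds 0)"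
    by (intro eventually_nhds_in_open) auto
  then have "eventually (\<lambda>u. from_local (from_local p w0) u = from_local p (1 / (1 / w0 + u))) (nhds 0)"
    by eventually_elim (auto simp: None from_local_def add_eq_0_iff2)
  then show ?thesis
    by (intro that[of "\<lambda>u. 1 / (1 / w0 + u)"]) (auto intro!: analytic_intros)
qed

section \<open>Laurent expansions of meromorphic differentials\<close>

lemma has_germ_cong:
  assumes "near p (\<lambda>x. f x = g x)"
  shows "has_germ k p f F \<longleftrightarrow> has_germ k p g F"
  unfolding has_germ_def
  by (rule has_laurent_expansion_cong) (use assms in \<open>auto simp: near_def elim: eventually_mono\<close>)

lemma germ_eqI: "has_germ k p f F \<Longrightarrow> germ k p f = F"
  unfolding has_germ_def germ_def by (rule laurent_expansion_0_eqI)

lemma has_germ_unique: "has_germ k p f F \<Longrightarrow> has_germ k p f G \<Longrightarrow> F = G"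
  unfolding has_germ_def by (rule has_laurent_expansion_unique)

lemma has_germ_mult:
  assumes "has_germ k p f F" "has_germ l p g G"
  shows "has_germ (k + l) p (\<lambda>x. f x * g x) (F * G)"
  using has_laurent_expansion_mult[OF assms[unfolded has_germ_def]]
  unfolding has_germ_def by (simp add: power_add mult_ac)

lemma has_germ_add:
  assumes "has_germ k p f F" "has_germ k p g G"
  shows "has_germ k p (\<lambda>x. f x + g x) (F + G)"
  using has_laurent_expansion_add[OF assms[unfolded has_germ_def]]
  unfolding has_germ_def by (simp add: algebra_simps)

lemma has_germ_diff:
  assumes "has_germ k p f F" "has_germ k p g G"
  shows "has_germ k p (\<lambda>x. f x - g x) (F - G)"
  using has_laurent_expansion_diff[OF assms[unfolded has_germ_def]]
  unfolding has_germ_def by (simp add: algebra_simps)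

lemma has_germ_const: "has_germ 0 p (\<lambda>_. c) (fls_const c)"
  unfolding has_germ_def by simp

lemma has_germ_zero: "has_germ k p (\<lambda>_. 0) 0"
  unfolding has_germ_def by simp

lemma has_germ_cmult:
  assumes "has_germ k p f F"
  shows "has_germ k p (\<lambda>x. c * f x) (fls_const c * F)"
  using has_germ_mult[OF has_germ_const assms] by simp

text \<open>The expansion of \<open>dz/dw\<close>.\<close>

definition jac_fls :: "P1 \<Rightarrow> complex fls" where
  "jac_fls p = (case p of Some _ \<Rightarrow> 1 | None \<Rightarrow> - fls_X_intpow (-2))"

lemma jac_has_laurent_expansion: "jac p has_laurent_expansion jac_fls p"
proof (cases p)
  case None
  have "(\<lambda>w::complex. - (w powi (-2))) has_laurent_expansion - (fls_X_intpow (-2))"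
    by (intro laurent_expansion_intros)
  moreover have "(\<lambda>w::complex. - (w powi (-2))) = jac p"
    by (auto simp: None jac_def fun_eq_iff power_int_def field_simps)
  ultimately show ?thesis by (simp add: jac_fls_def None)
next
  case (Some a)
  then have "jac p = (\<lambda>_. 1)" "jac_fls p = 1" by (auto simp: jac_fls_def)
  then show ?thesis by simp
qed

lemma jac_fls_nonzero [simp]: "jac_fls p \<noteq> 0"
  by (auto simp: jac_fls_def fls_shift_eq0_iff split: option.splits)

lemma fls_subdegree_jac_fls: "fls_subdegree (jac_fls p) = (if p = None then - 2 else 0)"
  by (auto simp: jac_fls_def split: option.splits)

lemma jac_nonzero: "w \<noteq> 0 \<Longrightarrow> jac p w \<noteq> 0"
  by (auto simp: jac_def split: option.splits)

text \<open>Since \<open>jac\<close> does not vanish away from the centre, germs of functions and germs of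
  \<open>k\<close>-differentials determine each other; this transfers facts about functions to differentials.\<close>

lemma has_germ_twist:
  "has_germ k p f F \<longleftrightarrow> has_germ 0 p f (F / jac_fls p ^ k)"
proof
  assume "has_germ k p f F"
  then have "(\<lambda>w. f (from_local p w) * jac p w ^ k / jac p w ^ k) has_laurent_expansion F / jac_fls p ^ k"
    unfolding has_germ_def by (intro laurent_expansion_intros jac_has_laurent_expansion)
  moreover have "eventually (\<lambda>w. f (from_local p w) * jac p w ^ k / jac p w ^ k = f (from_local p w) * jac p w ^ 0) (at 0)"
    by (auto simp: eventually_at_filter jac_nonzero)
  ultimately show "has_germ 0 p f (F / jac_fls p ^ k)"
    unfolding has_germ_def by (subst has_laurent_expansion_cong[symmetric, OF _ refl])
next
  assume "has_germ 0 p f (F / jac_fls p ^ k)"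
  then have "(\<lambda>w. f (from_local p w) * jac p w ^ k) has_laurent_expansion (F / jac_fls p ^ k * jac_fls p ^ k)"
    unfolding has_germ_def power_0 mult_1_right
    by (intro laurent_expansion_intros jac_has_laurent_expansion)
  moreover have "F / jac_fls p ^ k * jac_fls p ^ k = F" by simp
  ultimately show "has_germ k p f F"
    unfolding has_germ_def by metis
qed

lemma has_germ_shift_degree:
  assumes "has_germ k p f F" "k \<le> l"
  shows "has_germ l p f (F * jac_fls p ^ (l - k))"
proof -
  have "F * jac_fls p ^ (l - k) / jac_fls p ^ l = F / jac_fls p ^ k"
    using assms(2) by (simp add: field_simps flip: power_add)
  then show ?thesis
    using assms(1) has_germ_twist by metis
qed

lemma mero_has_germ:
  assumes "f \<in> mero U" "p \<in> U"
  shows "has_germ k p f (germ k p f)"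
proof -
  have "(\<lambda>w. f (from_local p w)) meromorphic_on {0}"
    using assms by (auto simp: mero_def nicely_meromorphic_on_def)
  then obtain F where "has_germ 0 p f F"
    by (auto simp: meromorphic_on_def has_germ_def)
  then have "has_germ k p f (F * jac_fls p ^ k)"
    using has_germ_shift_degree[of 0 p f F k] by simp
  then show ?thesis by (simp add: germ_eqI)
qed

lemma remove_sings_nicely:
  assumes "f nicely_meromorphic_on {z}"
  shows "remove_sings f z = f z"
  using assms unfolding nicely_meromorphic_on_def
  by (metis remove_sings_at_pole remove_sings_eqI singletonI)

lemma mero_of_mero:
  assumes "f \<in> mero U"
  shows "mero_of U f = f"
proof
  fix p
  show "mero_of U f p = f p"
    using assms remove_sings_nicely[of "\<lambda>w. f (from_local p w)" 0]
    by (auto simp: mero_of_def mero_def)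
qed

lemma mero_of_cong:
  assumes "\<And>p. p \<in> U \<Longrightarrow> near p (\<lambda>x. f x = g x)"
  shows "mero_of U f = mero_of U g"
proof
  fix p
  show "mero_of U f p = mero_of U g p"
    using assms[of p] by (auto simp: mero_of_def near_def intro!: remove_sings_cong)
qed

lemma near_eqI_germ:
  assumes "has_germ k p f F" "has_germ k p g F"
  shows "near p (\<lambda>x. f x = g x)"
proof -
  have "eventually (\<lambda>w. f (from_local p w) * jac p w ^ k = g (from_local p w) * jac p w ^ k) (at 0)"
    using assms unfolding has_germ_def has_laurent_expansion_def
    by (auto elim: eventually_elim2)
  moreover have "eventually (\<lambda>w. w \<noteq> 0) (at (0::complex))"
    by (simp add: eventually_at_filter)
  ultimately show ?thesis
    unfolding near_def by eventually_elim (auto simp: jac_nonzero)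
qed

text \<open>Elements of \<open>mero U\<close> are determined at each point by their values nearby.  Together with
  \<open>near_eqI_germ\<close> this reduces identities between sections to identities between Laurent series.\<close>

lemma mero_eqI:
  assumes "f \<in> mero U" "g \<in> mero U" "\<And>p. p \<in> U \<Longrightarrow> near p (\<lambda>x. f x = g x)"
  shows "f = g"
  using mero_of_mero[OF assms(1)] mero_of_mero[OF assms(2)] mero_of_cong[OF assms(3)] by metis

lemma analytic_at_shift: "(\<lambda>u. g (z + u)) analytic_on {0} \<longleftrightarrow> g analytic_on {z::complex}"
proof
  assume "(\<lambda>u. g (z + u)) analytic_on {0}"
  then have "((\<lambda>u. g (z + u)) \<circ> (\<lambda>x. x - z)) analytic_on {z}"
    by (intro analytic_on_compose analytic_intros) simp
  then show "g analytic_on {z}" by (simp add: o_def)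
next
  assume "g analytic_on {z}"
  then have "(g \<circ> (\<lambda>u. z + u)) analytic_on {0}"
    by (intro analytic_on_compose analytic_intros) simp
  then show "(\<lambda>u. g (z + u)) analytic_on {0}" by (simp add: o_def)
qed

text \<open>Poles are isolated; seen from a nearby point \<open>x\<close>, the function is the composition of its expression
  in the parameter at \<open>p\<close> with the transition map.\<close>

lemma has_germ_near_analytic:
  assumes "has_germ k p f F"
  shows "near p (\<lambda>x. \<forall>z. x = Some z \<longrightarrow> (\<lambda>z. f (Some z)) analytic_on {z})"
proof -
  define h where "h = (\<lambda>w. f (from_local p w))"
  have "h has_laurent_expansion F / jac_fls p ^ k"
    using assms unfolding has_germ_twist[of k] by (simp add: has_germ_def h_def)
  then have "isolated_singularity_at h 0"
    by (rule has_laurent_expansion_isolated_0)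
  then obtain r where r: "r > 0" "h analytic_on ball 0 r - {0}"
    by (auto simp: isolated_singularity_at_def)
  have "eventually (\<lambda>w. w \<in> ball 0 r - {0}) (at (0::complex))"
    using r(1) by (intro eventually_at_in_open) auto
  then show ?thesis unfolding near_def
  proof eventually_elim
    case (elim w)
    then have h: "h analytic_on {w}"
      by (intro analytic_on_subset[OF r(2)]) auto
    show ?case
    proof safe
      fix z assume z: "from_local p w = Some z"
      obtain \<tau> where \<tau>: "\<tau> analytic_on {0}" "\<tau> 0 = w"
        "eventually (\<lambda>u. from_local (from_local p w) u = from_local p (\<tau> u)) (nhds 0)"
        using from_local_transition[of p w] elim by auto
      have "(h \<circ> \<tau>) analytic_on {0}"
        using \<tau>(1,2) h by (intro analytic_on_compose) auto
      moreover have "eventually (\<lambda>u. (h \<circ> \<tau>) u = f (Some (z + u))) (nhds 0)"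
        using \<tau>(3) by eventually_elim (simp add: h_def z flip: from_local_Some)
      ultimately have "(\<lambda>u. f (Some (z + u))) analytic_on {0}"
        using analytic_at_cong[OF _ refl, of "h \<circ> \<tau>" "\<lambda>u. f (Some (z + u))" 0] by simp
      then show "(\<lambda>z. f (Some z)) analytic_on {z}"
        by (simp add: analytic_at_shift[of "\<lambda>z. f (Some z)" z])
    qed
  qed
qed

lemma has_germ_near_continuous:
  assumes "has_germ k p f F"
  shows "near p (\<lambda>x. (\<lambda>u. f (from_local x u)) \<midarrow>0\<rightarrow> f x)"
proof (rule near_mono[OF near_conj[OF has_germ_near_analytic[OF assms] near_not_in_finite[of "{None}"]]])
  fix x assume "(\<forall>z. x = Some z \<longrightarrow> (\<lambda>z. f (Some z)) analytic_on {z}) \<and> x \<notin> {None}"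
  then obtain z where x: "x = Some z" and "(\<lambda>z. f (Some z)) analytic_on {z}" by auto
  then have "(\<lambda>u. f (Some (z + u))) analytic_on {0}"
    by (simp add: analytic_at_shift[of "\<lambda>z. f (Some z)" z])
  from analytic_at_imp_isCont[OF this] show "(\<lambda>u. f (from_local x u)) \<midarrow>0\<rightarrow> f x"
    by (simp add: isCont_def x)
qed simp

text \<open>Passing to the representative changes \<open>f\<close> only at points where it is not continuous, and these are
  isolated.\<close>

lemma near_mero_of:
  assumes "openin P1_top U" "p \<in> U" "has_germ k p f F"
  shows "near p (\<lambda>x. mero_of U f x = f x)"
proof -
  have "near p (\<lambda>x. x \<in> U \<and> (\<lambda>u. f (from_local x u)) \<midarrow>0\<rightarrow> f x)"
    by (intro near_conj near_in has_germ_near_continuous[OF assms(3)] assms)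
  then show ?thesis
    by (rule near_mono) (auto simp: mero_of_def)
qed

lemma has_germ_mero_of:
  assumes "openin P1_top U" "p \<in> U" "has_germ k p f F"
  shows "has_germ k p (mero_of U f) F"
  using has_germ_cong[OF near_mero_of[OF assms]] assms(3) by simp

lemma mero_of_in_mero:
  assumes "openin P1_top U" "\<And>p. p \<in> U \<Longrightarrow> \<exists>k F. has_germ k p f F"
  shows "mero_of U f \<in> mero U"
  unfolding mero_def
proof (safe)
  fix p assume p: "p \<in> U"
  then obtain k F where F: "has_germ k p f F" using assms(2) by blast
  define h where "h = (\<lambda>w. f (from_local p w))"
  have h: "h has_laurent_expansion F / jac_fls p ^ k"
    using F unfolding has_germ_twist[of k] by (simp add: has_germ_def h_def)
  then have "h meromorphic_on {0}"
    by (auto simp: meromorphic_on_def)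
  then have n: "remove_sings h nicely_meromorphic_on {0}"
    by (rule remove_sings_nicely_meromorphic)
  have ev: "eventually (\<lambda>w. remove_sings h w = mero_of U f (from_local p w)) (at 0)"
    using near_mero_of[OF assms(1) p F] eventually_remove_sings_eq_at[OF has_laurent_expansion_isolated_0[OF h]]
    unfolding near_def by eventually_elim (simp add: h_def)
  have eq0: "remove_sings h 0 = mero_of U f (from_local p 0)"
    using p by (simp add: mero_of_def h_def)
  have 1: "(\<lambda>w. mero_of U f (from_local p w)) meromorphic_on {0}"
    using has_germ_mero_of[OF assms(1) p F] unfolding has_germ_twist[of k]
    by (auto simp: meromorphic_on_def has_germ_def)
  have 2: "remove_sings h \<midarrow>0\<rightarrow> remove_sings h 0 \<longleftrightarrow>
     (\<lambda>w. mero_of U f (from_local p w)) \<midarrow>0\<rightarrow> mero_of U f (from_local p 0)"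
    by (rule filterlim_cong) (use ev eq0 in auto)
  have 3: "is_pole (remove_sings h) 0 \<longleftrightarrow> is_pole (\<lambda>w. mero_of U f (from_local p w)) 0"
    by (rule is_pole_cong) (use ev in auto)
  show "(\<lambda>w. mero_of U f (from_local p w)) nicely_meromorphic_on {0}"
    using n 1 2 unfolding nicely_meromorphic_on_def ball_simps 3 eq0 by auto
qed (auto simp: mero_of_def)

section \<open>Orders of vanishing and derivatives\<close>

text \<open>The order of vanishing is at least \<open>m\<close>, where the zero series has infinite order;
  \<open>fls_subdegree\<close> instead assigns it 0.\<close>

definition ord_ge :: "int \<Rightarrow> complex fls \<Rightarrow> bool" where
  "ord_ge m F \<longleftrightarrow> (\<forall>k<m. fls_nth F k = 0)"

lemma ord_ge_zero [simp]: "ord_ge m 0" by (simp add: ord_ge_def)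

lemma ord_ge_mono: "ord_ge m F \<Longrightarrow> m' \<le> m \<Longrightarrow> ord_ge m' F" by (auto simp: ord_ge_def)

lemma ord_ge_add: "ord_ge m F \<Longrightarrow> ord_ge m G \<Longrightarrow> ord_ge m (F + G)" by (auto simp: ord_ge_def)

lemma ord_ge_diff: "ord_ge m F \<Longrightarrow> ord_ge m G \<Longrightarrow> ord_ge m (F - G)" by (auto simp: ord_ge_def)

lemma ord_ge_minus: "ord_ge m (- F) = ord_ge m F" by (auto simp: ord_ge_def)

text \<open>In general differentiation lowers the order by one; here it does not, because the constant term is
  killed.\<close>

lemma ord_ge_0_deriv:
  assumes "ord_ge 0 F"
  shows "ord_ge 0 (fls_deriv F)"
  unfolding ord_ge_def
proof safe
  fix k :: int assume "k < 0"
  then show "fls_nth (fls_deriv F) k = 0"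
    using assms by (cases "k = -1") (auto simp: ord_ge_def)
qed

lemma ord_ge_iff: "ord_ge m F \<longleftrightarrow> F = 0 \<or> m \<le> fls_subdegree F"
proof (cases "F = 0")
  case False
  have "m \<le> fls_subdegree F" if "ord_ge m F"
    using that False by (intro fls_subdegree_geI) (auto simp: ord_ge_def)
  then show ?thesis using False by (auto simp: ord_ge_def)
qed simp

lemma ord_ge_iff_subdegree: "m \<le> 0 \<Longrightarrow> ord_ge m F \<longleftrightarrow> m \<le> fls_subdegree F"
  by (auto simp: ord_ge_iff)

lemma ord_ge_mult: "ord_ge m F \<Longrightarrow> ord_ge k G \<Longrightarrow> ord_ge (m + k) (F * G)"
  by (cases "F = 0 \<or> G = 0") (auto simp: ord_ge_iff)

lemma ord_ge_mult': "ord_ge m F \<Longrightarrow> ord_ge k G \<Longrightarrow> m + k = l \<Longrightarrow> ord_ge l (F * G)"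
  using ord_ge_mult by blast

lemma ord_ge_const [simp]: "ord_ge 0 (fls_const c)" by (auto simp: ord_ge_def)

lemma ord_ge_X_inv_power: "ord_ge (- int n) (fls_X_inv ^ n)" by (auto simp: ord_ge_def)

lemma ord_ge_X_power: "ord_ge (int n) (fls_X ^ n)" by (auto simp: ord_ge_def)

lemma X_inv_X_power: "fls_X_inv ^ n * fls_X ^ n = (1 :: complex fls)"
  by (metis fls_X_inv_nonzero fls_inverse_X_inv left_inverse power_inverse power_mult_distrib power_one right_inverse)

text \<open>The connection on \<open>\<Omega>\<^sup>1\<close> for which \<open>dz\<close> is horizontal has this coefficient in the frame \<open>dw\<close>:
  it is \<open>- J'/J\<close> for \<open>J = dz/dw\<close>, so \<open>2/w\<close> at infinity.\<close>

definition flat_coeff :: "P1 \<Rightarrow> complex fls" where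
  "flat_coeff p = (if p = None then 2 * fls_X_inv else 0)"

lemma fls_deriv_jac_fls: "fls_deriv (jac_fls p) = - flat_coeff p * jac_fls p"
proof (cases p)
  case None
  have "fls_X_intpow (-2) = (fls_X_inv ^ 2 :: complex fls)"
    by (simp add: fls_X_inv_power_conv_shift_1)
  then have "jac_fls p = - (fls_X_inv ^ 2)" by (simp add: None jac_fls_def)
  then show ?thesis
    by (simp add: flat_coeff_def None fls_deriv_X_inv_power power2_eq_square power3_eq_cube numeral_eq_Suc algebra_simps del: One_nat_def)
qed (auto simp: jac_fls_def flat_coeff_def)

text \<open>The value at infinity is arbitrary: \<open>ddz h\<close> is used only through its germs.\<close>

definition ddz :: "(P1 \<Rightarrow> complex) \<Rightarrow> P1 \<Rightarrow> complex" where
  "ddz h p = (case p of Some a \<Rightarrow> deriv (\<lambda>z. h (Some z)) a | None \<Rightarrow> 0)"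

lemma exterior_d_eq: "exterior_d U h = mero_of U (ddz h)"
  by (simp add: exterior_d_def ddz_def[abs_def])

text \<open>This is the chain rule \<open>(dh/dz) (dz/dw) = dh/dw\<close>: the exterior derivative does not depend on the
  local parameter.\<close>

lemma has_germ_ddz:
  assumes "has_germ 0 p f F"
  shows "has_germ 1 p (ddz f) (fls_deriv F)"
proof -
  define h where "h = (\<lambda>w. f (from_local p w))"
  have h: "h has_laurent_expansion F"
    using assms by (simp add: has_germ_def h_def)
  then have d: "deriv h has_laurent_expansion fls_deriv F"
    by (rule has_laurent_expansion_deriv)
  obtain r where r: "r > 0" "h analytic_on ball 0 r - {0}"
    using has_laurent_expansion_isolated_0[OF h] by (auto simp: isolated_singularity_at_def)
  have "eventually (\<lambda>w. w \<in> ball 0 r - {0}) (at (0::complex))"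
    using r(1) by (intro eventually_at_in_open) auto
  then have "eventually (\<lambda>w. deriv h w = ddz f (from_local p w) * jac p w ^ 1) (at 0)"
  proof eventually_elim
    case (elim w)
    then have "h analytic_on {w}"
      by (intro analytic_on_subset[OF r(2)]) auto
    then have dh: "(h has_field_derivative deriv h w) (at w)"
      using analytic_on_imp_differentiable_at[of h "{w}" w] DERIV_deriv_iff_field_differentiable by auto
    show ?case
    proof (cases p)
      case (Some a)
      have "(\<lambda>z. f (Some z)) = (\<lambda>z. h (z - a))"
        by (auto simp: h_def Some)
      moreover have "((\<lambda>z. h (z - a)) has_field_derivative deriv h w) (at (a + w))"
        using DERIV_at_within_shift[of h "deriv h w" "-a" "a + w" UNIV] dh
        by (simp add: DERIV_shift[of h _ "-a + (a + w)" a, symmetric] flip: diff_conv_add_uminus)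
      ultimately show ?thesis
        by (auto simp: Some ddz_def intro!: DERIV_imp_deriv[symmetric])
    next
      case None
      have w: "w \<noteq> 0" using elim by auto
      have 1: "((\<lambda>z. h (1 / z)) has_field_derivative deriv h w * (- (w ^ 2))) (at (1 / w))"
      proof (rule DERIV_chain2[of h])
        show "(h has_field_derivative deriv h w) (at (1 / (1 / w)))"
          using dh by simp
        show "((\<lambda>z. 1 / z) has_field_derivative - (w ^ 2)) (at (1 / w))"
          using w by (auto intro!: derivative_eq_intros simp: power2_eq_square)
      qed
      have "eventually (\<lambda>z. z \<in> - {0}) (nhds (1 / w))"
        using w by (intro eventually_nhds_in_open) auto
      then have "eventually (\<lambda>z. h (1 / z) = f (Some z)) (nhds (1 / w))"
        by eventually_elim (auto simp: h_def None from_local_def)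
      then have "((\<lambda>z. f (Some z)) has_field_derivative deriv h w * (- (w ^ 2))) (at (1 / w))"
        using 1 by (rule DERIV_cong_ev[OF refl _ refl, THEN iffD1])
      then have "ddz f (Some (1 / w)) = deriv h w * (- (w ^ 2))"
        by (auto simp: ddz_def intro: DERIV_imp_deriv)
      then show ?thesis
        using w by (simp add: None from_local_def jac_def)
    qed
  qed
  then show ?thesis
    unfolding has_germ_def using d by (subst has_laurent_expansion_cong[symmetric, OF _ refl])
qed

text \<open>Deriving the coefficient of \<open>g dz\<close> is the connection with \<open>dz\<close> horizontal, which explains the extra
  term in other frames.\<close>

lemma has_germ_ddz_form:
  assumes "has_germ 1 p g G"
  shows "has_germ 2 p (ddz g) (fls_deriv G + flat_coeff p * G)"
proof -
  define G0 where "G0 = G / jac_fls p"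
  have G: "G = G0 * jac_fls p" by (simp add: G0_def)
  have "has_germ 0 p g G0"
    using assms has_germ_twist[of 1 p g G] by (simp add: G0_def)
  then have "has_germ 2 p (ddz g) (fls_deriv G0 * jac_fls p)"
    using has_germ_shift_degree[OF has_germ_ddz, of p g G0 2] by simp
  moreover have "fls_deriv G0 * jac_fls p = fls_deriv G + flat_coeff p * G"
    by (simp add: G fls_deriv_jac_fls algebra_simps)
  ultimately show ?thesis by simp
qed

lemma has_germ_mult_fun: "has_germ 0 p f F \<Longrightarrow> has_germ k p g G \<Longrightarrow> has_germ k p (\<lambda>x. f x * g x) (F * G)"
  using has_germ_mult[of 0 p f F k g G] by simp

lemma has_germ_mult_fun_right: "has_germ k p f F \<Longrightarrow> has_germ 0 p g G \<Longrightarrow> has_germ k p (\<lambda>x. f x * g x) (F * G)"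
  using has_germ_mult[of k p f F 0 g G] by simp

lemma has_germ_eq_rhs: "has_germ k p f F \<Longrightarrow> G = F \<Longrightarrow> has_germ k p f G"
  by simp

lemma has_germ_mult_20: "has_germ 2 p f F \<Longrightarrow> has_germ 0 p g G \<Longrightarrow> has_germ 2 p (\<lambda>x. f x * g x) (F * G)"
  using has_germ_mult[of 2 p f F 0 g G] by simp

lemma has_germ_mult_11: "has_germ 1 p f F \<Longrightarrow> has_germ 1 p g G \<Longrightarrow> has_germ 2 p (\<lambda>x. f x * g x) (F * G)"
  using has_germ_mult[of 1 p f F 1 g G] by (simp add: numeral_2_eq_2)

section \<open>Sections of the bundle\<close>

lemma sectI:
  assumes "openin P1_top U" "\<And>p. p \<in> U \<Longrightarrow> \<exists>F. has_germ k p f F \<and> ord_ge (- int (count D p)) F"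
  shows "mero_of U f \<in> sect k D U"
  unfolding sect_def
proof safe
  show "mero_of U f \<in> mero U"
    using assms by (intro mero_of_in_mero) blast+
  fix p assume p: "p \<in> U"
  then obtain F where F: "has_germ k p f F" "ord_ge (- int (count D p)) F"
    using assms(2) by blast
  then show "- int (count D p) \<le> fls_subdegree (germ k p (mero_of U f))"
    using has_germ_mero_of[OF assms(1) p F(1)] germ_eqI ord_ge_iff_subdegree by fastforce
qed

lemma sect_mero: "f \<in> sect k D U \<Longrightarrow> f \<in> mero U"
  by (simp add: sect_def)

lemma sectE:
  assumes "f \<in> sect k D U" "p \<in> U"
  obtains F where "has_germ k p f F" "ord_ge (- int (count D p)) F"
  using assms mero_has_germ[of f U p k] that[of "germ k p f"]
  by (auto simp: sect_def ord_ge_iff_subdegree)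

lemma E0E:
  assumes "s \<in> E0 D U" "p \<in> U"
  obtains F G where "has_germ 0 p (fst s) F" "has_germ 1 p (snd s) G"
    "ord_ge 0 F" "ord_ge (- int (count D p)) G"
proof -
  have "fst s \<in> hol U" "snd s \<in> sect 1 D U"
    using assms(1) by (auto simp: E0_def)
  then obtain F G where "has_germ 0 p (fst s) F" "ord_ge (- int (count {#} p)) F"
    "has_germ 1 p (snd s) G" "ord_ge (- int (count D p)) G"
    using sectE assms(2) by metis
  then show ?thesis by (intro that) auto
qed

text \<open>The representative depends only on local values, so it commutes with restriction.\<close>

lemma mero_of_restrict: "V \<subseteq> U \<Longrightarrow> (\<lambda>p. if p \<in> V then mero_of U f p else 0) = mero_of V f"
  by (auto simp: mero_of_def fun_eq_iff)

lemma restrict_section_mero_of: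
  "V \<subseteq> U \<Longrightarrow> restrict_section V (mero_of U f, mero_of U g) = (mero_of V f, mero_of V g)"
  unfolding restrict_section_def fst_conv snd_conv by (simp add: mero_of_restrict)

lemma restrict_section_eq:
  assumes "V \<subseteq> U" "fst s \<in> mero U" "snd s \<in> mero U"
  shows "restrict_section V s = (mero_of V (fst s), mero_of V (snd s))"
  using restrict_section_mero_of[OF assms(1), of "fst s" "snd s"] assms(2,3)
  by (simp add: mero_of_mero)

lemma E0_mero: "s \<in> E0 D U \<Longrightarrow> fst s \<in> mero U" "s \<in> E0 D U \<Longrightarrow> snd s \<in> mero U"
  by (auto simp: E0_def sect_def)

lemma E0I:
  assumes "openin P1_top U"
    "\<And>p. p \<in> U \<Longrightarrow> \<exists>F G. has_germ 0 p f F \<and> has_germ 1 p g G \<and> ord_ge 0 F \<and> ord_ge (- int (count D p)) G"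
  shows "(mero_of U f, mero_of U g) \<in> E0 D U"
  unfolding E0_def using assms(2) by (auto intro!: sectI assms(1)) blast+

lemma restrict_section_E0:
  assumes "s \<in> E0 D U" "V \<subseteq> U" "openin P1_top V"
  shows "restrict_section V s \<in> E0 D V"
  unfolding restrict_section_eq[OF assms(2) E0_mero[OF assms(1)]]
  by (intro E0I assms) (use assms E0E in \<open>metis subsetD\<close>)

lemma add_section_E0:
  assumes "s \<in> E0 D U" "t \<in> E0 D U" "openin P1_top U"
  shows "add_section U s t \<in> E0 D U"
  unfolding add_section_def
proof (intro E0I assms)
  fix p assume p: "p \<in> U"
  from E0E[OF assms(1) p] obtain F G where 1: "has_germ 0 p (fst s) F" "has_germ 1 p (snd s) G"
    "ord_ge 0 F" "ord_ge (- int (count D p)) G" .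
  from E0E[OF assms(2) p] obtain F' G' where 2: "has_germ 0 p (fst t) F'" "has_germ 1 p (snd t) G'"
    "ord_ge 0 F'" "ord_ge (- int (count D p)) G'" .
  show "\<exists>F G. has_germ 0 p (\<lambda>p. fst s p + fst t p) F \<and> has_germ 1 p (\<lambda>p. snd s p + snd t p) G \<and>
      ord_ge 0 F \<and> ord_ge (- int (count D p)) G"
    using 1 2 by (intro exI[of _ "F + F'"] exI[of _ "G + G'"]) (auto intro: has_germ_add ord_ge_add)
qed

lemma mult_section_E0:
  assumes "s \<in> E0 D U" "\<And>p. p \<in> U \<Longrightarrow> \<exists>H. has_germ 0 p h H \<and> ord_ge 0 H" "openin P1_top U"
  shows "mult_section U h s \<in> E0 D U"
  unfolding mult_section_def
proof (intro E0I assms)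
  fix p assume p: "p \<in> U"
  from E0E[OF assms(1) p] obtain F G where 1: "has_germ 0 p (fst s) F" "has_germ 1 p (snd s) G"
    "ord_ge 0 F" "ord_ge (- int (count D p)) G" .
  from assms(2)[OF p] obtain H where 2: "has_germ 0 p h H" "ord_ge 0 H" by blast
  show "\<exists>F G. has_germ 0 p (\<lambda>p. h p * fst s p) F \<and> has_germ 1 p (\<lambda>p. h p * snd s p) G \<and>
      ord_ge 0 F \<and> ord_ge (- int (count D p)) G"
    using 1 2 ord_ge_mult[of 0 H _ F] ord_ge_mult[of 0 H _ G]
    by (intro exI[of _ "H * F"] exI[of _ "H * G"]) (auto intro: has_germ_mult_fun)
qed

lemma hol_germ: "h \<in> hol U \<Longrightarrow> p \<in> U \<Longrightarrow> \<exists>H. has_germ 0 p h H \<and> ord_ge 0 H"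
  by (erule (1) sectE) auto

section \<open>The connection with given coefficients\<close>

text \<open>The two components of the image of \<open>(f, g dz)\<close>.  In the frame \<open>(1, dz)\<close> the connection matrix has
  columns \<open>(0, \<gamma>)\<close> and \<open>(1, \<delta>)\<close>.\<close>

abbreviation nabla_fst :: "(P1 \<Rightarrow> complex) \<Rightarrow> (P1 \<Rightarrow> complex) \<Rightarrow> P1 \<Rightarrow> complex" where
  "nabla_fst f g x \<equiv> ddz f x + g x"

abbreviation nabla_snd :: "(P1 \<Rightarrow> complex) \<Rightarrow> (P1 \<Rightarrow> complex) \<Rightarrow>
    (P1 \<Rightarrow> complex) \<Rightarrow> (P1 \<Rightarrow> complex) \<Rightarrow> P1 \<Rightarrow> complex" where
  "nabla_snd \<gamma> \<delta> f g x \<equiv> \<gamma> x * f x + (ddz g x + \<delta> x * g x)"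

text \<open>Sections are replaced by their representatives; outside of the sections the value is the one that
  \<open>is_connection\<close> demands.\<close>

definition conn :: "divisor \<Rightarrow> (P1 \<Rightarrow> complex) \<Rightarrow> (P1 \<Rightarrow> complex) \<Rightarrow> connection" where
  "conn D \<gamma> \<delta> U s = (if openin P1_top U \<and> s \<in> E0 D U
     then (mero_of U (\<lambda>x. nabla_fst (fst s) (snd s) x),
           mero_of U (\<lambda>x. nabla_snd \<gamma> \<delta> (fst s) (snd s) x))
     else undefined)"

lemma conn_germs:
  assumes "has_germ 2 p \<gamma> \<Gamma>" "has_germ 1 p \<delta> \<Delta>" "has_germ 0 p f F" "has_germ 1 p g G"
  shows "has_germ 1 p (\<lambda>x. nabla_fst f g x) (fls_deriv F + G)"
    "has_germ 2 p (\<lambda>x. nabla_snd \<gamma> \<delta> f g x)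
       (\<Gamma> * F + (fls_deriv G + flat_coeff p * G + \<Delta> * G))"
  by (intro has_germ_add has_germ_ddz has_germ_ddz_form has_germ_mult_20 has_germ_mult_11 assms)+

lemma conn_in:
  assumes "openin P1_top U" "s \<in> E0 D U"
  shows "conn D \<gamma> \<delta> U s = (mero_of U (\<lambda>x. nabla_fst (fst s) (snd s) x),
           mero_of U (\<lambda>x. nabla_snd \<gamma> \<delta> (fst s) (snd s) x))"
  using assms by (simp add: conn_def)

text \<open>The trace of the connection matrix in the standard frame \<open>1, dw/w\<^sup>n\<close>.  The last term is the
  logarithmic derivative of \<open>w\<^sup>-\<^sup>n\<close>.\<close>

definition trace_fls :: "divisor \<Rightarrow> (P1 \<Rightarrow> complex fls) \<Rightarrow> P1 \<Rightarrow> complex fls" where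
  "trace_fls D \<Delta> p = flat_coeff p + \<Delta> p - of_nat (count D p) * fls_X_inv"

text \<open>In the frame \<open>dw/w\<^sup>n\<close> of \<open>\<Omega>\<^sup>1(D)\<close> the coefficient of this rank one connection is
  \<open>K - n/w\<close>, and only the order of its pole counts.\<close>

lemma ord_ge_covariant_deriv:
  assumes "ord_ge (- int n) G" "ord_ge (- m) (K - of_nat n * fls_X_inv)" "m \<ge> 0"
  shows "ord_ge (- int n - m) (fls_deriv G + K * G)"
proof -
  \<comment> \<open>the coefficient of the section in the frame \<open>dw/w\<^sup>n\<close>\<close>
  define H where "H = fls_X ^ n * G"
  have G: "G = fls_X_inv ^ n * H"
    using X_inv_X_power[of n] by (simp add: H_def flip: mult.assoc)
  have H: "ord_ge 0 H"
    unfolding H_def by (rule ord_ge_mult'[OF ord_ge_X_power assms(1)]) simp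
  have "fls_deriv G + K * G = fls_X_inv ^ n * (fls_deriv H + (K - of_nat n * fls_X_inv) * H)"
    by (simp add: G fls_deriv_X_inv_power algebra_simps)
  moreover have "ord_ge (- m) (fls_deriv H + (K - of_nat n * fls_X_inv) * H)"
    using ord_ge_mult[OF assms(2) H] ord_ge_mono[OF ord_ge_0_deriv[OF H], of "- m"] assms(3) by (intro ord_ge_add) auto
  ultimately show ?thesis
    using ord_ge_mult[OF ord_ge_X_inv_power] by fastforce
qed

lemma add_section_components:
  "fst (add_section U s t) = mero_of U (\<lambda>p. fst s p + fst t p)"
  "snd (add_section U s t) = mero_of U (\<lambda>p. snd s p + snd t p)"
  by (auto simp: add_section_def)

lemma mult_section_components:
  "fst (mult_section U h s) = mero_of U (\<lambda>p. h p * fst s p)"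
  "snd (mult_section U h s) = mero_of U (\<lambda>p. h p * snd s p)"
  by (auto simp: mult_section_def)

text \<open>Both sides have the same germs at every point of \<open>V\<close>, because \<open>conn\<close> acts on germs.\<close>

lemma conn_restrict:
  assumes \<gamma>: "\<And>p. has_germ 2 p \<gamma> (\<Gamma> p)" and \<delta>: "\<And>p. has_germ 1 p \<delta> (\<Delta> p)"
    and U: "openin P1_top U" and V: "openin P1_top V" "V \<subseteq> U" and s: "s \<in> E0 D U"
  shows "conn D \<gamma> \<delta> V (restrict_section V s) = restrict_section V (conn D \<gamma> \<delta> U s)"
proof -
  have rs: "restrict_section V s \<in> E0 D V"
    by (rule restrict_section_E0[OF s V(2,1)])
  have rg: "has_germ 0 p (fst (restrict_section V s)) F \<longleftrightarrow> has_germ 0 p (fst s) F"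
    "has_germ 1 p (snd (restrict_section V s)) G \<longleftrightarrow> has_germ 1 p (snd s) G" if "p \<in> V" for p F G
    by (rule has_germ_cong, rule near_mono[OF near_in[OF V(1) that]], simp add: restrict_section_def)+
  show "conn D \<gamma> \<delta> V (restrict_section V s) = restrict_section V (conn D \<gamma> \<delta> U s)"
    unfolding conn_in[OF U s] conn_in[OF V(1) rs] restrict_section_mero_of[OF V(2)]
  proof (intro prod_eqI; unfold fst_conv snd_conv; intro mero_of_cong)
    fix p assume p: "p \<in> V"
    with V have "p \<in> U" by auto
    from E0E[OF s this] obtain F G where g: "has_germ 0 p (fst s) F" "has_germ 1 p (snd s) G" .
    note g' = g[folded rg[OF p]]
    show "near p (\<lambda>x. nabla_fst (fst (restrict_section V s)) (snd (restrict_section V s)) x =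
        nabla_fst (fst s) (snd s) x)"
      "near p (\<lambda>x. nabla_snd \<gamma> \<delta> (fst (restrict_section V s)) (snd (restrict_section V s)) x =
             nabla_snd \<gamma> \<delta> (fst s) (snd s) x)"
      by (rule near_eqI_germ; rule conn_germs[OF \<gamma> \<delta> g'] conn_germs[OF \<gamma> \<delta> g])+
  qed
qed

text \<open>Each algebraic clause is an identity between Laurent series.  The bounds on the poles of \<open>\<gamma>\<close> and of
  the trace ensure that the image of a section of \<open>E\<^sub>0\<close> has its poles bounded by \<open>D'\<close>.\<close>

lemma is_connection_conn:
  assumes \<gamma>: "\<And>p. has_germ 2 p \<gamma> (\<Gamma> p)" and \<delta>: "\<And>p. has_germ 1 p \<delta> (\<Delta> p)"
    and DD: "\<And>p. count D p \<le> count D' p"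
    and \<Gamma>: "\<And>p. ord_ge (- int (count (D + D') p)) (\<Gamma> p)"
    and tr: "\<And>p. ord_ge (- int (count D' p)) (trace_fls D \<Delta> p)"
  shows "is_connection D D' (conn D \<gamma> \<delta>)"
  unfolding is_connection_def
proof (intro conjI allI impI)
  fix U s
  assume "openin P1_top U \<and> s \<in> E0 D U"
  then have U: "openin P1_top U" and s: "s \<in> E0 D U" by auto
  have "\<exists>F. has_germ 1 p (\<lambda>x. nabla_fst (fst s) (snd s) x) F \<and> ord_ge (- int (count D' p)) F"
    "\<exists>F. has_germ 2 p (\<lambda>x. nabla_snd \<gamma> \<delta> (fst s) (snd s) x) F
      \<and> ord_ge (- int (count (D + D') p)) F" if p: "p \<in> U" for p
  proof -
    from E0E[OF s p] obtain F G where g: "has_germ 0 p (fst s) F" "has_germ 1 p (snd s) G"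
      "ord_ge 0 F" "ord_ge (- int (count D p)) G" .
    note c = conn_germs[OF \<gamma> \<delta> g(1,2)]
    have "ord_ge (- int (count D' p)) (fls_deriv F + G)"
    proof (rule ord_ge_add)
      show "ord_ge (- int (count D' p)) (fls_deriv F)"
        by (rule ord_ge_mono[OF ord_ge_0_deriv[OF g(3)]]) simp
      show "ord_ge (- int (count D' p)) G"
        using g(4) by (rule ord_ge_mono) (use DD[of p] in simp)
    qed
    then show "\<exists>F. has_germ 1 p (\<lambda>x. nabla_fst (fst s) (snd s) x) F \<and> ord_ge (- int (count D' p)) F"
      using c(1) by blast
    have "ord_ge (- int (count (D + D') p)) (\<Gamma> p * F)"
      using ord_ge_mult[OF \<Gamma> g(3)] by simp
    moreover have "ord_ge (- int (count (D + D') p)) (fls_deriv G + flat_coeff p * G + \<Delta> p * G)"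
      using ord_ge_covariant_deriv[OF g(4), of "int (count D' p)" "flat_coeff p + \<Delta> p"] tr[of p]
      by (simp add: trace_fls_def algebra_simps)
    ultimately show "\<exists>F. has_germ 2 p (\<lambda>x. nabla_snd \<gamma> \<delta> (fst s) (snd s) x) F
      \<and> ord_ge (- int (count (D + D') p)) F"
      using c(2) ord_ge_add by blast
  qed
  then show "conn D \<gamma> \<delta> U s \<in> E0_forms D D' U"
    unfolding conn_in[OF U s] E0_forms_def by (auto intro!: sectI U)
next
  fix U V s
  assume "openin P1_top U \<and> openin P1_top V \<and> V \<subseteq> U \<and> s \<in> E0 D U"
  then show "conn D \<gamma> \<delta> V (restrict_section V s) = restrict_section V (conn D \<gamma> \<delta> U s)"
    by (intro conn_restrict[OF \<gamma> \<delta>]) auto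
next
  fix U s t
  assume "openin P1_top U \<and> s \<in> E0 D U \<and> t \<in> E0 D U"
  then have U: "openin P1_top U" and s: "s \<in> E0 D U" and t: "t \<in> E0 D U" by auto
  note st = add_section_E0[OF s t U]
  show "conn D \<gamma> \<delta> U (add_section U s t) = add_section U (conn D \<gamma> \<delta> U s) (conn D \<gamma> \<delta> U t)"
    unfolding conn_in[OF U s] conn_in[OF U t] conn_in[OF U st]
  proof (intro prod_eqI; unfold add_section_components fst_conv snd_conv; intro mero_of_cong)
    fix p assume p: "p \<in> U"
    from E0E[OF s p] obtain F G where g: "has_germ 0 p (fst s) F" "has_germ 1 p (snd s) G" .
    from E0E[OF t p] obtain F' G' where g': "has_germ 0 p (fst t) F'" "has_germ 1 p (snd t) G'" .
    note mo = has_germ_mero_of[OF U p]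
    note l = conn_germs[OF \<gamma> \<delta> mo[OF has_germ_add[OF g(1) g'(1)]] mo[OF has_germ_add[OF g(2) g'(2)]]]
    note r = has_germ_add[OF mo[OF conn_germs(1)[OF \<gamma> \<delta> g]] mo[OF conn_germs(1)[OF \<gamma> \<delta> g']]]
      has_germ_add[OF mo[OF conn_germs(2)[OF \<gamma> \<delta> g]] mo[OF conn_germs(2)[OF \<gamma> \<delta> g']]]
    show "near p (\<lambda>x. nabla_fst (mero_of U (\<lambda>p. fst s p + fst t p)) (mero_of U (\<lambda>p. snd s p + snd t p)) x =
      mero_of U (\<lambda>x. nabla_fst (fst s) (snd s) x) x + mero_of U (\<lambda>x. nabla_fst (fst t) (snd t) x) x)"
      by (rule near_eqI_germ[OF l(1)], rule has_germ_eq_rhs[OF r(1)]) (simp add: algebra_simps)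
    show "near p (\<lambda>x. nabla_snd \<gamma> \<delta> (mero_of U (\<lambda>p. fst s p + fst t p)) (mero_of U (\<lambda>p. snd s p + snd t p)) x =
      mero_of U (\<lambda>x. nabla_snd \<gamma> \<delta> (fst s) (snd s) x) x +
      mero_of U (\<lambda>x. nabla_snd \<gamma> \<delta> (fst t) (snd t) x) x)"
      by (rule near_eqI_germ[OF l(2)], rule has_germ_eq_rhs[OF r(2)]) (simp add: algebra_simps)
  qed
next
  fix U c s
  assume "openin P1_top U \<and> s \<in> E0 D U"
  then have U: "openin P1_top U" and s: "s \<in> E0 D U" by auto
  have cs: "mult_section U (\<lambda>_. c) s \<in> E0 D U"
    by (rule mult_section_E0[OF s _ U]) (use has_germ_const ord_ge_const in blast)
  show "conn D \<gamma> \<delta> U (mult_section U (\<lambda>_. c) s) = mult_section U (\<lambda>_. c) (conn D \<gamma> \<delta> U s)"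
    unfolding conn_in[OF U s] conn_in[OF U cs]
  proof (intro prod_eqI; unfold mult_section_components fst_conv snd_conv; intro mero_of_cong)
    fix p assume p: "p \<in> U"
    from E0E[OF s p] obtain F G where g: "has_germ 0 p (fst s) F" "has_germ 1 p (snd s) G" .
    note mo = has_germ_mero_of[OF U p]
    note l = conn_germs[OF \<gamma> \<delta> mo[OF has_germ_cmult[OF g(1)]] mo[OF has_germ_cmult[OF g(2)]]]
    note r = has_germ_cmult[OF mo[OF conn_germs(1)[OF \<gamma> \<delta> g]]]
      has_germ_cmult[OF mo[OF conn_germs(2)[OF \<gamma> \<delta> g]]]
    show "near p (\<lambda>x. nabla_fst (mero_of U (\<lambda>p. c * fst s p)) (mero_of U (\<lambda>p. c * snd s p)) x =
      c * mero_of U (\<lambda>x. nabla_fst (fst s) (snd s) x) x)"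
      by (rule near_eqI_germ[OF l(1)], rule has_germ_eq_rhs[OF r(1)]) (simp add: algebra_simps)
    show "near p (\<lambda>x. nabla_snd \<gamma> \<delta> (mero_of U (\<lambda>p. c * fst s p)) (mero_of U (\<lambda>p. c * snd s p)) x =
      c * mero_of U (\<lambda>x. nabla_snd \<gamma> \<delta> (fst s) (snd s) x) x)"
      by (rule near_eqI_germ[OF l(2)], rule has_germ_eq_rhs[OF r(2)]) (simp add: algebra_simps)
  qed
next
  fix U h s
  assume "openin P1_top U \<and> h \<in> hol U \<and> s \<in> E0 D U"
  then have U: "openin P1_top U" and h: "h \<in> hol U" and s: "s \<in> E0 D U" by auto
  have hs: "mult_section U h s \<in> E0 D U"
    by (rule mult_section_E0[OF s _ U]) (use h hol_germ in blast)
  show "conn D \<gamma> \<delta> U (mult_section U h s) =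
      add_section U (mult_section U (exterior_d U h) s) (mult_section U h (conn D \<gamma> \<delta> U s))"
    unfolding conn_in[OF U s] conn_in[OF U hs] exterior_d_eq
  proof (intro prod_eqI; unfold mult_section_components add_section_components fst_conv snd_conv; intro mero_of_cong)
    fix p assume p: "p \<in> U"
    from E0E[OF s p] obtain F G where g: "has_germ 0 p (fst s) F" "has_germ 1 p (snd s) G" .
    obtain H where H: "has_germ 0 p h H" using hol_germ[OF h p] by blast
    note mo = has_germ_mero_of[OF U p]
    note l = conn_germs[OF \<gamma> \<delta> mo[OF has_germ_mult_fun[OF H g(1)]] mo[OF has_germ_mult_fun[OF H g(2)]]]
    have dH: "has_germ 1 p (mero_of U (ddz h)) (fls_deriv H)"
      by (rule mo[OF has_germ_ddz[OF H]])
    note r1 = has_germ_add[OF mo[OF has_germ_mult_fun_right[OF dH g(1)]] mo[OF has_germ_mult_fun[OF H mo[OF conn_germs(1)[OF \<gamma> \<delta> g]]]]]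
    note r2 = has_germ_add[OF mo[OF has_germ_mult_11[OF dH g(2)]] mo[OF has_germ_mult_fun[OF H mo[OF conn_germs(2)[OF \<gamma> \<delta> g]]]]]
    show "near p (\<lambda>x. nabla_fst (mero_of U (\<lambda>p. h p * fst s p)) (mero_of U (\<lambda>p. h p * snd s p)) x =
      mero_of U (\<lambda>p. mero_of U (ddz h) p * fst s p) x +
      mero_of U (\<lambda>p. h p * mero_of U (\<lambda>x. nabla_fst (fst s) (snd s) x) p) x)"
      by (rule near_eqI_germ[OF l(1)], rule has_germ_eq_rhs[OF r1]) (simp add: algebra_simps)
    show "near p (\<lambda>x. nabla_snd \<gamma> \<delta> (mero_of U (\<lambda>p. h p * fst s p)) (mero_of U (\<lambda>p. h p * snd s p)) x =
      mero_of U (\<lambda>p. mero_of U (ddz h) p * snd s p) x +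
      mero_of U (\<lambda>p. h p * mero_of U (\<lambda>x. nabla_snd \<gamma> \<delta> (fst s) (snd s) x) p) x)"
      by (rule near_eqI_germ[OF l(2)], rule has_germ_eq_rhs[OF r2]) (simp add: algebra_simps)
  qed
next
  fix U s
  assume "\<not> (openin P1_top U \<and> s \<in> E0 D U)"
  then show "conn D \<gamma> \<delta> U s = undefined" by (auto simp: conn_def)
qed

section \<open>Normalizations and connection matrix\<close>

lemma mero_of_zero [simp]: "mero_of U (\<lambda>_. 0) = (\<lambda>_. 0)"
proof
  fix p
  have "remove_sings (\<lambda>w::complex. 0::complex) 0 = 0"
    by (rule remove_sings_eqI) simp
  then show "mero_of U (\<lambda>_. 0) p = 0"
    by (simp add: mero_of_def)
qed

lemma zero_in_sect: "openin P1_top U \<Longrightarrow> (\<lambda>_. 0) \<in> sect k D U"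
  using sectI[of U k "\<lambda>_. 0" D] has_germ_zero by fastforce

lemma ddz_zero [simp]: "ddz (\<lambda>_. 0) = (\<lambda>_. 0)"
  by (auto simp: ddz_def fun_eq_iff split: option.splits)

lemma trivial_on_O_conn: "trivial_on_O D (conn D \<gamma> \<delta>)"
  unfolding trivial_on_O_def
  by (auto simp: conn_def E0_def zero_in_sect exterior_d_eq)

lemma phi_is_id_conn: "phi_is_id D (conn D \<gamma> \<delta>)"
  unfolding phi_is_id_def
  by (auto simp: conn_def E0_def zero_in_sect mero_of_mero sect_mero)

lemma has_germ_Some_analytic:
  assumes "(\<lambda>z. f (Some z)) analytic_on {b}"
  shows "\<exists>F. has_germ k (Some b) f F \<and> ord_ge 0 F"
proof -
  have "(\<lambda>w. f (Some (b + w))) has_fps_expansion fps_expansion (\<lambda>z. f (Some z)) b"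
    using analytic_at_imp_has_fps_expansion[OF assms] .
  then have "has_germ k (Some b) f (fps_to_fls (fps_expansion (\<lambda>z. f (Some z)) b))"
    unfolding has_germ_def by (auto intro!: has_laurent_expansion_fps)
  then show ?thesis by (intro exI conjI) (auto simp: ord_ge_def)
qed

text \<open>The form \<open>dw / w\<^sup>n\<close> attached to \<open>p\<close>.\<close>

definition frame_form :: "divisor \<Rightarrow> P1 \<Rightarrow> P1 \<Rightarrow> complex" where
  "frame_form D p x = (case x of None \<Rightarrow> 0
        | Some z \<Rightarrow> (case p of Some a \<Rightarrow> 1 / (z - a) ^ count D p
                           | None \<Rightarrow> - (z ^ count D p / z ^ 2)))"

lemma frame2_eq: "frame2 D p = (mero_of (frame_nhd D p) (\<lambda>_. 0), mero_of (frame_nhd D p) (frame_form D p))"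
  by (simp add: frame2_def frame_form_def[abs_def])

lemma frame1_eq: "frame1 D p = (mero_of (frame_nhd D p) (\<lambda>_. 1), mero_of (frame_nhd D p) (\<lambda>_. 0))"
  by (simp add: frame1_def)

lemma openin_frame_nhd: "openin P1_top (frame_nhd D p)"
proof -
  have "frame_nhd D p = - ((set_mset D \<union> {None, Some 0}) - {p})"
    by (auto simp: frame_nhd_def)
  then show ?thesis by (simp only: openin_Compl_finite finite_Diff finite_Un finite_set_mset finite.intros)
qed

lemma in_frame_nhd: "p \<in> frame_nhd D p" by (simp add: frame_nhd_def)

lemma has_germ_frame_form: "has_germ 1 p (frame_form D p) (fls_X_inv ^ count D p)"
proof -
  have 1: "(\<lambda>w::complex. inverse w ^ count D p) has_laurent_expansion (fls_X_inv ^ count D p)"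
    using has_laurent_expansion_power[OF has_laurent_expansion_inverse[OF has_laurent_expansion_fps_X]]
    by (simp add: fls_inverse_X)
  have "eventually (\<lambda>w. inverse w ^ count D p = frame_form D p (from_local p w) * jac p w ^ 1) (at 0)"
    unfolding eventually_at_filter
    by (rule always_eventually)
       (auto simp: frame_form_def from_local_def jac_def divide_simps power_one_over split: option.splits)
  then show ?thesis
    unfolding has_germ_def using 1 by (subst has_laurent_expansion_cong[symmetric, OF _ refl])
qed

lemma frame1_E0: "frame1 D p \<in> E0 D (frame_nhd D p)"
  unfolding frame1_eq
proof (intro E0I openin_frame_nhd exI conjI)
  fix x
  show "has_germ 0 x (\<lambda>_. 1) (fls_const 1)" by (rule has_germ_const)
  show "has_germ 1 x (\<lambda>_. 0) 0" by (rule has_germ_zero)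
qed (use ord_ge_const[of 1] in auto)

lemma frame2_E0: "frame2 D p \<in> E0 D (frame_nhd D p)"
  unfolding frame2_eq
proof (intro E0I openin_frame_nhd)
  fix x assume x: "x \<in> frame_nhd D p"
  have "\<exists>G. has_germ 1 x (frame_form D p) G \<and> ord_ge (- int (count D x)) G"
  proof (cases "x = p")
    case True
    then show ?thesis using has_germ_frame_form ord_ge_X_inv_power by blast
  next
    case False
    with x obtain b where b: "x = Some b" "b \<noteq> 0" by (auto simp: frame_nhd_def)
    have "(\<lambda>z. frame_form D p (Some z)) analytic_on {b}"
      using b False by (cases p) (auto simp: frame_form_def intro!: analytic_intros)
    from has_germ_Some_analytic[OF this] show ?thesis
      using ord_ge_mono[of 0 _ "- int (count D x)"] b by auto
  qed
  then show "\<exists>F G. has_germ 0 x (\<lambda>_. 0) F \<and> has_germ 1 x (frame_form D p) G \<and> ord_ge 0 F \<and> ord_ge (- int (count D x)) G"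
    using has_germ_zero ord_ge_zero by blast
qed

lemma conn_germ:
  assumes "\<And>p. has_germ 2 p \<gamma> (\<Gamma> p)" "\<And>p. has_germ 1 p \<delta> (\<Delta> p)"
    and "openin P1_top U" "s \<in> E0 D U" "p \<in> U" "has_germ 0 p (fst s) F" "has_germ 1 p (snd s) G"
  shows "has_germ 1 p (fst (conn D \<gamma> \<delta> U s)) (fls_deriv F + G)"
    "has_germ 2 p (snd (conn D \<gamma> \<delta> U s)) (\<Gamma> p * F + (fls_deriv G + flat_coeff p * G + \<Delta> p * G))"
  using conn_germs[OF assms(1,2,6,7)] assms
  by (simp_all add: conn_in has_germ_mero_of)

text \<open>At every point the matrix is a companion matrix up to the factor \<open>w\<^sup>n\<close>: its trace only involves \<open>\<delta>\<close>
  and its determinant is \<open>- \<gamma>\<close>.\<close>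

lemma conn_matrix_conn:
  assumes "\<And>p. has_germ 2 p \<gamma> (\<Gamma> p)" "\<And>p. has_germ 1 p \<delta> (\<Delta> p)"
  shows "conn_matrix D (conn D \<gamma> \<delta>) p = vector [vector [0, fls_X_inv ^ count D p],
     vector [\<Gamma> p * fls_X ^ count D p, trace_fls D \<Delta> p]]"
proof -
  note mo = has_germ_mero_of[OF openin_frame_nhd in_frame_nhd]
  have 1: "has_germ 0 p (fst (frame1 D p)) 1" "has_germ 1 p (snd (frame1 D p)) 0"
    using mo[OF has_germ_const[of p 1]] has_germ_zero by (auto simp: frame1_eq)
  have 2: "has_germ 0 p (fst (frame2 D p)) 0" "has_germ 1 p (snd (frame2 D p)) (fls_X_inv ^ count D p)"
    using mo[OF has_germ_frame_form] has_germ_zero by (auto simp: frame2_eq)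
  note c1 = conn_germ[OF assms openin_frame_nhd frame1_E0 in_frame_nhd 1, THEN germ_eqI]
  note c2 = conn_germ[OF assms openin_frame_nhd frame2_E0 in_frame_nhd 2, THEN germ_eqI]
  have "(fls_deriv (fls_X_inv ^ count D p) + flat_coeff p * fls_X_inv ^ count D p + \<Delta> p * fls_X_inv ^ count D p) * fls_X ^ count D p
    = trace_fls D \<Delta> p * (fls_X_inv ^ count D p * fls_X ^ count D p)"
    by (simp add: fls_deriv_X_inv_power trace_fls_def algebra_simps)
  then show ?thesis
    unfolding conn_matrix_def Let_def c1 c2 by (simp add: X_inv_X_power)
qed

section \<open>Every normalized connection has this form\<close>

lemma has_germ_divide:
  assumes "has_germ k p f F" "has_germ l p g G" "l \<le> k"
  shows "\<exists>H. has_germ (k - l) p (\<lambda>x. f x / g x) H"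
proof -
  have "has_germ 0 p f (F / jac_fls p ^ k)" "has_germ 0 p g (G / jac_fls p ^ l)"
    using assms has_germ_twist by auto
  then have "has_germ 0 p (\<lambda>x. f x / g x) ((F / jac_fls p ^ k) / (G / jac_fls p ^ l))"
    unfolding has_germ_def power_0 mult_1_right by (rule has_laurent_expansion_divide)
  then show ?thesis
    using has_germ_shift_degree by blast
qed

lemma ddz_cong_open:
  assumes "openin P1_top V" "\<And>x. x \<in> V \<Longrightarrow> f x = g x" "x \<in> V"
  shows "ddz f x = ddz g x"
proof (cases x)
  case (Some a)
  have "eventually (\<lambda>w. f (from_local x w) = g (from_local x w)) (nhds 0)"
    using eventually_from_local_in[OF assms(1,3)] by eventually_elim (use assms(2) in auto)
  then have "eventually (\<lambda>z. f (Some z) = g (Some z)) (nhds a)"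
    by (simp add: Some nhds_to_0[of a] eventually_filtermap add.commute)
  then show ?thesis
    by (auto simp: ddz_def Some intro!: deriv_cong_ev)
qed (simp add: ddz_def)

lemma is_connectionD:
  assumes "is_connection D D' nabla" "openin P1_top U" "s \<in> E0 D U"
  shows is_connection_forms: "nabla U s \<in> E0_forms D D' U"
    and is_connection_restrict:
      "openin P1_top V \<Longrightarrow> V \<subseteq> U \<Longrightarrow> nabla V (restrict_section V s) = restrict_section V (nabla U s)"
    and is_connection_add: "t \<in> E0 D U \<Longrightarrow> nabla U (add_section U s t) = add_section U (nabla U s) (nabla U t)"
    and is_connection_Leibniz: "h \<in> hol U \<Longrightarrow> nabla U (mult_section U h s) =
      add_section U (mult_section U (exterior_d U h) s) (mult_section U h (nabla U s))"
proof -
  note c = assms(1)[unfolded is_connection_def]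
  show "nabla U s \<in> E0_forms D D' U"
    by (rule c[THEN conjunct1, rule_format]) (intro conjI assms)
  show "nabla V (restrict_section V s) = restrict_section V (nabla U s)" if "openin P1_top V" "V \<subseteq> U"
    by (rule c[THEN conjunct2, THEN conjunct1, rule_format]) (intro conjI assms that)
  show "nabla U (add_section U s t) = add_section U (nabla U s) (nabla U t)" if "t \<in> E0 D U"
    by (rule c[THEN conjunct2, THEN conjunct2, THEN conjunct1, rule_format]) (intro conjI assms that)
  show "nabla U (mult_section U h s) =
      add_section U (mult_section U (exterior_d U h) s) (mult_section U h (nabla U s))" if "h \<in> hol U"
    by (rule c[THEN conjunct2, THEN conjunct2, THEN conjunct2, THEN conjunct2, THEN conjunct1, rule_format])
       (intro conjI assms that)
qed

text \<open>Over the affine line without \<open>D\<close> the bundle is free on \<open>1\<close> and \<open>dz\<close>, so the Leibniz rule determines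
  the connection from the images of these two sections.  Their first components are given by the
  normalizations, and \<open>\<gamma>\<close> and \<open>\<delta>\<close> are the second ones.\<close>

lemma connection_local_formula:
  assumes c: "is_connection D D' nabla" and t: "trivial_on_O D nabla" and ph: "phi_is_id D nabla"
  defines "Z \<equiv> - insert None (set_mset D)"
  defines "one \<equiv> mero_of Z (\<lambda>_. 1)"
  defines "\<gamma> \<equiv> snd (nabla Z (one, \<lambda>_. 0))" and "\<delta> \<equiv> snd (nabla Z (\<lambda>_. 0, one))"
  assumes V: "openin P1_top V" "V \<subseteq> Z" and s: "s \<in> E0 D V"
  shows "nabla V s = conn D \<gamma> \<delta> V s" and "\<gamma> \<in> mero Z" "\<delta> \<in> mero Z"
    and "p \<in> Z \<Longrightarrow> \<exists>\<Gamma>. has_germ 2 p \<gamma> \<Gamma>" "p \<in> Z \<Longrightarrow> \<exists>\<Delta>. has_germ 1 p \<delta> \<Delta>"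
proof -
  have Z: "openin P1_top Z" unfolding Z_def by (rule openin_Compl_finite) simp
  note restr = is_connection_restrict[OF c] and add = is_connection_add[OF c]
    and leib = is_connection_Leibniz[OF c] and forms = is_connection_forms[OF c]
  have one1: "one x = 1" if "x \<in> Z" for x
    using that by (auto simp: one_def mero_of_def intro!: remove_sings_eqI)
  have sec1: "(one, \<lambda>_. 0) \<in> E0 D Z"
  proof -
    have "(mero_of Z (\<lambda>_. 1), mero_of Z (\<lambda>_. 0)) \<in> E0 D Z"
      by (rule E0I[OF Z], rule exI[of _ "fls_const 1"], rule exI[of _ 0])
         (simp only: has_germ_const has_germ_zero ord_ge_const ord_ge_zero simp_thms)
    then show ?thesis by (simp add: one_def)
  qed
  have sec2: "(\<lambda>_. 0, one) \<in> E0 D Z"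
  proof -
    have "\<exists>G. has_germ 1 p (\<lambda>_. 1) G \<and> ord_ge (- int (count D p)) G" if p: "p \<in> Z" for p
    proof -
      obtain b where b: "p = Some b" using p by (cases p) (auto simp: Z_def)
      show ?thesis unfolding b
        using has_germ_Some_analytic[of "\<lambda>_. 1" b 1] ord_ge_mono[of 0 _ "- int (count D (Some b))"]
        by (auto intro: analytic_intros)
    qed
    then have "(mero_of Z (\<lambda>_. 0), mero_of Z (\<lambda>_. 1)) \<in> E0 D Z"
      by (intro E0I[OF Z]) (metis has_germ_zero ord_ge_zero)
    then show ?thesis by (simp add: one_def)
  qed
  have f1: "nabla Z (one, \<lambda>_. 0) \<in> E0_forms D D' Z" and f2: "nabla Z (\<lambda>_. 0, one) \<in> E0_forms D D' Z"
    by (rule forms[OF Z] sec1 sec2)+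
  show "\<gamma> \<in> mero Z" "\<delta> \<in> mero Z"
    using f1 f2 unfolding E0_forms_def \<gamma>_def \<delta>_def by (auto intro: sect_mero)
  have \<gamma>: "\<exists>\<Gamma>. has_germ 2 p \<gamma> \<Gamma>" and \<delta>: "\<exists>\<Delta>. has_germ 2 p \<delta> \<Delta>" if "p \<in> Z" for p
    using f1 f2 mero_has_germ[OF sect_mero that] unfolding E0_forms_def \<gamma>_def \<delta>_def by auto blast+
  have \<delta>1: "\<exists>\<Delta>. has_germ 1 p \<delta> \<Delta>" if "p \<in> Z" for p
    using \<delta>[OF that] has_germ_twist by (metis has_germ_shift_degree le0)
  show "p \<in> Z \<Longrightarrow> \<exists>\<Gamma>. has_germ 2 p \<gamma> \<Gamma>" "p \<in> Z \<Longrightarrow> \<exists>\<Delta>. has_germ 1 p \<delta> \<Delta>"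
    using \<gamma> \<delta>1 by auto

  have VZ: "x \<in> V \<Longrightarrow> x \<in> Z" for x using V by auto
  obtain f g where fg: "s = (f, g)" by (cases s)
  define oneV where "oneV = mero_of V (\<lambda>_. 1)"
  have oneV1: "oneV x = 1" if "x \<in> V" for x
    using that by (auto simp: oneV_def mero_of_def intro!: remove_sings_eqI)
  have r1: "restrict_section V (one, \<lambda>_. 0) = (oneV, \<lambda>_. 0)"
    and r2: "restrict_section V (\<lambda>_. 0, one) = (\<lambda>_. 0, oneV)"
    unfolding one_def oneV_def
    using restrict_section_mero_of[OF V(2), of "\<lambda>_. 1" "\<lambda>_. 0"] restrict_section_mero_of[OF V(2), of "\<lambda>_. 0" "\<lambda>_. 1"]
    by simp_all
  have sV1: "(oneV, \<lambda>_. 0) \<in> E0 D V" and sV2: "(\<lambda>_. 0, oneV) \<in> E0 D V"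
    using restrict_section_E0[OF sec1 V(2,1)] restrict_section_E0[OF sec2 V(2,1)] by (simp_all add: r1 r2)
  have nV1: "nabla V (oneV, \<lambda>_. 0) = restrict_section V (nabla Z (one, \<lambda>_. 0))"
    and nV2: "nabla V (\<lambda>_. 0, oneV) = restrict_section V (nabla Z (\<lambda>_. 0, one))"
    using restr[OF Z sec1 V] restr[OF Z sec2 V] by (simp_all add: r1 r2)
  have f: "f \<in> hol V" and gs: "g \<in> sect 1 D V" using s by (auto simp: fg E0_def)
  have g: "g \<in> hol V"
  proof -
    have "mero_of V g \<in> hol V"
    proof (rule sectI[OF V(1)])
      fix p assume p: "p \<in> V"
      from sectE[OF gs p] obtain G where G: "has_germ 1 p g G" "ord_ge (- int (count D p)) G" .
      have "count D p = 0" "p \<noteq> None" using VZ[OF p] by (auto simp: Z_def count_eq_zero_iff)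
      then show "\<exists>F. has_germ 0 p g F \<and> ord_ge (- int (count {#} p)) F"
        using G has_germ_twist[of 1 p g G] by (auto simp: jac_fls_def split: option.splits)
    qed
    then show ?thesis using gs by (simp add: mero_of_mero sect_mero)
  qed
  have d1: "mult_section V f (oneV, \<lambda>_. 0) = (f, \<lambda>_. 0)" and d2: "mult_section V g (\<lambda>_. 0, oneV) = (\<lambda>_. 0, g)"
  proof -
    have "mero_of V (\<lambda>p. h p * oneV p) = h" if "h \<in> mero V" for h
    proof -
      have "mero_of V (\<lambda>p. h p * oneV p) = mero_of V h"
        by (rule mero_of_cong, rule near_mono[OF near_in[OF V(1)]]) (auto simp: oneV1)
      then show ?thesis using mero_of_mero[OF that] by simp
    qed
    then show "mult_section V f (oneV, \<lambda>_. 0) = (f, \<lambda>_. 0)" "mult_section V g (\<lambda>_. 0, oneV) = (\<lambda>_. 0, g)"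
      using f g by (auto simp: mult_section_def sect_mero)
  qed
  have s1: "(f, \<lambda>_. 0) \<in> E0 D V" and s2: "(\<lambda>_. 0, g) \<in> E0 D V"
    using f gs by (auto simp: E0_def zero_in_sect V(1))
  have d: "add_section V (f, \<lambda>_. 0) (\<lambda>_. 0, g) = s"
    using f g by (simp add: add_section_def mero_of_mero sect_mero fg)
  have n: "nabla V s = add_section V (nabla V (f, \<lambda>_. 0)) (nabla V (\<lambda>_. 0, g))"
    using add[OF V(1) s1 s2] by (simp add: d)
  have a: "fst (nabla V (f, \<lambda>_. 0)) = mero_of V (ddz f)"
    using t f V(1) by (simp add: trivial_on_O_def exterior_d_eq)
  have b: "fst (nabla V (\<lambda>_. 0, g)) = g"
    using ph gs V(1) by (simp add: phi_is_id_def)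
  have a2: "snd (nabla V (f, \<lambda>_. 0)) = mero_of V (\<lambda>x. \<gamma> x * f x)"
  proof -
    have "nabla V (f, \<lambda>_. 0) = add_section V (mult_section V (exterior_d V f) (oneV, \<lambda>_. 0))
       (mult_section V f (restrict_section V (nabla Z (one, \<lambda>_. 0))))"
      using leib[OF V(1) sV1 f] by (simp add: d1 nV1)
    then have "snd (nabla V (f, \<lambda>_. 0)) = mero_of V (\<lambda>p. mero_of V (\<lambda>p. f p * (if p \<in> V then \<gamma> p else 0)) p)"
      by (simp add: add_section_components mult_section_components restrict_section_def \<gamma>_def cong: if_cong)
    also have "\<dots> = mero_of V (\<lambda>x. \<gamma> x * f x)"
    proof (rule mero_of_cong)
      fix p assume p: "p \<in> V"
      obtain \<Gamma> where \<Gamma>: "has_germ 2 p \<gamma> \<Gamma>" using \<gamma> VZ[OF p] by blast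
      obtain F where F: "has_germ 0 p f F" using hol_germ[OF f p] by blast
      have "near p (\<lambda>x. f x * (if x \<in> V then \<gamma> x else 0) = \<gamma> x * f x)"
        by (rule near_mono[OF near_in[OF V(1) p]]) auto
      then have "has_germ 2 p (\<lambda>x. f x * (if x \<in> V then \<gamma> x else 0)) (\<Gamma> * F)"
        by (rule has_germ_cong[THEN iffD2]) (rule has_germ_mult_20[OF \<Gamma> F])
      from near_mero_of[OF V(1) p this]
      have "near p (\<lambda>x. mero_of V (\<lambda>p. f p * (if p \<in> V then \<gamma> p else 0)) x = f x * (if x \<in> V then \<gamma> x else 0) \<and> x \<in> V)"
        by (intro near_conj near_in V(1) p)
      then show "near p (\<lambda>x. mero_of V (\<lambda>p. f p * (if p \<in> V then \<gamma> p else 0)) x = \<gamma> x * f x)"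
        by (rule near_mono) auto
    qed
    finally show ?thesis .
  qed
  have b2: "snd (nabla V (\<lambda>_. 0, g)) = mero_of V (\<lambda>x. ddz g x + \<delta> x * g x)"
  proof -
    have "nabla V (\<lambda>_. 0, g) = add_section V (mult_section V (exterior_d V g) (\<lambda>_. 0, oneV))
       (mult_section V g (restrict_section V (nabla Z (\<lambda>_. 0, one))))"
      using leib[OF V(1) sV2 g] by (simp add: d2 nV2)
    then have "snd (nabla V (\<lambda>_. 0, g)) = mero_of V (\<lambda>p. mero_of V (\<lambda>p. mero_of V (ddz g) p * oneV p) p
        + mero_of V (\<lambda>p. g p * (if p \<in> V then \<delta> p else 0)) p)"
      by (simp add: add_section_components mult_section_components restrict_section_def \<delta>_def exterior_d_eq cong: if_cong)
    also have "\<dots> = mero_of V (\<lambda>x. ddz g x + \<delta> x * g x)"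
    proof (rule mero_of_cong)
      fix p assume p: "p \<in> V"
      obtain \<Delta> where \<Delta>: "has_germ 2 p \<delta> \<Delta>" using \<delta> VZ[OF p] by blast
      obtain G where G: "has_germ 0 p g G" using hol_germ[OF g p] by blast
      have dG: "has_germ 1 p (mero_of V (ddz g)) (fls_deriv G)"
        by (rule has_germ_mero_of[OF V(1) p has_germ_ddz[OF G]])
      have "near p (\<lambda>x. g x * (if x \<in> V then \<delta> x else 0) = \<delta> x * g x)"
        by (rule near_mono[OF near_in[OF V(1) p]]) auto
      then have 1: "has_germ 2 p (\<lambda>x. g x * (if x \<in> V then \<delta> x else 0)) (\<Delta> * G)"
        by (rule has_germ_cong[THEN iffD2]) (rule has_germ_mult_20[OF \<Delta> G])
      have "near p (\<lambda>x. mero_of V (ddz g) x * oneV x = mero_of V (ddz g) x)"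
        by (rule near_mono[OF near_in[OF V(1) p]]) (auto simp: oneV1)
      then have 2: "has_germ 1 p (\<lambda>x. mero_of V (ddz g) x * oneV x) (fls_deriv G)"
        by (rule has_germ_cong[THEN iffD2]) (rule dG)
      have "near p (\<lambda>x. x \<in> V \<and> mero_of V (\<lambda>p. g p * (if p \<in> V then \<delta> p else 0)) x = g x * (if x \<in> V then \<delta> x else 0)
         \<and> mero_of V (\<lambda>p. mero_of V (ddz g) p * oneV p) x = mero_of V (ddz g) x * oneV x
         \<and> mero_of V (ddz g) x = ddz g x)"
        by (intro near_conj near_in V(1) p near_mero_of[OF V(1) p 1] near_mero_of[OF V(1) p 2]
            near_mero_of[OF V(1) p has_germ_ddz[OF G]])
      then show "near p (\<lambda>x. mero_of V (\<lambda>p. mero_of V (ddz g) p * oneV p) x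
        + mero_of V (\<lambda>p. g p * (if p \<in> V then \<delta> p else 0)) x = ddz g x + \<delta> x * g x)"
        by (rule near_mono) (auto simp: oneV1)
    qed
    finally show ?thesis .
  qed
  have "fst (nabla V s) = mero_of V (\<lambda>x. nabla_fst f g x)"
  proof -
    have "fst (nabla V s) = mero_of V (\<lambda>p. mero_of V (ddz f) p + g p)"
      unfolding n add_section_components a b ..
    also have "\<dots> = mero_of V (\<lambda>x. nabla_fst f g x)"
    proof (rule mero_of_cong)
      fix p assume p: "p \<in> V"
      obtain F where F: "has_germ 0 p f F" using hol_germ[OF f p] by blast
      show "near p (\<lambda>x. mero_of V (ddz f) x + g x = nabla_fst f g x)"
        by (rule near_mono[OF near_mero_of[OF V(1) p has_germ_ddz[OF F]]]) simp
    qed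
    finally show ?thesis .
  qed
  moreover have "snd (nabla V s) = mero_of V (\<lambda>x. nabla_snd \<gamma> \<delta> f g x)"
  proof -
    have "snd (nabla V s) = mero_of V (\<lambda>p. mero_of V (\<lambda>x. \<gamma> x * f x) p + mero_of V (\<lambda>x. ddz g x + \<delta> x * g x) p)"
      unfolding n add_section_components a2 b2 ..
    also have "\<dots> = mero_of V (\<lambda>x. nabla_snd \<gamma> \<delta> f g x)"
    proof (rule mero_of_cong)
      fix p assume p: "p \<in> V"
      obtain \<Gamma> where \<Gamma>: "has_germ 2 p \<gamma> \<Gamma>" using \<gamma> VZ[OF p] by blast
      obtain \<Delta> where \<Delta>: "has_germ 1 p \<delta> \<Delta>" using \<delta>1 VZ[OF p] by blast
      obtain F where F: "has_germ 0 p f F" using hol_germ[OF f p] by blast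
      from sectE[OF gs p] obtain G where G: "has_germ 1 p g G" .
      have 1: "has_germ 2 p (\<lambda>x. \<gamma> x * f x) (\<Gamma> * F)" by (rule has_germ_mult_20[OF \<Gamma> F])
      have 2: "has_germ 2 p (\<lambda>x. ddz g x + \<delta> x * g x) (fls_deriv G + flat_coeff p * G + \<Delta> * G)"
        by (intro has_germ_add has_germ_ddz_form has_germ_mult_11 G \<Delta>)
      show "near p (\<lambda>x. mero_of V (\<lambda>x. \<gamma> x * f x) x + mero_of V (\<lambda>x. ddz g x + \<delta> x * g x) x = nabla_snd \<gamma> \<delta> f g x)"
        by (rule near_mono[OF near_conj[OF near_mero_of[OF V(1) p 1] near_mero_of[OF V(1) p 2]]]) simp
    qed
    finally show ?thesis .
  qed
  ultimately show "nabla V s = conn D \<gamma> \<delta> V s"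
    unfolding conn_in[OF V(1) s] by (simp add: prod_eq_iff fg)
qed

lemma mero_of_eqI:
  assumes "near x (\<lambda>y. f y = g y)" "x \<in> U" "x \<in> U'"
  shows "mero_of U f x = mero_of U' g x"
  using assms by (auto simp: mero_of_def near_def intro!: remove_sings_cong)

text \<open>By restriction, the local formula holds off finitely many points on every open set, and a section is
  determined by its values there.  It remains to see that \<open>\<gamma>\<close> and \<open>\<delta>\<close> are meromorphic at \<open>D\<close> and
  at infinity; this follows by applying the connection to the standard frame at these points, whose image
  is meromorphic by definition.\<close>

theorem normalized_connection_eq_conn:
  assumes c: "is_connection D D' nabla" and t: "trivial_on_O D nabla" and ph: "phi_is_id D nabla"
  obtains \<gamma> \<delta> \<Gamma> \<Delta> where "\<And>p. has_germ 2 p \<gamma> (\<Gamma> p)" "\<And>p. has_germ 1 p \<delta> (\<Delta> p)"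
    "nabla = conn D \<gamma> \<delta>"
proof -
  define Z where "Z = - insert None (set_mset D)"
  define one where "one = mero_of Z (\<lambda>_. 1)"
  define \<gamma> where "\<gamma> = snd (nabla Z (one, \<lambda>_. 0))"
  define \<delta> where "\<delta> = snd (nabla Z (\<lambda>_. 0, one))"
  note loc = connection_local_formula[OF c t ph, folded Z_def, folded one_def, folded \<gamma>_def \<delta>_def]
  have Z: "openin P1_top Z" unfolding Z_def by (rule openin_Compl_finite) simp
  note restr = is_connection_restrict[OF c] and forms = is_connection_forms[OF c]
  have nZ: "near p (\<lambda>x. x \<in> Z)" for p
    using near_not_in_finite[of "insert None (set_mset D)" p] by (simp add: Z_def)
  have emp: "(\<lambda>_. 0, \<lambda>_. 0) \<in> E0 D {}" by (simp add: E0_def zero_in_sect)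
  have \<gamma>Z: "\<exists>\<Gamma>. has_germ 2 p \<gamma> \<Gamma>" and \<delta>Z: "\<exists>\<Delta>. has_germ 1 p \<delta> \<Delta>" if "p \<in> Z" for p
    by (rule loc(4)[OF openin_empty _ emp that] loc(5)[OF openin_empty _ emp that], simp)+
  have \<gamma>m: "mero_of Z \<gamma> = \<gamma>" and \<delta>m: "mero_of Z \<delta> = \<delta>"
    by (rule mero_of_mero[OF loc(2)[OF openin_empty _ emp]] mero_of_mero[OF loc(3)[OF openin_empty _ emp]], simp)+

  have nabla_near: "near x (\<lambda>y. fst (nabla U s) y = nabla_fst (fst s) (snd s) y)"
      "near x (\<lambda>y. snd (nabla U s) y = nabla_snd \<gamma> \<delta> (fst s) (snd s) y)"
    if U: "openin P1_top U" and s: "s \<in> E0 D U" and x: "x \<in> U" "x \<in> Z" for U s x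
  proof -
    define V where "V = U \<inter> Z"
    have V: "openin P1_top V" "V \<subseteq> U" "V \<subseteq> Z" "x \<in> V"
      using U Z x by (auto simp: V_def)
    define s' where "s' = restrict_section V s"
    have s': "s' \<in> E0 D V" unfolding s'_def by (rule restrict_section_E0[OF s V(2,1)])
    have eqs: "fst s' y = fst s y" "snd s' y = snd s y" "ddz (fst s') y = ddz (fst s) y" "ddz (snd s') y = ddz (snd s) y"
      if "y \<in> V" for y
      using ddz_cong_open[OF V(1), of "fst s'" "fst s" y] ddz_cong_open[OF V(1), of "snd s'" "snd s" y] that
      by (auto simp: s'_def restrict_section_def)
    have "restrict_section V (nabla U s) = conn D \<gamma> \<delta> V s'"
      using restr[OF U s V(1,2)] loc(1)[OF V(1,3) s'] by (simp add: s'_def)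
    then have "(\<lambda>p. if p \<in> V then fst (nabla U s) p else 0) = mero_of V (\<lambda>x. nabla_fst (fst s') (snd s') x)"
        "(\<lambda>p. if p \<in> V then snd (nabla U s) p else 0) =
          mero_of V (\<lambda>x. nabla_snd \<gamma> \<delta> (fst s') (snd s') x)"
      unfolding conn_in[OF V(1) s'] restrict_section_def prod.inject by auto
    note comps = this
    have *: "fst (nabla U s) y = mero_of V (\<lambda>x. nabla_fst (fst s') (snd s') x) y"
        "snd (nabla U s) y = mero_of V (\<lambda>x. nabla_snd \<gamma> \<delta> (fst s') (snd s') x) y"
      if "y \<in> V" for y
      using fun_cong[OF comps(1), of y] fun_cong[OF comps(2), of y] that by auto
    obtain \<Gamma> \<Delta> where gd: "has_germ 2 x \<gamma> \<Gamma>" "has_germ 1 x \<delta> \<Delta>" using \<gamma>Z \<delta>Z x by blast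
    from E0E[OF s' V(4)] obtain F G where fg: "has_germ 0 x (fst s') F" "has_germ 1 x (snd s') G" .
    note nm = conn_germs[OF gd fg, THEN near_mero_of[OF V(1,4)]]
    show "near x (\<lambda>y. fst (nabla U s) y = nabla_fst (fst s) (snd s) y)"
      by (rule near_mono[OF near_conj[OF near_in[OF V(1,4)] nm(1)]]) (simp add: * eqs)
    show "near x (\<lambda>y. snd (nabla U s) y = nabla_snd \<gamma> \<delta> (fst s) (snd s) y)"
      by (rule near_mono[OF near_conj[OF near_in[OF V(1,4)] nm(2)]]) (simp add: * eqs)
  qed

  have nab_mero: "mero_of U (fst (nabla U s)) = fst (nabla U s)" "fst (nabla U s) \<in> mero U"
      "mero_of U (snd (nabla U s)) = snd (nabla U s)" "snd (nabla U s) \<in> mero U"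
    if "openin P1_top U" "s \<in> E0 D U" for U s
    using forms[OF that] by (auto simp: E0_forms_def mero_of_mero sect_mero)

  have \<gamma>germ: "\<exists>\<Gamma>. has_germ 2 p \<gamma> \<Gamma>" for p
  proof -
    define N where "N = frame_nhd D p"
    have N: "openin P1_top N" "p \<in> N" by (simp_all add: N_def openin_frame_nhd in_frame_nhd)
    define s where "s = frame1 D p"
    have s: "s \<in> E0 D N" by (simp add: s_def N_def frame1_E0)
    have s_eq0: "snd s = (\<lambda>_. 0)" by (simp add: s_def frame1_def)
    have s_eq: "fst s y = 1" if "y \<in> N" for y
      using that by (auto simp: s_def frame1_def N_def mero_of_def intro!: remove_sings_eqI)
    have "snd (nabla N s) x = \<gamma> x" if x: "x \<in> N" "x \<in> Z" for x
    proof -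
      have "near x (\<lambda>y. snd (nabla N s) y = \<gamma> y)"
        by (rule near_mono[OF near_conj[OF near_in[OF N(1) x(1)] nabla_near(2)[OF N(1) s x]]])
           (simp add: s_eq s_eq0)
      then have "mero_of N (snd (nabla N s)) x = mero_of Z \<gamma> x"
        by (rule mero_of_eqI) (use x in auto)
      then show ?thesis
        by (simp add: \<gamma>m nab_mero(3)[OF N(1) s])
    qed
    then have "near p (\<lambda>x. \<gamma> x = snd (nabla N s) x)"
      by (intro near_mono[OF near_conj[OF near_in[OF N] nZ]]) auto
    moreover have "has_germ 2 p (snd (nabla N s)) (germ 2 p (snd (nabla N s)))"
      by (rule mero_has_germ[OF nab_mero(4)[OF N(1) s] N(2)])
    ultimately show ?thesis
      using has_germ_cong by metis
  qed

  have \<delta>germ: "\<exists>\<Delta>. has_germ 1 p \<delta> \<Delta>" for p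
  proof -
    define N where "N = frame_nhd D p"
    have N: "openin P1_top N" "p \<in> N" by (simp_all add: N_def openin_frame_nhd in_frame_nhd)
    define s where "s = frame2 D p"
    have s: "s \<in> E0 D N" by (simp add: s_def N_def frame2_E0)
    have s_eq: "fst s = (\<lambda>_. 0)" "snd s = mero_of N (frame_form D p)"
      by (auto simp: s_def frame2_eq N_def)
    \<comment> \<open>the second component of the image of the frame, solved for \<open>\<delta>\<close>\<close>
    define \<delta>' where "\<delta>' = (\<lambda>y. (snd (nabla N s) y - ddz (snd s) y) / snd s y)"
    have \<delta>': "\<exists>H. has_germ 1 x \<delta>' H" if x: "x \<in> N" for x
    proof -
      from E0E[OF s x] obtain G where G: "has_germ 1 x (snd s) G" .
      note has_germ_diff[OF mero_has_germ[OF nab_mero(4)[OF N(1) s] x] has_germ_ddz_form[OF G]]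
      from has_germ_divide[OF this G] show ?thesis by (simp add: \<delta>'_def)
    qed
    have "mero_of N \<delta>' x = \<delta> x" if x: "x \<in> N" "x \<in> Z" for x
    proof -
      from E0E[OF s x(1)] obtain G where G: "has_germ 1 x (snd s) G" .
      have nz: "near x (\<lambda>y. snd s y \<noteq> 0)"
      proof -
        have "near x (\<lambda>y. y \<in> N \<and> y \<notin> {p, None, Some 0} \<and> snd s y = frame_form D p y)"
        proof (intro near_conj near_in[OF N(1) x(1)])
          show "near x (\<lambda>y. y \<notin> {p, None, Some 0})" by (rule near_not_in_finite) simp
          have "\<exists>F. has_germ 1 x (frame_form D p) F"
          proof (cases "x = p")
            case True then show ?thesis using has_germ_frame_form by blast
          next
            case False
            with x obtain b where b: "x = Some b" "b \<noteq> 0" by (auto simp: frame_nhd_def N_def)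
            have "(\<lambda>z. frame_form D p (Some z)) analytic_on {b}"
              using b False by (cases p) (auto simp: frame_form_def intro!: analytic_intros)
            from has_germ_Some_analytic[OF this] show ?thesis using b by auto
          qed
          then show "near x (\<lambda>y. snd s y = frame_form D p y)"
            unfolding s_eq using near_mero_of[OF N(1) x(1)] by blast
        qed
        then show ?thesis
          by (rule near_mono) (auto simp: frame_form_def split: option.splits)
      qed
      have "near x (\<lambda>y. \<delta>' y = \<delta> y)"
        by (rule near_mono[OF near_conj[OF nz nabla_near(2)[OF N(1) s x]]])
           (simp add: s_eq(1) \<delta>'_def)
      then have "mero_of N \<delta>' x = mero_of Z \<delta> x"
        by (rule mero_of_eqI) (use x in auto)
      then show ?thesis
        by (simp add: \<delta>m)
    qed
    then have "near p (\<lambda>x. \<delta> x = mero_of N \<delta>' x)"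
      by (intro near_mono[OF near_conj[OF near_in[OF N] nZ]]) auto
    moreover obtain H where "has_germ 1 p (mero_of N \<delta>') H"
      using has_germ_mero_of[OF N] \<delta>'[OF N(2)] by blast
    ultimately show ?thesis
      using has_germ_cong by metis
  qed

  from \<gamma>germ obtain \<Gamma> where \<Gamma>: "\<And>p. has_germ 2 p \<gamma> (\<Gamma> p)" by metis
  from \<delta>germ obtain \<Delta> where \<Delta>: "\<And>p. has_germ 1 p \<delta> (\<Delta> p)" by metis
  have "nabla U s = conn D \<gamma> \<delta> U s" for U s
  proof (cases "openin P1_top U \<and> s \<in> E0 D U")
    case False
    have "nabla U s = undefined"
      using c[unfolded is_connection_def, THEN conjunct2, THEN conjunct2, THEN conjunct2,
          THEN conjunct2, THEN conjunct2, rule_format, OF False] .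
    then show ?thesis using False by (auto simp: conn_def)
  next
    case True
    then have U: "openin P1_top U" and s: "s \<in> E0 D U" by auto
    have germs: "\<exists>F. has_germ 1 x (\<lambda>y. nabla_fst (fst s) (snd s) y) F"
      "\<exists>F. has_germ 2 x (\<lambda>y. nabla_snd \<gamma> \<delta> (fst s) (snd s) y) F" if x: "x \<in> U" for x
    proof -
      from E0E[OF s x] obtain F G where g: "has_germ 0 x (fst s) F" "has_germ 1 x (snd s) G" .
      show "\<exists>F. has_germ 1 x (\<lambda>y. nabla_fst (fst s) (snd s) y) F"
        "\<exists>F. has_germ 2 x (\<lambda>y. nabla_snd \<gamma> \<delta> (fst s) (snd s) y) F"
        using conn_germs[OF \<Gamma> \<Delta> g] by blast+
    qed
    have 1: "fst (nabla U s) x = fst (conn D \<gamma> \<delta> U s) x" "snd (nabla U s) x = snd (conn D \<gamma> \<delta> U s) x"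
      if x: "x \<in> U" "x \<in> Z" for x
      using mero_of_eqI[OF nabla_near(1)[OF U s x] x(1) x(1)] mero_of_eqI[OF nabla_near(2)[OF U s x] x(1) x(1)]
      unfolding nab_mero(1,3)[OF U s] conn_in[OF U s] by simp_all
    show ?thesis
    proof (intro prod_eqI)
      show "fst (nabla U s) = fst (conn D \<gamma> \<delta> U s)"
      proof (rule mero_eqI[OF nab_mero(2)[OF U s]])
        show "fst (conn D \<gamma> \<delta> U s) \<in> mero U"
          unfolding conn_in[OF U s] fst_conv by (rule mero_of_in_mero[OF U]) (use germs in blast)
        show "near p (\<lambda>x. fst (nabla U s) x = fst (conn D \<gamma> \<delta> U s) x)" if "p \<in> U" for p
          by (rule near_mono[OF near_conj[OF near_in[OF U that] nZ]]) (simp add: 1)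
      qed
      show "snd (nabla U s) = snd (conn D \<gamma> \<delta> U s)"
      proof (rule mero_eqI[OF nab_mero(4)[OF U s]])
        show "snd (conn D \<gamma> \<delta> U s) \<in> mero U"
          unfolding conn_in[OF U s] snd_conv by (rule mero_of_in_mero[OF U]) (use germs in blast)
        show "near p (\<lambda>x. snd (nabla U s) x = snd (conn D \<gamma> \<delta> U s) x)" if "p \<in> U" for p
          by (rule near_mono[OF near_conj[OF near_in[OF U that] nZ]]) (simp add: 1)
      qed
    qed
  qed
  then have "nabla = conn D \<gamma> \<delta>" by (intro ext)
  then show ?thesis using that \<Gamma> \<Delta> by blast
qed

section \<open>Interpolation of differentials on the projective line\<close>

lemma fls_subdegree_power_int:
  fixes F :: "complex fls"
  assumes "F \<noteq> 0"
  shows "fls_subdegree (F powi n) = n * fls_subdegree F"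
proof (cases "n \<ge> 0")
  case True
  then show ?thesis by (simp add: power_int_def fls_subdegree_pow)
next
  case False
  have "fls_subdegree (inverse F) = - fls_subdegree F" by simp
  then show ?thesis using False by (simp add: power_int_def fls_subdegree_pow)
qed

lemma has_germ_linear:
  defines "lin \<equiv> \<lambda>a x. case x of None \<Rightarrow> 0 | Some z \<Rightarrow> z - a"
  shows "\<exists>L. has_germ 0 p (lin a) L \<and> L \<noteq> 0 \<and> fls_subdegree L =
     (if p = Some a then 1 else if p = None then - 1 else 0) \<and> (p = None \<longrightarrow> fls_nth L (- 1) = 1)"
proof (cases p)
  case (Some b)
  have "has_germ 0 p (lin a) (fls_const (b - a) + fls_X)"
    unfolding has_germ_def Some lin_def
    using has_laurent_expansion_add[OF has_laurent_expansion_const[of "b - a"] has_laurent_expansion_fps_X]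
    by (simp add: algebra_simps)
  moreover have "fls_nth (fls_const (b - a) + fls_X) (1::int) = 1" by simp
  then have "fls_const (b - a) + fls_X \<noteq> 0" by (metis fls_zero_nth zero_neq_one)
  moreover have "fls_subdegree (fls_const (b - a) + fls_X) = (if b = a then 1 else 0)"
    by (auto intro!: fls_subdegree_eqI)
  ultimately show ?thesis by (auto simp: Some)
next
  case None
  have "(\<lambda>w. inverse w - a) has_laurent_expansion (fls_X_inv - fls_const a)"
    using has_laurent_expansion_inverse[OF has_laurent_expansion_fps_X]
    by (intro has_laurent_expansion_diff has_laurent_expansion_const) (simp add: fls_inverse_X)
  moreover have "eventually (\<lambda>w. inverse w - a = lin a (from_local p w)) (at 0)"
    unfolding eventually_at_filter
    by (rule always_eventually) (auto simp: None lin_def from_local_def divide_simps)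
  ultimately have "has_germ 0 p (lin a) (fls_X_inv - fls_const a)"
    unfolding has_germ_def power_0 mult_1_right by (subst has_laurent_expansion_cong[symmetric, OF _ refl])
  moreover have 1: "fls_nth (fls_X_inv - fls_const a) (-1::int) = 1" by simp
  then have "fls_X_inv - fls_const a \<noteq> 0" by (metis fls_zero_nth zero_neq_one)
  moreover have "fls_subdegree (fls_X_inv - fls_const a) = - 1"
    by (auto intro!: fls_subdegree_eqI)
  ultimately show ?thesis using 1 by (auto simp: None)
qed

text \<open>The rational function with order \<open>m a\<close> at each \<open>a \<in> S\<close> and no other zeros or poles in the affine
  line; its order at infinity is forced.\<close>

definition lin_prod :: "complex set \<Rightarrow> (complex \<Rightarrow> int) \<Rightarrow> P1 \<Rightarrow> complex" where
  "lin_prod S m x = (\<Prod>a\<in>S. (case x of None \<Rightarrow> 0 | Some z \<Rightarrow> z - a) powi m a)"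

lemma has_germ_lin_prod:
  assumes "finite S"
  shows "\<exists>K. \<forall>p. has_germ 0 p (lin_prod S m) (K p) \<and> K p \<noteq> 0 \<and>
    fls_subdegree (K p) = (case p of Some b \<Rightarrow> if b \<in> S then m b else 0 | None \<Rightarrow> - (\<Sum>a\<in>S. m a))"
proof -
  define lin :: "complex \<Rightarrow> P1 \<Rightarrow> complex" where "lin = (\<lambda>a x. case x of None \<Rightarrow> 0 | Some z \<Rightarrow> z - a)"
  have "\<exists>L. has_germ 0 p (lin a) L \<and> L \<noteq> 0 \<and> fls_subdegree L =
     (if p = Some a then 1 else if p = None then - 1 else 0)" for a p
    using has_germ_linear[of p a] unfolding lin_def by blast
  then have "\<forall>a p. \<exists>L. has_germ 0 p (lin a) L \<and> L \<noteq> 0 \<and> fls_subdegree L =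
     (if p = Some a then 1 else if p = None then - 1 else 0)" by blast
  then obtain L where L: "\<And>a p. has_germ 0 p (lin a) (L a p)" "\<And>a p. L a p \<noteq> 0"
     "\<And>a p. fls_subdegree (L a p) = (if p = Some a then 1 else if p = None then - 1 else 0)"
    unfolding choice_iff by blast
  show ?thesis
  proof (intro exI[of _ "\<lambda>p. \<Prod>a\<in>S. L a p powi m a"] allI conjI)
    fix p
    show "has_germ 0 p (lin_prod S m) (\<Prod>a\<in>S. L a p powi m a)"
      unfolding has_germ_def lin_prod_def power_0 mult_1_right
      by (intro laurent_expansion_intros L(1)[unfolded has_germ_def power_0 mult_1_right lin_def])
    show nz: "(\<Prod>a\<in>S. L a p powi m a) \<noteq> 0"
      using L(2) assms by simp
    have "fls_subdegree (\<Prod>a\<in>S. L a p powi m a) = (\<Sum>a\<in>S. m a * fls_subdegree (L a p))"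
      using L(2) by (subst fls_subdegree_prod) (auto simp: fls_subdegree_power_int)
    also have "\<dots> = (case p of Some b \<Rightarrow> if b \<in> S then m b else 0 | None \<Rightarrow> - (\<Sum>a\<in>S. m a))"
    proof (cases p)
      case None
      then show ?thesis by (simp add: L(3) sum_negf)
    next
      case (Some b)
      have "(\<Sum>a\<in>S. m a * fls_subdegree (L a p)) = (\<Sum>a\<in>S. if a = b then m b else 0)"
        by (intro sum.cong) (auto simp: L(3) Some)
      then show ?thesis using assms by (simp add: Some)
    qed
    finally show "fls_subdegree (\<Prod>a\<in>S. L a p powi m a) = \<dots>" .
  qed
qed

lemma ord_ge_sum: "(\<And>x. x \<in> A \<Longrightarrow> ord_ge m (f x)) \<Longrightarrow> ord_ge m (\<Sum>x\<in>A. f x)"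
  by (induction A rule: infinite_finite_induct) (auto intro: ord_ge_add)

lemma has_germ_sum: "(\<And>i. i \<in> I \<Longrightarrow> has_germ k p (f i) (F i)) \<Longrightarrow> has_germ k p (\<lambda>x. \<Sum>i\<in>I. f i x) (\<Sum>i\<in>I. F i)"
  by (induction I rule: infinite_finite_induct) (auto intro: has_germ_zero has_germ_add)

lemma ord_ge_mult_subdegree: "K \<noteq> 0 \<Longrightarrow> ord_ge m F \<Longrightarrow> m + fls_subdegree K = l \<Longrightarrow> ord_ge l (K * F)"
  using ord_ge_mult'[of "fls_subdegree K" K m F l] by (auto simp: ord_ge_iff)

text \<open>This is Liouville's theorem for functions tending to 0, in terms of germs.\<close>

lemma entire_vanishing_at_infinity:
  assumes h: "\<And>p. has_germ 0 p h (H p)" and H: "\<And>b. ord_ge 0 (H (Some b))" and Hi: "ord_ge 1 (H None)"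
  shows "H p = 0"
proof -
  define f where "f = (\<lambda>z. h (Some z))"
  have fexp: "(\<lambda>w. f (b + w)) has_laurent_expansion H (Some b)" for b
    using h[of "Some b"] by (simp add: has_germ_def f_def)
  have "remove_sings f analytic_on {b}" for b
  proof (rule remove_sings_analytic_at)
    show "isolated_singularity_at f b"
      by (rule has_laurent_expansion_isolated[OF fexp])
    show "f \<midarrow>b\<rightarrow> fls_nth (H (Some b)) 0"
      using has_laurent_expansion_imp_tendsto[OF fexp] H[of b] by (auto simp: ord_ge_iff_subdegree)
  qed
  then have hol: "remove_sings f holomorphic_on UNIV"
    using analytic_imp_holomorphic analytic_on_analytic_at by blast
  have iso: "isolated_singularity_at f b" for b
    by (rule has_laurent_expansion_isolated[OF fexp])
  have ev: "near None (\<lambda>x. mero_of UNIV h x = h x)"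
    by (rule near_mero_of[OF _ _ h]) (metis openin_topspace topspace_Alexandroff_compactification topspace_euclidean UNIV_option_conv, simp)
  have rs: "remove_sings f z = mero_of UNIV h (Some z)" for z
    by (simp add: mero_of_def f_def remove_sings_shift_0[of _ z])
  have "(\<lambda>w. h (from_local None w)) \<midarrow>0\<rightarrow> 0"
  proof -
    have e: "(\<lambda>w. h (from_local None w)) has_laurent_expansion H None"
      using h[of None] by (simp add: has_germ_def)
    have "0 \<le> fls_subdegree (H None)" using Hi ord_ge_mono[of 1 "H None" 0] by (simp add: ord_ge_iff_subdegree)
    from has_laurent_expansion_imp_tendsto_0[OF e this] show ?thesis
      using Hi by (simp add: ord_ge_def)
  qed
  moreover have "eventually (\<lambda>w. h (from_local None w) = remove_sings f (1 / w)) (at 0)"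
    using ev unfolding near_def eventually_at_filter
    by eventually_elim (auto simp: rs from_local_def)
  ultimately have "(\<lambda>w. remove_sings f (1 / w)) \<midarrow>0\<rightarrow> 0"
    by (rule Lim_transform_eventually)
  then have "(remove_sings f \<longlongrightarrow> 0) at_infinity"
    by (simp add: lim_at_infinity_0 o_def inverse_eq_divide)
  then have z: "remove_sings f z = 0" for z
    using Liouville_weak_0[OF hol] by blast
  have "near p (\<lambda>x. mero_of UNIV h x = h x \<and> x \<notin> {None})"
    by (intro near_conj near_mero_of[OF _ _ h] near_not_in_finite)
       (metis openin_topspace topspace_Alexandroff_compactification topspace_euclidean UNIV_option_conv, simp_all)
  then have "near p (\<lambda>x. h x = 0)"
    by (rule near_mono) (auto simp: z simp flip: rs)
  then have "has_germ 0 p h 0"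
    using has_germ_zero by (rule has_germ_cong[THEN iffD2])
  then show ?thesis
    by (rule has_germ_unique[OF h])
qed

text \<open>A \<open>k\<close>-differential with at least these zeros is a section of a line bundle of degree
  \<open>- 2 k - (\<Sum> e)\<close>, which is negative.  Dividing it by the rational function with the prescribed orders on the
  affine line gives an entire function, and the degree condition makes it vanish at infinity.\<close>

theorem vanishing_of_negative_degree:
  assumes S: "finite S" and f: "\<And>p. has_germ k p f (F p)" and e: "\<And>p. ord_ge (e p) (F p)"
    and e0: "\<And>b. b \<notin> S \<Longrightarrow> e (Some b) = 0"
    and deg: "(\<Sum>a\<in>S. e (Some a)) + e None + 2 * int k > 0"
  shows "F p = 0"
proof -
  obtain K where K: "\<And>p. has_germ 0 p (lin_prod S (\<lambda>a. - e (Some a))) (K p)" "\<And>p. K p \<noteq> 0"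
    "\<And>p. fls_subdegree (K p) = (case p of Some b \<Rightarrow> if b \<in> S then - e (Some b) else 0 | None \<Rightarrow> - (\<Sum>a\<in>S. - e (Some a)))"
    using has_germ_lin_prod[OF S, of "\<lambda>a. - e (Some a)"] by blast
  define h where "h = (\<lambda>x. lin_prod S (\<lambda>a. - e (Some a)) x * f x)"
  have "has_germ 0 p f (F p / jac_fls p ^ k)" for p
    using f[of p] has_germ_twist by blast
  then have h: "has_germ 0 p h (K p * (F p / jac_fls p ^ k))" for p
    unfolding h_def by (intro has_germ_mult_fun K)
  have "K p * (F p / jac_fls p ^ k) = 0"
  proof (rule entire_vanishing_at_infinity[OF h])
    fix b
    show "ord_ge 0 (K (Some b) * (F (Some b) / jac_fls (Some b) ^ k))"
      using ord_ge_mult_subdegree[OF K(2) e, of "Some b" "Some b" 0] K(3)[of "Some b"] e0[of b]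
      by (auto simp: jac_fls_def)
  next
    have "ord_ge 1 (inverse (jac_fls None ^ k) * (K None * F None))"
    proof (rule ord_ge_mono)
      have "ord_ge (e None + (\<Sum>a\<in>S. e (Some a))) (K None * F None)"
        by (rule ord_ge_mult_subdegree[OF K(2) e]) (simp add: K(3) sum_negf)
      then show "ord_ge (2 * int k + (\<Sum>a\<in>S. e (Some a)) + e None) (inverse (jac_fls None ^ k) * (K None * F None))"
        by (rule ord_ge_mult_subdegree[rotated]) (simp_all add: fls_subdegree_pow fls_subdegree_jac_fls)
    qed (use deg in simp)
    then show "ord_ge 1 (K None * (F None / jac_fls None ^ k))"
      by (simp add: field_simps)
  qed
  then show ?thesis using K(2)[of p] by simp
qed

text \<open>The principal part itself is a rational function with no other poles.  Its behaviour at infinity is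
  recorded up to the first coefficient, where the residue reappears.\<close>

lemma principal_part_at_point:
  "\<exists>h H. (\<forall>p. has_germ 0 p h (H p)) \<and> ord_ge 0 (H (Some a) - A) \<and> (\<forall>b. b \<noteq> a \<longrightarrow> ord_ge 0 (H (Some b))) \<and>
     ord_ge 1 (H None) \<and> fls_nth (H None) 1 = fls_nth A (- 1)"
proof -
  define lin :: "P1 \<Rightarrow> complex" where "lin = (\<lambda>x. case x of None \<Rightarrow> 0 | Some z \<Rightarrow> z - a)"
  obtain L where L: "\<And>p. has_germ 0 p lin (L p)" "\<And>p. L p \<noteq> 0"
    "\<And>p. fls_subdegree (L p) = (if p = Some a then 1 else if p = None then - 1 else 0)" "fls_nth (L None) (- 1) = 1"
    using has_germ_linear[of _ a] unfolding lin_def by metis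
  define N where "N = nat (- fls_subdegree A)"
  define h where "h = (\<lambda>x. \<Sum>j\<in>{1..N}. fls_nth A (- int j) * inverse (lin x) ^ j)"
  define H where "H = (\<lambda>p. \<Sum>j\<in>{1..N}. fls_const (fls_nth A (- int j)) * inverse (L p) ^ j)"
  have h: "has_germ 0 p h (H p)" for p
    unfolding h_def H_def
  proof (intro has_germ_sum has_germ_cmult)
    fix j
    show "has_germ 0 p (\<lambda>x. inverse (lin x) ^ j) (inverse (L p) ^ j)"
      using L(1)[of p] unfolding has_germ_def power_0 mult_1_right by (intro laurent_expansion_intros)
  qed
  have "has_germ 0 (Some a) lin fls_X"
    unfolding has_germ_def lin_def by (simp add: has_laurent_expansion_fps_X)
  then have "L (Some a) = fls_X" using L(1) has_germ_unique by blast
  then have "fls_nth (H (Some a)) k = fls_nth A k" if "k < 0" for k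
  proof -
    have "fls_nth (H (Some a)) k = (\<Sum>j\<in>{1..N}. if int j = - k then fls_nth A (- int j) else 0)"
      using \<open>L (Some a) = fls_X\<close>
      by (auto simp: H_def fls_nth_sum fls_inverse_X intro!: sum.cong)
    also have "\<dots> = (\<Sum>j\<in>{1..N}. if j = nat (- k) then fls_nth A k else 0)"
      using that by (intro sum.cong) auto
    also have "\<dots> = fls_nth A k"
      using that by (auto simp: N_def)
    finally show ?thesis .
  qed
  then have 1: "ord_ge 0 (H (Some a) - A)" by (simp add: ord_ge_def)
  have 2: "ord_ge 0 (H (Some b))" if "b \<noteq> a" for b
    unfolding H_def
  proof (intro ord_ge_sum)
    fix j
    show "ord_ge 0 (fls_const (fls_nth A (- int j)) * inverse (L (Some b)) ^ j)"
      using ord_ge_mult[of 0 "fls_const (fls_nth A (- int j))" 0 "inverse (L (Some b)) ^ j"] L(2,3)[of "Some b"] that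
      by (auto simp: ord_ge_iff_subdegree fls_subdegree_pow)
  qed
  have sub: "fls_subdegree (inverse (L None) ^ j) = int j" for j
    using L(2,3)[of None] by (simp add: fls_subdegree_pow)
  have 3: "ord_ge 1 (H None)"
    unfolding H_def
  proof (intro ord_ge_sum)
    fix j assume "j \<in> {1..N}"
    then have "ord_ge 1 (inverse (L None) ^ j)" using sub[of j] by (auto simp: ord_ge_iff)
    then show "ord_ge 1 (fls_const (fls_nth A (- int j)) * inverse (L None) ^ j)"
      using ord_ge_mult[OF ord_ge_const] by fastforce
  qed
  have "fls_nth (inverse (L None)) 1 = 1"
    using fls_inverse_base[OF L(2)[of None]] L(3)[of None] L(4) by simp
  then have "fls_nth (inverse (L None) ^ j) 1 = (if j = 1 then 1 else 0)" if "j \<in> {1..N}" for j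
    using that sub[of j] by (cases "j = 1") auto
  then have "fls_nth (H None) 1 = (\<Sum>j\<in>{1..N}. if j = 1 then fls_nth A (- 1) else 0)"
    unfolding H_def fls_nth_sum by (intro sum.cong) auto
  also have "\<dots> = fls_nth A (- 1)"
    by (auto simp: N_def)
  finally show ?thesis
    using h 1 2 3 by blast
qed

text \<open>At infinity the constant term is prescribed along with the principal part, by a polynomial in \<open>z\<close>.\<close>

lemma polynomial_part_at_infinity:
  "\<exists>h H. (\<forall>p. has_germ 0 p h (H p)) \<and> (\<forall>b. ord_ge 0 (H (Some b))) \<and>
     ord_ge 1 (H None - A) \<and> fls_nth (H None) 1 = 0"
proof -
  define lin :: "P1 \<Rightarrow> complex" where "lin = (\<lambda>x. case x of None \<Rightarrow> 0 | Some z \<Rightarrow> z)"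
  obtain L where L: "\<And>p. has_germ 0 p lin (L p)" "\<And>p. L p \<noteq> 0"
    "\<And>p. fls_subdegree (L p) = (if p = Some 0 then 1 else if p = None then - 1 else 0)"
    using has_germ_linear[of _ 0] unfolding lin_def diff_0_right by metis
  define N where "N = nat (- fls_subdegree A)"
  define h where "h = (\<lambda>x. \<Sum>j\<in>{0..N}. fls_nth A (- int j) * lin x ^ j)"
  define H where "H = (\<lambda>p. \<Sum>j\<in>{0..N}. fls_const (fls_nth A (- int j)) * L p ^ j)"
  have h: "has_germ 0 p h (H p)" for p
    unfolding h_def H_def
  proof (intro has_germ_sum has_germ_cmult)
    fix j
    show "has_germ 0 p (\<lambda>x. lin x ^ j) (L p ^ j)"
      using L(1)[of p] unfolding has_germ_def power_0 mult_1_right by (intro laurent_expansion_intros)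
  qed
  have 2: "ord_ge 0 (H (Some b))" for b
    unfolding H_def
  proof (intro ord_ge_sum)
    fix j
    show "ord_ge 0 (fls_const (fls_nth A (- int j)) * L (Some b) ^ j)"
      using ord_ge_mult[of 0 "fls_const (fls_nth A (- int j))" 0 "L (Some b) ^ j"] L(2,3)[of "Some b"]
      by (auto simp: ord_ge_iff_subdegree fls_subdegree_pow)
  qed
  have "has_germ 0 None lin fls_X_inv"
  proof -
    have "(\<lambda>w. inverse w) has_laurent_expansion (fls_X_inv :: complex fls)"
      using has_laurent_expansion_inverse[OF has_laurent_expansion_fps_X] by (simp add: fls_inverse_X)
    moreover have "eventually (\<lambda>w. inverse w = lin (from_local None w)) (at 0)"
      unfolding eventually_at_filter
      by (rule always_eventually) (auto simp: lin_def from_local_def divide_simps)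
    ultimately show ?thesis
      unfolding has_germ_def power_0 mult_1_right by (subst has_laurent_expansion_cong[symmetric, OF _ refl])
  qed
  then have LN: "L None = fls_X_inv" using L(1) has_germ_unique by blast
  have n: "fls_nth (H None) k = (if k \<le> 0 then fls_nth A k else 0)" for k
  proof -
    have "fls_nth (H None) k = (\<Sum>j\<in>{0..N}. if int j = - k then fls_nth A (- int j) else 0)"
      by (auto simp: H_def fls_nth_sum LN intro!: sum.cong)
    also have "\<dots> = (if k \<le> 0 then \<Sum>j\<in>{0..N}. if j = nat (- k) then fls_nth A k else 0 else 0)"
    proof (cases "k \<le> 0")
      case True
      then have "(int j = - k) = (j = nat (- k))" for j by auto
      with True show ?thesis by (auto intro!: sum.cong)
    qed (auto intro!: sum.neutral)
    also have "\<dots> = (if k \<le> 0 then fls_nth A k else 0)"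
      by (auto simp: N_def)
    finally show ?thesis .
  qed
  show ?thesis
    using h 2 by (intro exI[of _ h] exI[of _ H]) (auto simp: n ord_ge_def)
qed

text \<open>Sum of the contributions of the points.  The value of the first coefficient at infinity is the residue
  theorem for the 1-form \<open>h dz\<close>.\<close>

theorem principal_parts:
  assumes "finite S"
  shows "\<exists>h H. (\<forall>p. has_germ 0 p h (H p)) \<and> (\<forall>a\<in>S. ord_ge 0 (H (Some a) - A a)) \<and>
    (\<forall>b. b \<notin> S \<longrightarrow> ord_ge 0 (H (Some b))) \<and> ord_ge 1 (H None - B) \<and>
    fls_nth (H None) 1 = (\<Sum>a\<in>S. fls_nth (A a) (- 1))"
proof -
  obtain h1 H1 where 1: "\<And>p. has_germ 0 p h1 (H1 p)" "\<And>b. ord_ge 0 (H1 (Some b))"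
     "ord_ge 1 (H1 None - B)" "fls_nth (H1 None) 1 = 0"
    using polynomial_part_at_infinity[of B] by blast
  have "\<forall>a. \<exists>h H. (\<forall>p. has_germ 0 p h (H p)) \<and> ord_ge 0 (H (Some a) - A a) \<and> (\<forall>b. b \<noteq> a \<longrightarrow> ord_ge 0 (H (Some b))) \<and>
     ord_ge 1 (H None) \<and> fls_nth (H None) 1 = fls_nth (A a) (- 1)"
    using principal_part_at_point by blast
  then obtain h2 H2 where 2: "\<And>a p. has_germ 0 p (h2 a) (H2 a p)" "\<And>a. ord_ge 0 (H2 a (Some a) - A a)"
     "\<And>a b. b \<noteq> a \<Longrightarrow> ord_ge 0 (H2 a (Some b))"
     "\<And>a. ord_ge 1 (H2 a None)" "\<And>a. fls_nth (H2 a None) 1 = fls_nth (A a) (- 1)"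
    by metis
  show ?thesis
  proof (intro exI[of _ "\<lambda>x. h1 x + (\<Sum>a\<in>S. h2 a x)"] exI[of _ "\<lambda>p. H1 p + (\<Sum>a\<in>S. H2 a p)"] conjI ballI allI impI)
    show "has_germ 0 p (\<lambda>x. h1 x + (\<Sum>a\<in>S. h2 a x)) (H1 p + (\<Sum>a\<in>S. H2 a p))" for p
      by (intro has_germ_add has_germ_sum 1 2)
    show "ord_ge 0 (H1 (Some a) + (\<Sum>a'\<in>S. H2 a' (Some a)) - A a)" if "a \<in> S" for a
    proof -
      have "H1 (Some a) + (\<Sum>a'\<in>S. H2 a' (Some a)) - A a =
         H1 (Some a) + ((H2 a (Some a) - A a) + (\<Sum>a'\<in>S - {a}. H2 a' (Some a)))"
        using assms that by (simp add: sum.remove)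
      then show ?thesis
        by (simp only:) (intro ord_ge_add ord_ge_sum 1 2, auto)
    qed
    show "ord_ge 0 (H1 (Some b) + (\<Sum>a\<in>S. H2 a (Some b)))" if "b \<notin> S" for b
      using that by (intro ord_ge_add ord_ge_sum 1 2) auto
    have "H1 None + (\<Sum>a\<in>S. H2 a None) - B = (H1 None - B) + (\<Sum>a\<in>S. H2 a None)" by simp
    then show "ord_ge 1 (H1 None + (\<Sum>a\<in>S. H2 a None) - B)"
      by (simp only:) (intro ord_ge_add ord_ge_sum 1 2)
    show "fls_nth (H1 None + (\<Sum>a\<in>S. H2 a None)) 1 = (\<Sum>a\<in>S. fls_nth (A a) (- 1))"
      by (simp add: fls_nth_sum 1 2)
  qed
qed

text \<open>Prescribing a \<open>k\<close>-differential modulo sections of a line bundle of degree \<open>-1\<close> is possible without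
  any obstruction.  Dividing by a rational function with the orders \<open>e\<close> on the affine line
  turns the conditions into prescribed principal parts, and the constant term at infinity.\<close>

theorem interpolation_of_differentials:
  assumes S: "finite S" and e0: "\<And>b. b \<notin> S \<Longrightarrow> e (Some b) = 0 \<and> T (Some b) = 0"
    and deg: "(\<Sum>a\<in>S. e (Some a)) + e None + 2 * int k = 1"
  obtains f F where "\<And>p. has_germ k p f (F p)" "\<And>p. ord_ge (e p) (F p - T p)"
proof -
  obtain K where K: "\<And>p. has_germ 0 p (lin_prod S (\<lambda>a. e (Some a))) (K p)" "\<And>p. K p \<noteq> 0"
    "\<And>p. fls_subdegree (K p) = (case p of Some b \<Rightarrow> if b \<in> S then e (Some b) else 0 | None \<Rightarrow> - (\<Sum>a\<in>S. e (Some a)))"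
    using has_germ_lin_prod[OF S, of "\<lambda>a. e (Some a)"] by blast
  \<comment> \<open>the orders of \<open>M\<close> are \<open>e\<close> on the affine line, and one less than \<open>e\<close> at infinity by the degree condition\<close>
  define M where "M = (\<lambda>p. K p * jac_fls p ^ k)"
  have M: "M p \<noteq> 0" for p using K(2) by (simp add: M_def)
  have Ms: "fls_subdegree (M (Some b)) = e (Some b)" for b
    using K(2,3)[of "Some b"] e0[of b] by (auto simp: M_def fls_subdegree_pow fls_subdegree_jac_fls)
  have Mn: "fls_subdegree (M None) = e None - 1"
    using K(2,3)[of None] deg by (auto simp: M_def fls_subdegree_pow fls_subdegree_jac_fls)
  obtain h H where h: "\<And>p. has_germ 0 p h (H p)" "\<And>a. a \<in> S \<Longrightarrow> ord_ge 0 (H (Some a) - T (Some a) / M (Some a))"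
    "\<And>b. b \<notin> S \<Longrightarrow> ord_ge 0 (H (Some b))" "ord_ge 1 (H None - T None / M None)"
    using principal_parts[OF S, of "\<lambda>a. T (Some a) / M (Some a)" "T None / M None"] by blast
  have "has_germ k p (lin_prod S (\<lambda>a. e (Some a))) (M p)" for p
    using has_germ_shift_degree[OF K(1), of k p] by (simp add: M_def)
  then have 1: "has_germ k p (\<lambda>x. lin_prod S (\<lambda>a. e (Some a)) x * h x) (M p * H p)" for p
    by (intro has_germ_mult_fun_right h)
  have 2: "ord_ge (e p) (M p * H p - T p)" for p
  proof -
    have eq: "M p * H p - T p = M p * (H p - T p / M p)" using M[of p] by (simp add: field_simps)
    show ?thesis
    proof (cases p)
      case None
      show ?thesis unfolding eq using ord_ge_mult_subdegree[OF M h(4), of None "e None"] Mn by (simp add: None)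
    next
      case (Some b)
      have "ord_ge 0 (H (Some b) - T (Some b) / M (Some b))"
        using h(2,3)[of b] e0[of b] by (cases "b \<in> S") auto
      then show ?thesis unfolding eq using ord_ge_mult_subdegree[OF M] Ms by (auto simp: Some)
    qed
  qed
  show ?thesis by (rule that[OF 1 2])
qed

text \<open>Modulo holomorphic 1-forms the degree is \<open>-2\<close>, and there is one obstruction:
  the residues have to add up to zero.\<close>

theorem interpolation_of_forms:
  assumes S: "finite S" and T0: "\<And>b. b \<notin> S \<Longrightarrow> T (Some b) = 0"
    and res: "(\<Sum>a\<in>S. fls_nth (T (Some a)) (- 1)) + fls_nth (T None) (- 1) = 0"
  obtains f F where "\<And>p. has_germ 1 p f (F p)" "\<And>p. ord_ge 0 (F p - T p)"
proof -
  obtain h H where h: "\<And>p. has_germ 0 p h (H p)" "\<And>a. a \<in> S \<Longrightarrow> ord_ge 0 (H (Some a) - T (Some a))"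
    "\<And>b. b \<notin> S \<Longrightarrow> ord_ge 0 (H (Some b))" "ord_ge 1 (H None - T None / jac_fls None)"
    "fls_nth (H None) 1 = (\<Sum>a\<in>S. fls_nth (T (Some a)) (- 1))"
    using principal_parts[OF S, of "\<lambda>a. T (Some a)" "T None / jac_fls None"] by blast
  have 1: "has_germ 1 p h (jac_fls p * H p)" for p
    using has_germ_shift_degree[OF h(1), of 1 p] by (simp add: mult.commute)
  have 2: "ord_ge 0 (jac_fls p * H p - T p)" for p
  proof (cases p)
    case (Some b)
    then show ?thesis using h(2,3)[of b] T0[of b] by (cases "b \<in> S") (auto simp: jac_fls_def)
  next
    case None
    have "jac_fls None * H None - T None = jac_fls None * (H None - T None / jac_fls None)" by (simp add: field_simps)
    then have "ord_ge (- 1) (jac_fls None * H None - T None)"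
      using ord_ge_mult_subdegree[OF jac_fls_nonzero h(4), of None "-1"] by (simp add: fls_subdegree_jac_fls)
    \<comment> \<open>the residue at infinity, the one coefficient that is not prescribed\<close>
    moreover have "fls_nth (jac_fls None * H None) (- 1) = - fls_nth (H None) 1"
      by (simp add: jac_fls_def fls_shifted_times_simps)
    then have "fls_nth (jac_fls None * H None - T None) (- 1) = 0"
      using res h(5) by (simp add: add_eq_0_iff)
    ultimately show ?thesis
      unfolding None ord_ge_def by (smt (verit))
  qed
  show ?thesis by (rule that[OF 1 2])
qed

section \<open>Power series solutions at a regular singular point\<close>

text \<open>The coefficients of a solution of \<open>X F'' + P F' - Q F = 0\<close>.  The \<open>n\<close>-th one is multiplied by
  \<open>n (n - 1 + P\<^sub>0)\<close>, which may vanish for \<open>n \<le> 2\<close> if \<open>P\<^sub>0\<close> is \<open>0\<close> or \<open>-1\<close>; so the first three are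
  parameters.\<close>

fun frobenius_coeff :: "complex fps \<Rightarrow> complex fps \<Rightarrow> complex \<Rightarrow> complex \<Rightarrow> complex \<Rightarrow> nat \<Rightarrow> complex" where
  "frobenius_coeff P Q f0 f1 f2 n = (if n = 0 then f0 else if n = 1 then f1 else if n = 2 then f2 else
     (\<Sum>i<n. (fps_nth Q (n - 1 - i) - fps_nth P (n - i) * of_nat i) * frobenius_coeff P Q f0 f1 f2 i) /
     (of_nat n * (of_nat n - 1 + fps_nth P 0)))"

declare frobenius_coeff.simps [simp del]

lemma fps_coeff_bound:
  assumes "fps_conv_radius P > 0"
  obtains M B where "M \<ge> 0" "B \<ge> 1" "\<And>n. norm (fps_nth P n) \<le> M * B ^ n"
proof -
  obtain r where r: "0 < r" "ereal r < fps_conv_radius P"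
    using ereal_dense2[OF assms] by auto
  have "summable (\<lambda>n. norm (fps_nth P n * of_real r ^ n))"
    using r by (intro norm_summable_fps) auto
  then have "Bseq (\<lambda>n. norm (fps_nth P n * of_real r ^ n))"
    by (intro convergent_imp_Bseq summable_LIMSEQ_zero[THEN convergentI])
  then obtain M where M: "M > 0" "\<And>n. norm (fps_nth P n * of_real r ^ n) \<le> M"
    by (auto simp: Bseq_def)
  show ?thesis
  proof (rule that[of M "max 1 (1 / r)"])
    fix n
    have "norm (fps_nth P n) = norm (fps_nth P n * of_real r ^ n) * (1 / r) ^ n"
      using r by (simp add: norm_mult norm_power power_divide)
    also have "\<dots> \<le> M * (max 1 (1 / r)) ^ n"
      using r M by (intro mult_mono power_mono) auto
    finally show "norm (fps_nth P n) \<le> M * (max 1 (1 / r)) ^ n" .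
  qed (use M in auto)
qed

text \<open>Majorant argument: if the coefficients of \<open>P\<close> and \<open>Q\<close> are bounded by \<open>M B\<^sup>n\<close>, the factor \<open>n\<close> gained by
  the recursion absorbs the factor \<open>i\<close> of the derivative.\<close>

lemma frobenius_coeff_bound:
  assumes "fps_conv_radius P > 0" "fps_conv_radius Q > 0" "fps_nth P 0 \<in> {0, - 1}"
  shows "\<exists>C \<rho>. \<rho> > 0 \<and> (\<forall>n. norm (frobenius_coeff P Q f0 f1 f2 n) \<le> C * \<rho> ^ n)"
proof -
  obtain M1 B1 where 1: "M1 \<ge> 0" "B1 \<ge> 1" "\<And>n. norm (fps_nth P n) \<le> M1 * B1 ^ n"
    by (rule fps_coeff_bound[OF assms(1)]) blast
  obtain M2 B2 where 2: "M2 \<ge> 0" "B2 \<ge> 1" "\<And>n. norm (fps_nth Q n) \<le> M2 * B2 ^ n"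
    by (rule fps_coeff_bound[OF assms(2)]) blast
  define M where "M = max M1 M2"
  define B where "B = max B1 B2"
  have M: "M \<ge> 0" and B: "B \<ge> 1" using 1 2 by (auto simp: M_def B_def)
  have PB: "norm (fps_nth P n) \<le> M * B ^ n" for n
    by (rule order_trans[OF 1(3)]) (use 1 2 in \<open>auto simp: M_def B_def intro!: mult_mono power_mono\<close>)
  have QB: "norm (fps_nth Q n) \<le> M * B ^ n" for n
    by (rule order_trans[OF 2(3)]) (use 1 2 in \<open>auto simp: M_def B_def intro!: mult_mono power_mono\<close>)
  \<comment> \<open>chosen such that the bound on the sums \<open>T\<close> is preserved by the recursion\<close>
  define \<rho> where "\<rho> = B + M * B"
  have \<rho>: "\<rho> \<ge> 1" using M B by (auto simp: \<rho>_def intro: add_increasing2)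
  define C where "C = norm f0 + norm f1 + norm f2"
  have C: "C \<ge> 0" by (simp add: C_def)
  have T: "M * (\<Sum>i<n. B ^ (n - i) * \<rho> ^ i) \<le> \<rho> ^ n" for n
  proof (induction n)
    case (Suc n)
    have "(\<Sum>i<Suc n. B ^ (Suc n - i) * \<rho> ^ i) = B * (\<Sum>i<n. B ^ (n - i) * \<rho> ^ i) + B * \<rho> ^ n"
      by (simp add: sum_distrib_left Suc_diff_le mult_ac)
    then have "M * (\<Sum>i<Suc n. B ^ (Suc n - i) * \<rho> ^ i) =
       B * (M * (\<Sum>i<n. B ^ (n - i) * \<rho> ^ i)) + M * B * \<rho> ^ n"
      by (simp add: algebra_simps)
    also have "\<dots> \<le> B * \<rho> ^ n + M * B * \<rho> ^ n"
      using Suc B by (intro add_right_mono mult_left_mono) auto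
    also have "\<dots> = \<rho> ^ Suc n" by (simp add: \<rho>_def algebra_simps)
    finally show ?case .
  qed simp
  have "norm (frobenius_coeff P Q f0 f1 f2 n) \<le> C * \<rho> ^ n" for n
  proof (induction n rule: less_induct)
    case (less n)
    show ?case
    proof (cases "n < 3")
      case True
      then have "n = 0 \<or> n = 1 \<or> n = 2" by auto
      then have "norm (frobenius_coeff P Q f0 f1 f2 n) \<le> C"
        by (auto simp: frobenius_coeff.simps C_def)
      also have "C \<le> C * \<rho> ^ n"
        using C \<rho> by (simp add: mult_le_cancel_left1)
      finally show ?thesis .
    next
      case False
      define d where "d = of_nat n * (of_nat n - 1 + fps_nth P 0)"
      define S where "S = (\<Sum>i<n. (fps_nth Q (n - 1 - i) - fps_nth P (n - i) * of_nat i) * frobenius_coeff P Q f0 f1 f2 i)"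
      have eq: "frobenius_coeff P Q f0 f1 f2 n = S / d"
        using False by (subst frobenius_coeff.simps) (simp add: S_def d_def)
      have "norm (of_nat n - 1 + fps_nth P 0) \<ge> 1"
      proof -
        have "\<exists>m::nat. m \<ge> 1 \<and> of_nat n - 1 + fps_nth P 0 = of_nat m"
        proof (cases "fps_nth P 0 = 0")
          case True
          then show ?thesis using False by (intro exI[of _ "n - 1"]) (auto simp: of_nat_diff)
        next
          case False': False
          then have "fps_nth P 0 = - 1" using assms(3) by auto
          then show ?thesis using False by (intro exI[of _ "n - 2"]) (auto simp: of_nat_diff)
        qed
        then show ?thesis by (auto simp: norm_of_nat)
      qed
      then have d: "norm d \<ge> real n"
        unfolding d_def norm_mult by (simp add: mult_le_cancel_left1)
      have "norm S \<le> (\<Sum>i<n. real n * (M * B ^ (n - i)) * (C * \<rho> ^ i))"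
        unfolding S_def
      proof (rule sum_norm_le)
        fix i assume "i \<in> {..<n}"
        then have i: "i < n" by simp
        have "norm (fps_nth Q (n - 1 - i) - fps_nth P (n - i) * of_nat i) \<le>
            M * B ^ (n - 1 - i) + M * B ^ (n - i) * real i"
          using norm_triangle_ineq4[of "fps_nth Q (n - 1 - i)" "fps_nth P (n - i) * of_nat i"]
            QB[of "n - 1 - i"] mult_right_mono[OF PB[of "n - i"], of "real i"] by (simp add: norm_mult)
        also have "\<dots> \<le> M * B ^ (n - i) + M * B ^ (n - i) * real i"
          using M B by (intro add_right_mono mult_left_mono power_increasing) auto
        also have "\<dots> = M * B ^ (n - i) * (1 + real i)" by (simp add: algebra_simps)
        also have "\<dots> \<le> M * B ^ (n - i) * real n"
          using M B i by (intro mult_left_mono) auto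
        finally have "norm (fps_nth Q (n - 1 - i) - fps_nth P (n - i) * of_nat i) \<le> real n * (M * B ^ (n - i))"
          by (simp add: mult_ac)
        then show "norm ((fps_nth Q (n - 1 - i) - fps_nth P (n - i) * of_nat i) * frobenius_coeff P Q f0 f1 f2 i)
          \<le> real n * (M * B ^ (n - i)) * (C * \<rho> ^ i)"
          unfolding norm_mult using less[OF i] M B by (intro mult_mono) auto
      qed
      also have "\<dots> = real n * C * (M * (\<Sum>i<n. B ^ (n - i) * \<rho> ^ i))"
        by (simp add: sum_distrib_left mult_ac)
      also have "\<dots> \<le> real n * C * \<rho> ^ n"
        using T[of n] C by (intro mult_left_mono) auto
      finally have "norm S \<le> real n * (C * \<rho> ^ n)" by simp
      also have "\<dots> \<le> norm d * (C * \<rho> ^ n)"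
        using d C \<rho> by (intro mult_right_mono) auto
      finally show ?thesis
        using d False C \<rho> by (auto simp: eq norm_divide divide_le_eq mult_ac)
    qed
  qed
  then show ?thesis using \<rho> by (intro exI[of _ C] exI[of _ \<rho>]) auto
qed

lemma fps_conv_radius_pos_of_bound:
  fixes F :: "complex fps"
  assumes "\<rho> > 0" "\<And>n. norm (fps_nth F n) \<le> C * \<rho> ^ n"
  shows "fps_conv_radius F > 0"
proof -
  define z where "z = complex_of_real (1 / (2 * \<rho>))"
  have z: "norm z = 1 / (2 * \<rho>)" unfolding z_def norm_of_real using assms(1) by simp
  have "summable (\<lambda>n. C * (1 / 2) ^ n)" by (intro summable_mult summable_geometric) simp
  then have "summable (\<lambda>n. fps_nth F n * z ^ n)"
  proof (rule summable_comparison_test')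
    fix n :: nat
    have "norm (fps_nth F n * z ^ n) \<le> C * \<rho> ^ n * (1 / (2 * \<rho>)) ^ n"
      using assms z by (simp add: norm_mult norm_power mult_right_mono)
    also have "\<dots> = C * (1 / 2) ^ n"
      using assms(1) by (simp add: field_simps power_mult_distrib)
    finally show "norm (fps_nth F n * z ^ n) \<le> C * (1 / 2) ^ n" .
  qed
  then have "conv_radius (fps_nth F) \<ge> norm z" by (rule conv_radius_geI)
  moreover have "ereal (norm z) > 0" using assms(1) by (simp add: z)
  ultimately show ?thesis unfolding fps_conv_radius_def by (rule less_le_trans[rotated])
qed

text \<open>For \<open>P\<^sub>0 = -1\<close> the exponents are \<open>0\<close> and \<open>2\<close> and for \<open>P\<^sub>0 = 0\<close> they are \<open>0\<close> and \<open>1\<close>.  The two assumptions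
  on the initial coefficients are the equations of degrees 0 and 1, which the recursion does not solve.\<close>

theorem frobenius:
  fixes P Q :: "complex fps"
  assumes "fps_conv_radius P > 0" "fps_conv_radius Q > 0" "fps_nth P 0 \<in> {0, - 1}"
    and e1: "fps_nth P 0 * f1 = fps_nth Q 0 * f0"
    and e2: "2 * (1 + fps_nth P 0) * f2 = fps_nth Q 1 * f0 + fps_nth Q 0 * f1 - fps_nth P 1 * f1"
  obtains F where "fps_conv_radius F > 0" "fps_nth F 0 = f0" "fps_nth F 1 = f1" "fps_nth F 2 = f2"
    "fps_X * fps_deriv (fps_deriv F) + P * fps_deriv F - Q * F = 0"
proof -
  define f where "f = frobenius_coeff P Q f0 f1 f2"
  have f012: "f 0 = f0" "f 1 = f1" "f 2 = f2"
    by (simp_all add: f_def frobenius_coeff.simps)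
  define S where "S = (\<lambda>n. \<Sum>i<n. (fps_nth Q (n - 1 - i) - fps_nth P (n - i) * of_nat i) * f i)"
  have rec: "of_nat n * (of_nat n - 1 + fps_nth P 0) * f n = S n" if "n > 0" for n
  proof -
    have nz: "of_nat n - 1 + fps_nth P 0 \<noteq> 0" if "n \<ge> 3"
    proof
      assume "of_nat n - 1 + fps_nth P 0 = 0"
      then have "of_nat n = (1 :: complex) \<or> of_nat n = (2 :: complex)"
        using assms(3) by (auto simp: algebra_simps)
      then have "n = 1 \<or> n = 2" by (metis of_nat_1 of_nat_eq_iff of_nat_numeral)
      then show False using \<open>n \<ge> 3\<close> by auto
    qed
    from that have "n = 1 \<or> n = 2 \<or> n \<ge> 3" by auto
    then consider "n = 1" | "n = 2" | "n \<ge> 3" by blast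
    then show ?thesis
    proof cases
      case 3
      then have "f n = S n / (of_nat n * (of_nat n - 1 + fps_nth P 0))"
        unfolding f_def by (subst frobenius_coeff.simps) (simp add: S_def f_def)
      then show ?thesis using nz 3 by simp
    next
      case 1
      then show ?thesis using e1 f012 by (simp add: S_def)
    next
      case 2
      then show ?thesis using e2 f012
        by (simp add: S_def numeral_2_eq_2 algebra_simps)
    qed
  qed
  define F where "F = Abs_fps f"
  have "fps_X * fps_deriv (fps_deriv F) + P * fps_deriv F - Q * F = 0"
  proof (rule fps_ext)
    fix m
    have a: "fps_nth (fps_X * fps_deriv (fps_deriv F)) m = of_nat m * of_nat (m + 1) * f (m + 1)"
      by (cases m) (auto simp: F_def algebra_simps)
    have "fps_nth (P * fps_deriv F) m = (\<Sum>i\<le>m. fps_nth P (m - i) * (of_nat (i + 1) * f (i + 1)))"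
      unfolding mult.commute[of P] fps_mult_nth by (simp add: F_def mult_ac atLeast0AtMost)
    also have "\<dots> = (\<Sum>i\<in>{1..Suc m}. fps_nth P (Suc m - i) * (of_nat i * f i))"
      by (rule sum.reindex_bij_witness[of _ "\<lambda>i. i - 1" Suc]) auto
    also have "\<dots> = (\<Sum>i\<in>{..Suc m}. fps_nth P (Suc m - i) * (of_nat i * f i))"
      by (rule sum.mono_neutral_left) auto
    also have "\<dots> = (\<Sum>i<Suc m. fps_nth P (Suc m - i) * (of_nat i * f i)) + fps_nth P 0 * (of_nat (Suc m) * f (Suc m))"
      by (simp add: lessThan_Suc_atMost)
    finally have b: "fps_nth (P * fps_deriv F) m = \<dots>" .
    have c: "fps_nth (Q * F) m = (\<Sum>i<Suc m. fps_nth Q (m - i) * f i)"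
      unfolding mult.commute[of Q] fps_mult_nth by (simp add: F_def mult_ac atLeast0AtMost lessThan_Suc_atMost)
    have "fps_nth (fps_X * fps_deriv (fps_deriv F) + P * fps_deriv F - Q * F) m =
       of_nat (Suc m) * (of_nat (Suc m) - 1 + fps_nth P 0) * f (Suc m) - S (Suc m)"
      unfolding fps_add_nth fps_sub_nth a b c S_def
      by (simp add: algebra_simps sum_subtractf)
    then show "fps_nth (fps_X * fps_deriv (fps_deriv F) + P * fps_deriv F - Q * F) m = fps_nth 0 m"
      using rec[of "Suc m"] by simp
  qed
  moreover have "fps_conv_radius F > 0"
    using frobenius_coeff_bound[OF assms(1-3), of f0 f1 f2] fps_conv_radius_pos_of_bound[of _ F]
    by (auto simp: F_def f_def)
  ultimately show ?thesis
    using that[of F] f012 by (simp add: F_def)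
qed

text \<open>The equations for horizontal sections \<open>(F, G dw)\<close> when the connection matrix has columns
  \<open>(0, \<Gamma>)\<close> and \<open>(1, \<Delta>)\<close>.\<close>

definition horizontal_series :: "complex fls \<Rightarrow> complex fls \<Rightarrow> complex fls \<Rightarrow> complex fls \<Rightarrow> bool" where
  "horizontal_series \<Gamma> \<Delta> F G \<longleftrightarrow> fls_deriv F + G = 0 \<and> \<Gamma> * F + (fls_deriv G + \<Delta> * G) = 0"

lemma fls_regpart_X_mult:
  assumes "ord_ge (- 1) A"
  shows "fps_to_fls (fls_regpart (fls_X * A)) = fls_X * A"
proof -
  have "ord_ge 0 (fls_X * A)" using ord_ge_mult[of 1 fls_X "-1" A] assms by (simp add: ord_ge_iff)
  then show ?thesis by (simp add: ord_ge_iff_subdegree)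
qed

lemma fls_X_mult_nth: "fls_nth (fls_X * (A :: complex fls)) k = fls_nth A (k - 1)"
  by (simp add: fls_X_times_conv_shift)

text \<open>Eliminating \<open>G = - F'\<close> gives \<open>F'' + \<Delta> F' - \<Gamma> F = 0\<close>.  The case of residue \<open>-1\<close> serves at the
  points of \<open>Q\<close>, and that of residue 0 at ordinary points.\<close>

theorem horizontal_series_exists:
  assumes \<Gamma>: "fls_conv_radius \<Gamma> > 0" "ord_ge (- 1) \<Gamma>" and \<Delta>: "fls_conv_radius \<Delta> > 0" "ord_ge (- 1) \<Delta>"
    and a: "fls_nth \<Delta> (- 1) \<in> {0, - 1}"
    and e1: "fls_nth \<Delta> (- 1) * f1 = fls_nth \<Gamma> (- 1) * f0"
    and e2: "2 * (1 + fls_nth \<Delta> (- 1)) * f2 = fls_nth \<Gamma> 0 * f0 + fls_nth \<Gamma> (- 1) * f1 - fls_nth \<Delta> 0 * f1"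
  obtains F G where "fls_conv_radius F > 0" "fls_conv_radius G > 0" "ord_ge 0 F" "ord_ge 0 G" "horizontal_series \<Gamma> \<Delta> F G"
    "fls_nth F 0 = f0" "fls_nth F 1 = f1" "fls_nth F 2 = f2"
proof -
  define P where "P = fls_regpart (fls_X * \<Delta>)"
  define Q where "Q = fls_regpart (fls_X * \<Gamma>)"
  have PQ: "fps_to_fls P = fls_X * \<Delta>" "fps_to_fls Q = fls_X * \<Gamma>"
    using fls_regpart_X_mult \<Gamma> \<Delta> by (auto simp: P_def Q_def)
  have n: "fps_nth P 0 = fls_nth \<Delta> (- 1)" "fps_nth P 1 = fls_nth \<Delta> 0"
    "fps_nth Q 0 = fls_nth \<Gamma> (- 1)" "fps_nth Q 1 = fls_nth \<Gamma> 0"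
    by (simp_all add: P_def Q_def fls_X_mult_nth)
  have "fps_conv_radius P > 0" "fps_conv_radius Q > 0"
    using \<Gamma>(1) \<Delta>(1) by (auto simp: P_def Q_def fps_conv_radius_fls_regpart fls_X_times_conv_shift)
  then obtain F where F: "fps_conv_radius F > 0" "fps_nth F 0 = f0" "fps_nth F 1 = f1" "fps_nth F 2 = f2"
    "fps_X * fps_deriv (fps_deriv F) + P * fps_deriv F - Q * F = 0"
    by (rule frobenius[of P Q f1 f0 f2]) (use a e1 e2 in \<open>auto simp only: n\<close>)
  define H where "H = fps_to_fls F"
  have "fps_to_fls (fps_X * fps_deriv (fps_deriv F) + P * fps_deriv F - Q * F) = 0"
    using F(5) by simp
  then have "fls_X * fls_deriv (fls_deriv H) + fls_X * \<Delta> * fls_deriv H - fls_X * \<Gamma> * H = 0"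
    by (simp add: fls_times_fps_to_fls PQ H_def fls_deriv_fps_to_fls)
  then have "fls_X * (fls_deriv (fls_deriv H) + \<Delta> * fls_deriv H - \<Gamma> * H) = 0"
    by (simp add: algebra_simps)
  then have eq: "fls_deriv (fls_deriv H) + \<Delta> * fls_deriv H - \<Gamma> * H = 0" by simp
  show ?thesis
  proof (rule that)
    show "fls_conv_radius H > 0" using F(1) by (simp add: H_def)
    then show "fls_conv_radius (- fls_deriv H) > 0"
      using fls_conv_radius_deriv less_le_trans by (metis fls_conv_radius_uminus)
    show "ord_ge 0 H" by (simp add: H_def ord_ge_def)
    then show "ord_ge 0 (- fls_deriv H)" by (simp add: ord_ge_minus ord_ge_0_deriv)
    show "horizontal_series \<Gamma> \<Delta> H (- fls_deriv H)"
      using eq by (simp add: horizontal_series_def algebra_simps)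
    show "fls_nth H 0 = f0" "fls_nth H 1 = f1" "fls_nth H 2 = f2" using F by (auto simp: H_def)
  qed
qed

lemma fls_mult_coeffs:
  assumes "ord_ge (- 1) A" "ord_ge 0 (F :: complex fls)"
  shows "fls_nth (A * F) (- 1) = fls_nth A (- 1) * fls_nth F 0"
    "fls_nth (A * F) 0 = fls_nth A (- 1) * fls_nth F 1 + fls_nth A 0 * fls_nth F 0"
proof -
  define P where "P = fls_regpart (fls_X * A)"
  define H where "H = fls_regpart F"
  have PH: "fps_to_fls P = fls_X * A" "fps_to_fls H = F"
    using fls_regpart_X_mult assms by (auto simp: P_def H_def ord_ge_iff_subdegree)
  have eq: "fls_nth (A * F) k = fls_nth (fps_to_fls (P * H)) (k + 1)" for k
    by (simp add: fls_times_fps_to_fls PH mult.assoc fls_X_mult_nth)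
  show "fls_nth (A * F) (- 1) = fls_nth A (- 1) * fls_nth F 0"
    "fls_nth (A * F) 0 = fls_nth A (- 1) * fls_nth F 1 + fls_nth A 0 * fls_nth F 0"
    by (auto simp: eq fps_mult_nth P_def H_def fls_X_mult_nth)
qed

text \<open>The coefficients of degrees \<open>-1\<close> and \<open>0\<close> of the equations.  In degree 0 the unknown second
  coefficient of \<open>F\<close> cancels, which leaves a condition on \<open>\<Gamma>\<close> and \<open>\<Delta>\<close> as soon as
  \<open>F\<close> does not vanish at the point.\<close>

lemma horizontal_series_indicial:
  assumes "ord_ge (- 1) \<Gamma>" "ord_ge (- 1) \<Delta>" "fls_nth \<Delta> (- 1) = - 1" "ord_ge 0 F" "ord_ge 0 G" "horizontal_series \<Gamma> \<Delta> F G"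
  defines "v \<equiv> fls_nth \<Gamma> (- 1)"
  shows "fls_nth G 0 = v * fls_nth F 0" "fls_nth F 1 = - fls_nth G 0"
    "fls_nth F 0 * (fls_nth \<Gamma> 0 + fls_nth \<Delta> 0 * v - v ^ 2) = 0"
proof -
  have 1: "fls_deriv F + G = 0" and 2: "\<Gamma> * F + (fls_deriv G + \<Delta> * G) = 0"
    using assms(6) by (auto simp: horizontal_series_def)
  have "fls_nth (fls_deriv F + G) 0 = 0" using 1 by simp
  then show F1: "fls_nth F 1 = - fls_nth G 0" by (simp add: eq_neg_iff_add_eq_0)
  have "fls_nth (\<Gamma> * F + (fls_deriv G + \<Delta> * G)) (- 1) = 0" using 2 by simp
  then show G0: "fls_nth G 0 = v * fls_nth F 0"
    using assms(3) by (simp add: fls_mult_coeffs assms v_def)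
  have "fls_nth (\<Gamma> * F + (fls_deriv G + \<Delta> * G)) 0 = 0" using 2 by simp
  then have "v * fls_nth F 1 + fls_nth \<Gamma> 0 * fls_nth F 0 + fls_nth \<Delta> 0 * fls_nth G 0 = 0"
    using assms(3) by (simp add: fls_mult_coeffs assms v_def)
  then show "fls_nth F 0 * (fls_nth \<Gamma> 0 + fls_nth \<Delta> 0 * v - v ^ 2) = 0"
    by (simp add: F1 G0 algebra_simps power2_eq_square)
qed

text \<open>The Wronskian \<open>W\<close> satisfies \<open>W' = - \<Delta> W\<close>, so it has order 1 unless it is zero.  But solutions
  vanishing at the point have order at least 2, which makes the order of \<open>W\<close> at least 3.\<close>

lemma wronskian_zero:
  assumes \<Gamma>: "ord_ge (- 1) \<Gamma>" and \<Delta>: "ord_ge (- 1) \<Delta>" "fls_nth \<Delta> (- 1) = - 1"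
    and 1: "ord_ge 0 F1" "ord_ge 0 G1" "horizontal_series \<Gamma> \<Delta> F1 G1" and 2: "ord_ge 0 F2" "ord_ge 0 G2" "horizontal_series \<Gamma> \<Delta> F2 G2"
    and 0: "fls_nth F1 0 = 0" "fls_nth F2 0 = 0"
  shows "F1 * G2 - F2 * G1 = 0"
proof (rule ccontr)
  define W where "W = F1 * G2 - F2 * G1"
  assume "F1 * G2 - F2 * G1 \<noteq> 0"
  then have W: "W \<noteq> 0" by (simp add: W_def)
  have vb2: "ord_ge 2 F \<and> ord_ge 1 G" if "ord_ge 0 F" "ord_ge 0 G" "horizontal_series \<Gamma> \<Delta> F G" "fls_nth F 0 = 0" for F G
  proof -
    have "fls_nth G 0 = 0" "fls_nth F 1 = 0"
      using horizontal_series_indicial(1,2)[OF \<Gamma> \<Delta> that(1-3)] that(4) by auto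
    moreover have "k < 2 \<Longrightarrow> k < 0 \<or> k = 0 \<or> k = 1" "k < 1 \<Longrightarrow> k < 0 \<or> k = 0" for k :: int by auto
    ultimately show ?thesis using that by (fastforce simp: ord_ge_def)
  qed
  have "ord_ge 3 W"
    unfolding W_def using vb2[OF 1 0(1)] vb2[OF 2 0(2)]
    by (intro ord_ge_diff ord_ge_mult'[of 2 _ 1]) auto
  then have m: "fls_subdegree W \<ge> 3" using W by (simp add: ord_ge_iff)
  have d1: "fls_deriv F1 = - G1" "fls_deriv G1 = - \<Gamma> * F1 - \<Delta> * G1"
    using 1(3) by (auto simp: horizontal_series_def eq_neg_iff_add_eq_0 algebra_simps)
  have d2: "fls_deriv F2 = - G2" "fls_deriv G2 = - \<Gamma> * F2 - \<Delta> * G2"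
    using 2(3) by (auto simp: horizontal_series_def eq_neg_iff_add_eq_0 algebra_simps)
  have dW: "fls_deriv W = - (\<Delta> * W)"
    by (simp add: W_def d1 d2 algebra_simps)
  define m where "m = fls_subdegree W"
  have "\<Delta> \<noteq> 0" using \<Delta>(2) by auto
  then have "fls_subdegree \<Delta> = - 1"
    using \<Delta> by (intro fls_subdegree_eqI) (auto simp: ord_ge_def)
  then have "fls_nth (\<Delta> * W) (m - 1) = - fls_nth W m"
    using fls_times_base[of \<Delta> W] \<Delta>(2) by (simp add: m_def)
  moreover have "fls_nth (fls_deriv W) (m - 1) = of_int m * fls_nth W m" by simp
  ultimately have "of_int m * fls_nth W m = fls_nth W m"
    using dW by simp
  then have "of_int m = (1 :: complex)" using W by (simp add: m_def)
  then show False using m by (simp add: m_def)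
qed

section \<open>Horizontal sections near a point\<close>

lemma near_iff_ball: "near p P \<longleftrightarrow> (\<exists>r>0. \<forall>x\<in>from_local p ` (ball 0 r - {0}). P x)"
  unfolding near_def eventually_at by (intro arg_cong[of _ _ Ex] ext) auto

lemma mero_of_analytic:
  assumes "Some z \<in> U" "(\<lambda>z. h (Some z)) analytic_on {z}"
  shows "mero_of U h (Some z) = h (Some z)"
  using assms remove_sings_shift_0[of "\<lambda>z. h (Some z)" z] by (simp add: mero_of_def)

text \<open>A representative in \<open>mero U\<close> has no removable singularities.\<close>

lemma mero_analytic:
  assumes "f \<in> mero U" "Some z \<in> U" "has_germ k (Some z) f F" "ord_ge 0 F"
  shows "(\<lambda>z. f (Some z)) analytic_on {z}"
proof -
  have n: "(\<lambda>w. f (Some (z + w))) nicely_meromorphic_on {0}"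
    using assms(1,2) by (auto simp: mero_def)
  have e: "(\<lambda>w. f (Some (z + w))) has_laurent_expansion F"
    using assms(3) by (simp add: has_germ_def)
  have "\<not> is_pole (\<lambda>w. f (Some (z + w))) 0"
  proof
    assume "is_pole (\<lambda>w. f (Some (z + w))) 0"
    then have "fls_subdegree F < 0" using is_pole_0_imp_neg_fls_subdegree[OF e] by simp
    then show False using assms(4) by (simp add: ord_ge_iff_subdegree)
  qed
  then have "(\<lambda>w. f (Some (z + w))) analytic_on {0}"
    using nicely_meromorphic_on_imp_analytic_at[OF n] by simp
  then show ?thesis by (simp add: analytic_at_shift[of "\<lambda>z. f (Some z)" z])
qed

lemma E0_analytic:
  assumes "s \<in> E0 D U" "Some z \<in> U" "Some z \<notin># D"
  shows "(\<lambda>z. fst s (Some z)) analytic_on {z}" "(\<lambda>z. snd s (Some z)) analytic_on {z}"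
proof -
  from E0E[OF assms(1,2)] obtain F G where "has_germ 0 (Some z) (fst s) F" "has_germ 1 (Some z) (snd s) G"
    "ord_ge 0 F" "ord_ge (- int (count D (Some z))) G" .
  moreover have "count D (Some z) = 0" using assms(3) by (simp add: count_eq_zero_iff)
  ultimately show "(\<lambda>z. fst s (Some z)) analytic_on {z}" "(\<lambda>z. snd s (Some z)) analytic_on {z}"
    using mero_analytic[OF E0_mero(1)[OF assms(1)] assms(2)] mero_analytic[OF E0_mero(2)[OF assms(1)] assms(2)]
    by auto
qed

lemma analytic_imp_DERIV:
  "f analytic_on {z} \<Longrightarrow> (f has_field_derivative deriv f z) (at z)"
  using analytic_on_imp_differentiable_at[of f "{z}" z] DERIV_deriv_iff_field_differentiable by auto

lemma exists_function_with_germ: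
  assumes "fls_conv_radius F > 0"
  shows "\<exists>f. has_germ k p f F"
proof -
  define f where "f = (\<lambda>x. eval_fls F (inv (from_local p) x))"
  have "has_germ 0 p f F"
    unfolding has_germ_def f_def
    using eval_fls_has_laurent_expansion[OF assms] by (simp add: inv_f_f[OF inj_from_local])
  then have "has_germ 0 p (\<lambda>x. f x) F" .
  moreover obtain J where J: "has_germ 0 p (\<lambda>x. inverse (jac p (inv (from_local p) x)) ^ k) J" "J = inverse (jac_fls p) ^ k"
    unfolding has_germ_def using jac_has_laurent_expansion
    by (simp add: inv_f_f[OF inj_from_local] has_laurent_expansion_power has_laurent_expansion_inverse)
  ultimately have "has_germ 0 p (\<lambda>x. f x * inverse (jac p (inv (from_local p) x)) ^ k) (F * J)"
    by (intro has_germ_mult_fun)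
  moreover have "F * J = F / jac_fls p ^ k" by (simp add: J(2) field_simps)
  ultimately show ?thesis using has_germ_twist by metis
qed

lemma open_from_local_ball: "openin P1_top (from_local p ` ball 0 r)"
  by (rule open_from_local_image) simp

lemma from_local_image_Diff: "from_local p ` (A - {0}) = from_local p ` A - {p}"
  using inj_from_local[of p] by (auto simp: inj_def) (metis from_local_0 from_local_eq_iff)

lemma center_in_ball: "r > 0 \<Longrightarrow> p \<in> from_local p ` ball 0 r"
  by (metis centre_in_ball from_local_0 image_eqI)

text \<open>Horizontality of \<open>(f, g dz)\<close> near a finite point, as a first order system in the coordinate \<open>z\<close>.\<close>

definition horizontal_at :: "(P1 \<Rightarrow> complex) \<Rightarrow> (P1 \<Rightarrow> complex) \<Rightarrow> (P1 \<Rightarrow> complex) \<Rightarrow> (P1 \<Rightarrow> complex) \<Rightarrow> P1 \<Rightarrow> bool" where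
  "horizontal_at \<gamma> \<delta> f g x \<longleftrightarrow> (\<exists>z. x = Some z \<and> (\<lambda>z. f (Some z)) analytic_on {z} \<and>
     (\<lambda>z. g (Some z)) analytic_on {z} \<and> deriv (\<lambda>z. f (Some z)) z = - g x \<and>
     deriv (\<lambda>z. g (Some z)) z = - \<gamma> x * f x - \<delta> x * g x)"

lemma open_Some_vimage: "openin P1_top U \<Longrightarrow> open (Some -` U)"
  using continuous_map_Some[of euclidean] by (auto simp: continuous_map_def vimage_def)

lemma horizontal_at_cong:
  assumes "openin P1_top V" "x \<in> V" "\<And>y. y \<in> V \<Longrightarrow> f y = f' y \<and> g y = g' y"
  shows "horizontal_at \<gamma> \<delta> f g x \<longleftrightarrow> horizontal_at \<gamma> \<delta> f' g' x"
proof (cases x)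
  case (Some z)
  have "eventually (\<lambda>w. w \<in> Some -` V) (nhds z)"
    using assms(2) Some by (intro eventually_nhds_in_open open_Some_vimage assms(1)) auto
  then have "eventually (\<lambda>w. f (Some w) = f' (Some w) \<and> g (Some w) = g' (Some w)) (nhds z)"
    by eventually_elim (use assms(3) in auto)
  then have ev: "eventually (\<lambda>w. f (Some w) = f' (Some w)) (nhds z)" "eventually (\<lambda>w. g (Some w) = g' (Some w)) (nhds z)"
    by (auto elim: eventually_mono)
  show ?thesis
    using analytic_at_cong[OF ev(1) refl] analytic_at_cong[OF ev(2) refl] deriv_cong_ev[OF ev(1) refl]
      deriv_cong_ev[OF ev(2) refl] assms(3)[OF assms(2)]
    by (simp add: horizontal_at_def Some)
qed (simp add: horizontal_at_def)

lemma horizontal_sectionD: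
  assumes "openin P1_top U" "s \<in> E0 D U" "conn D \<gamma> \<delta> U s = zero_section" "Some z \<in> U" "Some z \<notin># D"
    "(\<lambda>z. \<gamma> (Some z)) analytic_on {z}" "(\<lambda>z. \<delta> (Some z)) analytic_on {z}"
  shows "horizontal_at \<gamma> \<delta> (fst s) (snd s) (Some z)"
proof -
  have a: "(\<lambda>z. fst s (Some z)) analytic_on {z}" "(\<lambda>z. snd s (Some z)) analytic_on {z}"
    using E0_analytic[OF assms(2,4,5)] by auto
  have d: "(\<lambda>z. ddz h (Some z)) = deriv (\<lambda>z. h (Some z))" for h
    by (simp add: ddz_def)
  have d': "(\<lambda>z. ddz (fst s) (Some z)) analytic_on {z}" "(\<lambda>z. ddz (snd s) (Some z)) analytic_on {z}"
    unfolding d using a by (auto intro: analytic_deriv)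
  have "mero_of U (nabla_fst (fst s) (snd s)) (Some z) = nabla_fst (fst s) (snd s) (Some z)"
    "mero_of U (nabla_snd \<gamma> \<delta> (fst s) (snd s)) (Some z) = nabla_snd \<gamma> \<delta> (fst s) (snd s) (Some z)"
    using a d' assms(4,6,7) by (auto intro!: mero_of_analytic analytic_intros)
  then have "nabla_fst (fst s) (snd s) (Some z) = 0" "nabla_snd \<gamma> \<delta> (fst s) (snd s) (Some z) = 0"
    using assms(3) unfolding conn_in[OF assms(1,2)] zero_section_def by auto
  then show ?thesis
    using a by (auto simp: horizontal_at_def ddz_def algebra_simps eq_neg_iff_add_eq_0)
qed

text \<open>The exceptional point is allowed because sections are determined by nearby values.\<close>

lemma horizontal_sectionI:
  assumes U: "openin P1_top U" and s: "s \<in> E0 D U"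
    and h: "\<And>x. x \<in> U \<Longrightarrow> x \<noteq> p \<Longrightarrow> horizontal_at \<gamma> \<delta> (fst s) (snd s) x"
  shows "conn D \<gamma> \<delta> U s = zero_section"
proof -
  have "near x (\<lambda>y. y \<in> U \<and> y \<notin> {p})" if "x \<in> U" for x
    by (intro near_conj near_in U that near_not_in_finite) simp
  moreover have "nabla_fst (fst s) (snd s) y = 0" "nabla_snd \<gamma> \<delta> (fst s) (snd s) y = 0"
    if "y \<in> U \<and> y \<notin> {p}" for y
    using h[of y] that by (auto simp: horizontal_at_def ddz_def)
  ultimately have "mero_of U (nabla_fst (fst s) (snd s)) = mero_of U (\<lambda>_. 0)"
    "mero_of U (nabla_snd \<gamma> \<delta> (fst s) (snd s)) = mero_of U (\<lambda>_. 0)"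
    by (intro mero_of_cong; blast intro: near_mono)+
  then show ?thesis
    unfolding conn_in[OF U s] zero_section_def by simp
qed

text \<open>A formal solution with positive radius of convergence gives an actual solution near \<open>p\<close>, because the
  defect of the equations has zero germ.\<close>

lemma horizontal_functions_exist:
  assumes \<Gamma>: "has_germ 2 p \<gamma> \<Gamma>" and \<Delta>: "has_germ 1 p \<delta> \<Delta>"
    and F: "fls_conv_radius F > 0" and G: "fls_conv_radius G > 0"
    and h: "horizontal_series \<Gamma> (flat_coeff p + \<Delta>) F G"
  obtains f g where "has_germ 0 p f F" "has_germ 1 p g G" "near p (horizontal_at \<gamma> \<delta> f g)"
proof -
  obtain f where f: "has_germ 0 p f F" using exists_function_with_germ[OF F] by blast
  obtain g where g: "has_germ 1 p g G" using exists_function_with_germ[OF G] by blast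
  have z: "fls_deriv F + G = 0" "\<Gamma> * F + (fls_deriv G + flat_coeff p * G + \<Delta> * G) = 0"
    using h by (auto simp: horizontal_series_def algebra_simps)
  note c = conn_germs[OF \<Gamma> \<Delta> f g, unfolded z]
  have "near p (\<lambda>x. (nabla_fst f g x = 0 \<and> nabla_snd \<gamma> \<delta> f g x = 0) \<and>
     (\<forall>z. x = Some z \<longrightarrow> (\<lambda>z. f (Some z)) analytic_on {z}) \<and> (\<forall>z. x = Some z \<longrightarrow> (\<lambda>z. g (Some z)) analytic_on {z})
     \<and> x \<notin> {None})"
    using near_eqI_germ[OF c(1) has_germ_zero] near_eqI_germ[OF c(2) has_germ_zero]
    by (intro near_conj has_germ_near_analytic[OF f] has_germ_near_analytic[OF g] near_not_in_finite) auto
  then have "near p (horizontal_at \<gamma> \<delta> f g)"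
  proof (rule near_mono)
    fix x
    assume *: "(nabla_fst f g x = 0 \<and> nabla_snd \<gamma> \<delta> f g x = 0) \<and>
     (\<forall>z. x = Some z \<longrightarrow> (\<lambda>z. f (Some z)) analytic_on {z}) \<and> (\<forall>z. x = Some z \<longrightarrow> (\<lambda>z. g (Some z)) analytic_on {z})
     \<and> x \<notin> {None}"
    then obtain z where z: "x = Some z" by auto
    have "deriv (\<lambda>z. f (Some z)) z = - g x"
      using * by (simp add: z ddz_def eq_neg_iff_add_eq_0)
    moreover have "deriv (\<lambda>z. g (Some z)) z = - \<gamma> x * f x - \<delta> x * g x"
      using * by (simp add: z ddz_def algebra_simps eq_neg_iff_add_eq_0)
    ultimately show "horizontal_at \<gamma> \<delta> f g x"
      using * z by (auto simp: horizontal_at_def)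
  qed
  then show ?thesis using that f g by blast
qed

lemma mero_of_pair_in_E0:
  assumes V: "openin P1_top V" and p: "p \<in> V" and f: "has_germ 0 p f F" "ord_ge 0 F" and g: "has_germ 1 p g G" "ord_ge 0 G"
    and h: "\<And>x. x \<in> V \<Longrightarrow> x \<noteq> p \<Longrightarrow> (\<exists>z. x = Some z \<and> (\<lambda>z. f (Some z)) analytic_on {z} \<and> (\<lambda>z. g (Some z)) analytic_on {z})"
  shows "(mero_of V f, mero_of V g) \<in> E0 D V"
proof (rule E0I[OF V])
  fix x assume x: "x \<in> V"
  show "\<exists>F G. has_germ 0 x f F \<and> has_germ 1 x g G \<and> ord_ge 0 F \<and> ord_ge (- int (count D x)) G"
  proof (cases "x = p")
    case True
    have "ord_ge (- int (count D x)) G" using g(2) by (rule ord_ge_mono) simp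
    then show ?thesis using f g True by blast
  next
    case False
    then obtain z where z: "x = Some z" "(\<lambda>z. f (Some z)) analytic_on {z}" "(\<lambda>z. g (Some z)) analytic_on {z}"
      using h x by blast
    obtain F' where F': "has_germ 0 x f F'" "ord_ge 0 F'" using has_germ_Some_analytic[OF z(2), of 0] z(1) by blast
    obtain G' where G': "has_germ 1 x g G'" "ord_ge 0 G'" using has_germ_Some_analytic[OF z(3), of 1] z(1) by blast
    have "ord_ge (- int (count D x)) G'" using G'(2) by (rule ord_ge_mono) simp
    then show ?thesis using F' G' by blast
  qed
qed

text \<open>The affine line carries the subspace topology of the projective line.\<close>

lemma connected_Some_vimage:
  assumes "connectedin P1_top U" "None \<notin> U"
  shows "connected (Some -` U)"
proof -
  have U: "U = Some ` (Some -` U)"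
  proof -
    have "x \<in> Some ` (Some -` U)" if "x \<in> U" for x
      using that assms(2) by (cases x) auto
    then show ?thesis by auto
  qed
  have "homeomorphic_map euclidean (subtopology P1_top (Some ` topspace euclidean)) (Some :: complex \<Rightarrow> P1)"
    using embedding_map_Some[of euclidean] by (simp add: embedding_map_def)
  from homeomorphic_map_connectedness[OF this, of "Some -` U"]
  have "connectedin (subtopology P1_top (range Some)) (Some ` (Some -` U)) \<longleftrightarrow> connectedin euclidean (Some -` U)"
    by simp
  moreover have "connectedin (subtopology P1_top (range Some)) (Some ` (Some -` U))"
    using assms(1) U by (auto simp: connectedin_subtopology)
  ultimately show ?thesis by simp
qed

text \<open>The trace of the system is \<open>- \<delta>\<close>.\<close>

lemma wronskian_deriv:
  assumes "horizontal_at \<gamma> \<delta> f1 g1 (Some z)" "horizontal_at \<gamma> \<delta> f2 g2 (Some z)"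
  shows "((\<lambda>z. f1 (Some z) * g2 (Some z) - f2 (Some z) * g1 (Some z)) has_field_derivative
     - \<delta> (Some z) * (f1 (Some z) * g2 (Some z) - f2 (Some z) * g1 (Some z))) (at z)"
proof -
  have 1: "((\<lambda>z. f1 (Some z)) has_field_derivative - g1 (Some z)) (at z)"
    "((\<lambda>z. g1 (Some z)) has_field_derivative - \<gamma> (Some z) * f1 (Some z) - \<delta> (Some z) * g1 (Some z)) (at z)"
    using assms(1) analytic_imp_DERIV[of "\<lambda>z. f1 (Some z)" z] analytic_imp_DERIV[of "\<lambda>z. g1 (Some z)" z]
    by (auto simp: horizontal_at_def)
  have 2: "((\<lambda>z. f2 (Some z)) has_field_derivative - g2 (Some z)) (at z)"
    "((\<lambda>z. g2 (Some z)) has_field_derivative - \<gamma> (Some z) * f2 (Some z) - \<delta> (Some z) * g2 (Some z)) (at z)"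
    using assms(2) analytic_imp_DERIV[of "\<lambda>z. f2 (Some z)" z] analytic_imp_DERIV[of "\<lambda>z. g2 (Some z)" z]
    by (auto simp: horizontal_at_def)
  show ?thesis
    by (rule derivative_eq_intros 1 2 refl)+ (simp add: algebra_simps)
qed

section \<open>Apparent singular points\<close>

text \<open>Under the condition on the coefficients there are two holomorphic solutions near \<open>q\<close> with nonzero
  Wronskian off \<open>q\<close>.  By Cramer's rule every other solution is a combination of them whose coefficients
  have zero derivative, hence are constant on connected sets, and so it extends to \<open>q\<close>.\<close>

theorem horizontal_sections_holomorphicI:
  assumes \<Gamma>: "has_germ 2 q \<gamma> \<Gamma>" and \<Delta>: "has_germ 1 q \<delta> \<Delta>"
    and ord_ge: "ord_ge (- 1) \<Gamma>" "ord_ge (- 1) (flat_coeff q + \<Delta>)" and res: "fls_nth (flat_coeff q + \<Delta>) (- 1) = - 1"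
    and app: "fls_nth \<Gamma> 0 = fls_nth \<Gamma> (- 1) ^ 2 - fls_nth (flat_coeff q + \<Delta>) 0 * fls_nth \<Gamma> (- 1)"
  shows "horizontal_sections_holomorphic D (conn D \<gamma> \<delta>) q"
proof -
  define v where "v = fls_nth \<Gamma> (- 1)"
  have cr: "fls_conv_radius \<Gamma> > 0" "fls_conv_radius \<Delta> > 0" "fls_conv_radius (flat_coeff q) > 0"
    using \<Gamma> \<Delta> by (auto simp: has_germ_def has_laurent_expansion_def flat_coeff_def intro!: less_le_trans[OF _ fls_conv_radius_mult])
  then have cr': "fls_conv_radius (flat_coeff q + \<Delta>) > 0"
    by (intro less_le_trans[OF _ fls_conv_radius_add]) simp
  have ex: "\<exists>F G. fls_conv_radius F > 0 \<and> fls_conv_radius G > 0 \<and> ord_ge 0 F \<and> ord_ge 0 G \<and> horizontal_series \<Gamma> (flat_coeff q + \<Delta>) F G \<and>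
     fls_nth F 0 = f0 \<and> fls_nth F 1 = - v * f0 \<and> fls_nth F 2 = f2" for f0 f2
  proof (rule horizontal_series_exists[OF cr(1) ord_ge(1) cr' ord_ge(2), of "- v * f0" f0 f2], unfold res v_def[symmetric])
    have "fls_nth \<Gamma> 0 = v ^ 2 - fls_nth (flat_coeff q + \<Delta>) 0 * v" by (simp only: app v_def)
    then show "2 * (1 + - 1) * f2 = fls_nth \<Gamma> 0 * f0 + v * (- v * f0) - fls_nth (flat_coeff q + \<Delta>) 0 * (- v * f0)"
      by (simp only:) (simp add: algebra_simps power2_eq_square)
  qed auto
  \<comment> \<open>the free parameters are the coefficients of degrees 0 and 2\<close>
  obtain F1 G1 where 1: "fls_conv_radius F1 > 0" "fls_conv_radius G1 > 0" "ord_ge 0 F1" "ord_ge 0 G1"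
     "horizontal_series \<Gamma> (flat_coeff q + \<Delta>) F1 G1" "fls_nth F1 0 = 1"
    using ex[of 1 0] by blast
  obtain F2 G2 where 2: "fls_conv_radius F2 > 0" "fls_conv_radius G2 > 0" "ord_ge 0 F2" "ord_ge 0 G2"
     "horizontal_series \<Gamma> (flat_coeff q + \<Delta>) F2 G2" "fls_nth F2 0 = 0" "fls_nth F2 1 = 0" "fls_nth F2 2 = 1"
    using ex[of 0 1] by auto
  have W: "F1 * G2 - F2 * G1 \<noteq> 0"
  proof -
    have G2: "G2 = - fls_deriv F2" using 2(5) by (simp add: horizontal_series_def eq_neg_iff_add_eq_0 add.commute)
    have "k < 1 \<Longrightarrow> k < 0 \<or> k = 0" "k < 2 \<Longrightarrow> k < 0 \<or> k = 0 \<or> k = 1" for k :: int by auto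
    then have vb2: "ord_ge 2 F2" "ord_ge 1 G2" using 2 by (fastforce simp: ord_ge_def G2)+
    have "fls_nth G2 1 \<noteq> 0" using 2(8) by (simp add: G2)
    then have "fls_subdegree G2 = 1" using vb2 by (intro fls_subdegree_eqI) (auto simp: ord_ge_def)
    moreover have "fls_subdegree F1 = 0" using 1 by (intro fls_subdegree_eqI) (auto simp: ord_ge_def)
    ultimately have "fls_nth (F1 * G2) 1 = fls_nth F1 0 * fls_nth G2 1"
      using fls_times_base[of F1 G2] by simp
    moreover have "fls_nth (F2 * G1) 1 = 0"
      using ord_ge_mult[OF vb2(1) 1(4)] by (simp add: ord_ge_def)
    ultimately have "fls_nth (F1 * G2 - F2 * G1) 1 \<noteq> 0"
      using \<open>fls_nth G2 1 \<noteq> 0\<close> 1(6) by simp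
    then show ?thesis by auto
  qed
  obtain f1 g1 where fg1: "has_germ 0 q f1 F1" "has_germ 1 q g1 G1" "near q (horizontal_at \<gamma> \<delta> f1 g1)"
    using horizontal_functions_exist[OF \<Gamma> \<Delta> 1(1,2,5)] by metis
  obtain f2 g2 where fg2: "has_germ 0 q f2 F2" "has_germ 1 q g2 G2" "near q (horizontal_at \<gamma> \<delta> f2 g2)"
    using horizontal_functions_exist[OF \<Gamma> \<Delta> 2(1,2,5)] by metis
  have "has_germ 1 q (\<lambda>x. f1 x * g2 x - f2 x * g1 x) (F1 * G2 - F2 * G1)"
    by (intro has_germ_diff has_germ_mult_fun fg1 fg2)
  then have nW: "near q (\<lambda>x. f1 x * g2 x - f2 x * g1 x \<noteq> 0)"
    unfolding has_germ_def near_def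
    by (rule eventually_mono[OF has_laurent_expansion_nonzero_imp_eventually_nonzero[OF _ W]]) auto
  have "near q (\<lambda>x. horizontal_at \<gamma> \<delta> f1 g1 x \<and> horizontal_at \<gamma> \<delta> f2 g2 x \<and> f1 x * g2 x - f2 x * g1 x \<noteq> 0 \<and>
     x \<notin> set_mset D \<and> (\<forall>z. x = Some z \<longrightarrow> (\<lambda>z. \<gamma> (Some z)) analytic_on {z}) \<and>
     (\<forall>z. x = Some z \<longrightarrow> (\<lambda>z. \<delta> (Some z)) analytic_on {z}))"
    by (intro near_conj fg1 fg2 nW near_not_in_finite has_germ_near_analytic[OF \<Gamma>] has_germ_near_analytic[OF \<Delta>]) simp
  then obtain r where r: "r > 0" and rr: "\<And>x. x \<in> from_local q ` (ball 0 r - {0}) \<Longrightarrow>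
     horizontal_at \<gamma> \<delta> f1 g1 x \<and> horizontal_at \<gamma> \<delta> f2 g2 x \<and> f1 x * g2 x - f2 x * g1 x \<noteq> 0 \<and>
     x \<notin> set_mset D \<and> (\<forall>z. x = Some z \<longrightarrow> (\<lambda>z. \<gamma> (Some z)) analytic_on {z}) \<and>
     (\<forall>z. x = Some z \<longrightarrow> (\<lambda>z. \<delta> (Some z)) analytic_on {z})"
    unfolding near_iff_ball by blast
  define V where "V = from_local q ` ball 0 r"
  have V: "openin P1_top V" "q \<in> V" using r by (auto simp: V_def open_from_local_ball center_in_ball)
  note rr = rr[unfolded from_local_image_Diff, folded V_def]
  show ?thesis
    unfolding horizontal_sections_holomorphic_def
  proof (intro exI[of _ V] conjI V allI impI)
    fix U s
    assume "openin P1_top U \<and> connectedin P1_top U \<and> U \<subseteq> V - {q} \<and> s \<in> E0 D U \<and> conn D \<gamma> \<delta> U s = zero_section"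
    then have U: "openin P1_top U" "connectedin P1_top U" "U \<subseteq> V - {q}" and s: "s \<in> E0 D U"
      and zero: "conn D \<gamma> \<delta> U s = zero_section" by auto
    define f where "f = fst s"
    define g where "g = snd s"
    have Us: "\<exists>z. x = Some z" if "x \<in> U" for x
      using rr[of x] U(3) that by (auto simp: horizontal_at_def)
    then have "None \<notin> U" by blast
    define Z where "Z = Some -` U"
    have Z: "open Z" "connected Z"
      using open_Some_vimage[OF U(1)] connected_Some_vimage[OF U(2) \<open>None \<notin> U\<close>] by (auto simp: Z_def)
    have h: "horizontal_at \<gamma> \<delta> f g (Some z)" "horizontal_at \<gamma> \<delta> f1 g1 (Some z)" "horizontal_at \<gamma> \<delta> f2 g2 (Some z)"
      "f1 (Some z) * g2 (Some z) - f2 (Some z) * g1 (Some z) \<noteq> 0" if z: "z \<in> Z" for z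
    proof -
      have zU: "Some z \<in> U" using z by (simp add: Z_def)
      then have R: "Some z \<in> V - {q}" using U(3) by blast
      note rz = rr[OF R]
      have nD: "Some z \<notin># D" using rz by blast
      have a: "(\<lambda>z. \<gamma> (Some z)) analytic_on {z}" "(\<lambda>z. \<delta> (Some z)) analytic_on {z}" using rz by blast+
      show "horizontal_at \<gamma> \<delta> f g (Some z)"
        unfolding f_def g_def by (rule horizontal_sectionD[OF U(1) s zero zU nD a])
      show "horizontal_at \<gamma> \<delta> f1 g1 (Some z)" "horizontal_at \<gamma> \<delta> f2 g2 (Some z)"
        "f1 (Some z) * g2 (Some z) - f2 (Some z) * g1 (Some z) \<noteq> 0" using rz by blast+
    qed
    define W where "W = (\<lambda>z. f1 (Some z) * g2 (Some z) - f2 (Some z) * g1 (Some z))"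
    \<comment> \<open>the numerators in Cramer's rule satisfy the same equation as the Wronskian\<close>
    define N1 where "N1 = (\<lambda>z. f (Some z) * g2 (Some z) - f2 (Some z) * g (Some z))"
    define N2 where "N2 = (\<lambda>z. f1 (Some z) * g (Some z) - f (Some z) * g1 (Some z))"
    have const: "\<exists>c. \<forall>z\<in>Z. N z / W z = c"
      if N: "\<And>z. z \<in> Z \<Longrightarrow> (N has_field_derivative - \<delta> (Some z) * N z) (at z)" for N
    proof -
      have d: "((\<lambda>z. N z / W z) has_field_derivative 0) (at z)" if z: "z \<in> Z" for z
      proof -
        have W: "(W has_field_derivative - \<delta> (Some z) * W z) (at z)"
          using wronskian_deriv[OF h(2,3)[OF z]] by (simp add: W_def)
        have "W z \<noteq> 0" using h(4)[OF z] by (simp add: W_def)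
        from DERIV_divide[OF N[OF z] W this] show ?thesis by (simp add: algebra_simps)
      qed
      have "continuous_on Z (\<lambda>z. N z / W z)"
        using d by (intro DERIV_continuous_on) (auto intro: has_field_derivative_at_within)
      then obtain c where "\<And>z. z \<in> Z \<Longrightarrow> N z / W z = c"
        using DERIV_zero_connected_constant[OF Z(2,1), of "{}" "\<lambda>z. N z / W z"] d by auto
      then show ?thesis by blast
    qed
    obtain c1 where c1: "\<And>z. z \<in> Z \<Longrightarrow> N1 z / W z = c1"
      using const[of N1] wronskian_deriv[OF h(1,3)] unfolding N1_def by blast
    obtain c2 where c2: "\<And>z. z \<in> Z \<Longrightarrow> N2 z / W z = c2"
      using const[of N2] wronskian_deriv[OF h(2,1)] unfolding N2_def by blast
    define f0 where "f0 = (\<lambda>x. c1 * f1 x + c2 * f2 x)"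
    define g0 where "g0 = (\<lambda>x. c1 * g1 x + c2 * g2 x)"
    have an: "(\<lambda>z. f0 (Some z)) analytic_on {z}" "(\<lambda>z. g0 (Some z)) analytic_on {z}" if "Some z \<in> V - {q}" for z
      using rr[OF that] unfolding f0_def g0_def by (auto simp: horizontal_at_def intro!: analytic_intros)
    define t where "t = (mero_of V f0, mero_of V g0)"
    have t: "t \<in> E0 D V"
      unfolding t_def
    proof (rule mero_of_pair_in_E0[OF V])
      show "has_germ 0 q f0 (fls_const c1 * F1 + fls_const c2 * F2)"
        unfolding f0_def by (intro has_germ_add has_germ_cmult fg1 fg2)
      show "has_germ 1 q g0 (fls_const c1 * G1 + fls_const c2 * G2)"
        unfolding g0_def by (intro has_germ_add has_germ_cmult fg1 fg2)
      show "ord_ge 0 (fls_const c1 * F1 + fls_const c2 * F2)" "ord_ge 0 (fls_const c1 * G1 + fls_const c2 * G2)"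
        by (intro ord_ge_add ord_ge_mult'[of 0 _ 0] ord_ge_const 1 2; simp)+
      show "\<exists>z. x = Some z \<and> (\<lambda>z. f0 (Some z)) analytic_on {z} \<and> (\<lambda>z. g0 (Some z)) analytic_on {z}"
        if "x \<in> V" "x \<noteq> q" for x
        using rr[of x] an that by (auto simp: horizontal_at_def)
    qed
    have "restrict_section U t = s"
    proof (intro prod_eqI ext)
      fix x
      show "fst (restrict_section U t) x = fst s x"
      proof (cases "x \<in> U")
        case False
        then show ?thesis using E0_mero[OF s] by (auto simp: restrict_section_def mero_def)
      next
        case True
        then obtain z where z: "x = Some z" "z \<in> Z" using Us by (auto simp: Z_def)
        have zV: "Some z \<in> V - {q}" using True z(1) U(3) by blast
        have nz: "W z \<noteq> 0" using h(4)[OF z(2)] by (simp add: W_def)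
        have "f0 x * W z = (c1 * W z) * f1 x + (c2 * W z) * f2 x"
          by (simp add: f0_def algebra_simps)
        also have "c1 * W z = N1 z" using c1[OF z(2)] nz by auto
        also have "c2 * W z = N2 z" using c2[OF z(2)] nz by auto
        also have "N1 z * f1 x + N2 z * f2 x = f x * W z"
          by (simp add: N1_def N2_def W_def z(1) algebra_simps)
        finally have "f0 x * W z = f x * W z" .
        then have "f0 x = f x" using nz by simp
        moreover have "mero_of V f0 x = f0 x"
          using mero_of_analytic[OF _ an(1)[OF zV], of V] zV z(1) by simp
        ultimately show ?thesis using True by (simp add: restrict_section_def t_def f_def)
      qed
      show "snd (restrict_section U t) x = snd s x"
      proof (cases "x \<in> U")
        case False
        then show ?thesis using E0_mero[OF s] by (auto simp: restrict_section_def mero_def)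
      next
        case True
        then obtain z where z: "x = Some z" "z \<in> Z" using Us by (auto simp: Z_def)
        have zV: "Some z \<in> V - {q}" using True z(1) U(3) by blast
        have nz: "W z \<noteq> 0" using h(4)[OF z(2)] by (simp add: W_def)
        have "g0 x * W z = (c1 * W z) * g1 x + (c2 * W z) * g2 x"
          by (simp add: g0_def algebra_simps)
        also have "c1 * W z = N1 z" using c1[OF z(2)] nz by auto
        also have "c2 * W z = N2 z" using c2[OF z(2)] nz by auto
        also have "N1 z * g1 x + N2 z * g2 x = g x * W z"
          by (simp add: N1_def N2_def W_def z(1) algebra_simps)
        finally have "g0 x * W z = g x * W z" .
        then have "g0 x = g x" using nz by simp
        moreover have "mero_of V g0 x = g0 x"
          using mero_of_analytic[OF _ an(2)[OF zV], of V] zV z(1) by simp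
        ultimately show ?thesis using True by (simp add: restrict_section_def t_def g_def)
      qed
    qed
    then show "\<exists>t\<in>E0 D V. restrict_section U t = s" using t by blast
  qed
qed

lemma mero_of_germ_value:
  assumes "x \<in> U" "has_germ 0 x f F" "ord_ge 0 F"
  shows "mero_of U f x = fls_nth F 0"
proof -
  have e: "(\<lambda>w. f (from_local x w)) has_laurent_expansion F"
    using assms(2) by (simp add: has_germ_def)
  have "0 \<le> fls_subdegree F" using assms(3) by (simp add: ord_ge_iff_subdegree)
  from has_laurent_expansion_imp_tendsto_0[OF e this] show ?thesis
    using assms(1) by (auto simp: mero_of_def intro: remove_sings_eqI)
qed

lemma connected_Some_vimage_punctured:
  assumes "None \<notin> from_local q ` (ball 0 r - {0})"
  shows "connected (Some -` from_local q ` (ball 0 r - {0}))"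
proof (rule connected_Some_vimage[OF _ assms])
  have "connected (ball (0::complex) r - {0})"
    using connected_punctured_ball[of "0::complex" r] by simp
  then show "connectedin P1_top (from_local q ` (ball 0 r - {0}))"
    using connectedin_continuous_map_image[OF continuous_from_local] by fastforce
qed

text \<open>Identity theorem for the defect of the equations.\<close>

lemma horizontal_extension:
  assumes Z: "open Z" "connected Z" and Z': "open Z'" "Z' \<subseteq> Z" "Z' \<noteq> {}"
    and a: "\<And>z. z \<in> Z \<Longrightarrow> (\<lambda>z. f (Some z)) analytic_on {z} \<and> (\<lambda>z. g (Some z)) analytic_on {z} \<and>
      (\<lambda>z. \<gamma> (Some z)) analytic_on {z} \<and> (\<lambda>z. \<delta> (Some z)) analytic_on {z}"
    and h: "\<And>z. z \<in> Z' \<Longrightarrow> horizontal_at \<gamma> \<delta> f g (Some z)" and z: "z \<in> Z"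
  shows "horizontal_at \<gamma> \<delta> f g (Some z)"
proof -
  define e1 where "e1 = (\<lambda>z. deriv (\<lambda>z. f (Some z)) z + g (Some z))"
  define e2 where "e2 = (\<lambda>z. deriv (\<lambda>z. g (Some z)) z + \<gamma> (Some z) * f (Some z) + \<delta> (Some z) * g (Some z))"
  have "e1 analytic_on {z}" "e2 analytic_on {z}" if "z \<in> Z" for z
    unfolding e1_def e2_def using a[OF that] by (auto intro!: analytic_intros analytic_deriv)
  then have hol: "e1 holomorphic_on Z" "e2 holomorphic_on Z"
    using analytic_on_analytic_at analytic_imp_holomorphic by metis+
  have "e1 z = 0" "e2 z = 0"
    using analytic_continuation_open[OF Z'(1) Z(1) Z'(3) Z(2) Z'(2) hol(1), of "\<lambda>_. 0" z]
      analytic_continuation_open[OF Z'(1) Z(1) Z'(3) Z(2) Z'(2) hol(2), of "\<lambda>_. 0" z] h z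
    by (auto simp: e1_def e2_def horizontal_at_def)
  then show ?thesis
    using a[OF z] by (auto simp: horizontal_at_def e1_def e2_def eq_neg_iff_add_eq_0 algebra_simps)
qed

text \<open>Take two independent solutions on a small disc beside \<open>q\<close> and extend them to \<open>q\<close>.  By analytic
  continuation the extensions are solutions around \<open>q\<close>.  If the condition failed, both would
  vanish at \<open>q\<close> by the indicial computation, and then their Wronskian would be zero near \<open>q\<close>, hence
  also on the disc.\<close>

theorem horizontal_sections_holomorphicD:
  assumes \<Gamma>: "\<And>p. has_germ 2 p \<gamma> (\<Gamma> p)" and \<Delta>: "\<And>p. has_germ 1 p \<delta> (\<Delta> p)"
    and ord_ge: "ord_ge (- 1) (\<Gamma> q)" "ord_ge (- 1) (flat_coeff q + \<Delta> q)" and res: "fls_nth (flat_coeff q + \<Delta> q) (- 1) = - 1"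
    and q: "q \<notin># D" and hol: "horizontal_sections_holomorphic D (conn D \<gamma> \<delta>) q"
  shows "fls_nth (\<Gamma> q) 0 = fls_nth (\<Gamma> q) (- 1) ^ 2 - fls_nth (flat_coeff q + \<Delta> q) 0 * fls_nth (\<Gamma> q) (- 1)"
proof (rule ccontr)
  assume napp: "\<not> ?thesis"
  obtain V where V: "openin P1_top V" "q \<in> V" and ext: "\<And>U s. openin P1_top U \<Longrightarrow> connectedin P1_top U \<Longrightarrow>
      U \<subseteq> V - {q} \<Longrightarrow> s \<in> E0 D U \<Longrightarrow> conn D \<gamma> \<delta> U s = zero_section \<Longrightarrow> \<exists>t\<in>E0 D V. restrict_section U t = s"
    using hol unfolding horizontal_sections_holomorphic_def by metis
  have "near q (\<lambda>x. x \<in> V \<and> x \<notin> insert None (set_mset D) \<and> (\<forall>z. x = Some z \<longrightarrow> (\<lambda>z. \<gamma> (Some z)) analytic_on {z}) \<and>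
     (\<forall>z. x = Some z \<longrightarrow> (\<lambda>z. \<delta> (Some z)) analytic_on {z}))"
    by (intro near_conj near_in V near_not_in_finite has_germ_near_analytic[OF \<Gamma>] has_germ_near_analytic[OF \<Delta>]) simp
  then obtain r where r: "r > 0" and rr: "\<And>x. x \<in> from_local q ` (ball 0 r - {0}) \<Longrightarrow>
     x \<in> V \<and> x \<notin> insert None (set_mset D) \<and> (\<forall>z. x = Some z \<longrightarrow> (\<lambda>z. \<gamma> (Some z)) analytic_on {z}) \<and>
     (\<forall>z. x = Some z \<longrightarrow> (\<lambda>z. \<delta> (Some z)) analytic_on {z})"
    unfolding near_iff_ball by blast
  define N where "N = from_local q ` (ball 0 r - {0})"
  note rr = rr[folded N_def]
  have N: "openin P1_top N" "q \<notin> N" "None \<notin> N"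
  proof -
    show "openin P1_top N" unfolding N_def by (rule open_from_local_image) auto
    show "q \<notin> N" unfolding N_def from_local_image_Diff by simp
    show "None \<notin> N" using rr by blast
  qed
  define Z where "Z = Some -` N"
  have Z: "open Z" "connected Z"
    using open_Some_vimage[OF N(1)] connected_Some_vimage_punctured[of q r] N(3) by (auto simp: Z_def N_def)
  have an: "(\<lambda>z. \<gamma> (Some z)) analytic_on {z}" "(\<lambda>z. \<delta> (Some z)) analytic_on {z}" "Some z \<in> V" "Some z \<notin># D"
    if "z \<in> Z" for z
    using rr[of "Some z"] that by (auto simp: Z_def)

  have "from_local q (of_real (r / 2)) \<in> N" using r by (auto simp: N_def)
  then obtain z0 where z0: "Some z0 \<in> N" using N(3) by (cases "from_local q (of_real (r / 2))") auto
  define x0 where "x0 = Some z0"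
  have z0Z: "z0 \<in> Z" using z0 by (simp add: Z_def)
  have kap0: "flat_coeff x0 = 0" by (simp add: flat_coeff_def x0_def)
  have vb0: "ord_ge 0 (\<Gamma> x0)" "ord_ge 0 (\<Delta> x0)"
    using has_germ_Some_analytic[OF an(1)[OF z0Z], of 2] has_germ_Some_analytic[OF an(2)[OF z0Z], of 1]
      has_germ_unique \<Gamma> \<Delta> unfolding x0_def by metis+
  have cr: "fls_conv_radius (\<Gamma> x0) > 0" "fls_conv_radius (\<Delta> x0) > 0"
    using \<Gamma> \<Delta> by (auto simp: has_germ_def has_laurent_expansion_def)
  \<comment> \<open>a solution with given initial values at \<open>x0\<close>, extended to \<open>V\<close>\<close>
  have local: "\<exists>t\<in>E0 D V. fst t x0 = f0 \<and> snd t x0 = - f1 \<and>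
      (\<forall>z\<in>Z. horizontal_at \<gamma> \<delta> (fst t) (snd t) (Some z))" for f0 f1
  proof -
    obtain F G where FG: "fls_conv_radius F > 0" "fls_conv_radius G > 0" "ord_ge 0 F" "ord_ge 0 G" "horizontal_series (\<Gamma> x0) (\<Delta> x0) F G"
      "fls_nth F 0 = f0" "fls_nth F 1 = f1"
    proof (rule horizontal_series_exists[of "\<Gamma> x0" "\<Delta> x0" f1 f0 "(fls_nth (\<Gamma> x0) 0 * f0 - fls_nth (\<Delta> x0) 0 * f1) / 2"])
      show "ord_ge (- 1) (\<Gamma> x0)" "ord_ge (- 1) (\<Delta> x0)" using vb0 by (auto intro: ord_ge_mono)
    qed (use vb0 cr in \<open>auto simp: ord_ge_def\<close>)
    have "fls_nth (fls_deriv F + G) 0 = 0" using FG(5) by (simp add: horizontal_series_def)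
    then have G0: "fls_nth G 0 = - f1" using FG(7) by (simp add: eq_neg_iff_add_eq_0 add.commute)
    have hz: "horizontal_series (\<Gamma> x0) (flat_coeff x0 + \<Delta> x0) F G" using FG(5) kap0 by simp
    obtain f g where f: "has_germ 0 x0 f F" and g: "has_germ 1 x0 g G" and hor: "near x0 (horizontal_at \<gamma> \<delta> f g)"
      using horizontal_functions_exist[OF \<Gamma>[of x0] \<Delta>[of x0] FG(1,2) hz] by metis
    have "near x0 (\<lambda>x. horizontal_at \<gamma> \<delta> f g x \<and> x \<in> N)"
      using hor N(1) z0 by (intro near_conj near_in) (auto simp: x0_def)
    then obtain r' where r': "r' > 0" and rr': "\<And>x. x \<in> from_local x0 ` (ball 0 r' - {0}) \<Longrightarrow> horizontal_at \<gamma> \<delta> f g x \<and> x \<in> N"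
      unfolding near_iff_ball by blast
    define U where "U = from_local x0 ` ball 0 r'"
    have U: "openin P1_top U" "x0 \<in> U" using r' by (auto simp: U_def open_from_local_ball center_in_ball)
    note rr' = rr'[unfolded from_local_image_Diff, folded U_def]
    have UN: "U \<subseteq> N" using rr' z0 by (auto simp: x0_def)
    have UV: "U \<subseteq> V - {q}" using UN rr N(2) by blast
    have conU: "connectedin P1_top U"
      unfolding U_def using connectedin_continuous_map_image[OF continuous_from_local, of "ball 0 r'"] by simp
    define s where "s = (mero_of U f, mero_of U g)"
    have s: "s \<in> E0 D U"
      unfolding s_def
      by (rule mero_of_pair_in_E0[OF U f FG(3) g FG(4)]) (use rr' in \<open>auto simp: horizontal_at_def\<close>)
    have s_hor: "conn D \<gamma> \<delta> U s = zero_section"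
    proof (rule horizontal_sectionI[OF U(1) s])
      fix x assume x: "x \<in> U" "x \<noteq> x0"
      have U': "openin P1_top (U - {x0})"
        using openin_Int[OF U(1) openin_Compl_finite[of "{x0}"]] by (simp add: Diff_eq)
      have "fst s y = f y \<and> snd s y = g y" if y: "y \<in> U - {x0}" for y
      proof -
        obtain z where z: "y = Some z" "(\<lambda>z. f (Some z)) analytic_on {z}" "(\<lambda>z. g (Some z)) analytic_on {z}"
          using rr'[OF y] by (auto simp: horizontal_at_def)
        show ?thesis
          using mero_of_analytic[of z U f] mero_of_analytic[of z U g] y z by (auto simp: s_def)
      qed
      then show "horizontal_at \<gamma> \<delta> (fst s) (snd s) x"
        using horizontal_at_cong[OF U', of x "fst s" f "snd s" g] rr'[of x] x by blast
    qed
    obtain t where t: "t \<in> E0 D V" and ts: "restrict_section U t = s"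
      using ext[OF U(1) conU UV s s_hor] by blast
    have tU: "fst t x = fst s x" "snd t x = snd s x" if "x \<in> U" for x
      using that by (auto simp: restrict_section_def simp flip: ts)
    have "fst s x0 = f0" "snd s x0 = - f1"
    proof -
      have "has_germ 0 x0 g G" using g has_germ_twist[of 1 x0 g G] by (simp add: x0_def jac_fls_def)
      then show "fst s x0 = f0" "snd s x0 = - f1"
        using mero_of_germ_value[OF U(2) f FG(3)] mero_of_germ_value[OF U(2) _ FG(4), of g] FG(6) G0 by (auto simp: s_def)
    qed
    moreover have "horizontal_at \<gamma> \<delta> (fst t) (snd t) (Some z)" if "z \<in> Z" for z
    proof (rule horizontal_extension[OF Z _ _ _ _ _ that])
      show "open (Some -` U)" using open_Some_vimage[OF U(1)] .
      show "Some -` U \<subseteq> Z" using UN by (auto simp: Z_def)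
      show "Some -` U \<noteq> {}" using U(2) by (auto simp: x0_def)
      show "(\<lambda>z. fst t (Some z)) analytic_on {z} \<and> (\<lambda>z. snd t (Some z)) analytic_on {z} \<and>
        (\<lambda>z. \<gamma> (Some z)) analytic_on {z} \<and> (\<lambda>z. \<delta> (Some z)) analytic_on {z}" if "z \<in> Z" for z
        using an[OF that] E0_analytic[OF t, of z] by auto
      fix z assume z: "z \<in> Some -` U"
      then have zU: "Some z \<in> U" and zZ: "z \<in> Z" using UN by (auto simp: Z_def)
      have "horizontal_at \<gamma> \<delta> (fst s) (snd s) (Some z)"
        by (rule horizontal_sectionD[OF U(1) s s_hor zU an(4)[OF zZ] an(1,2)[OF zZ]])
      then show "horizontal_at \<gamma> \<delta> (fst t) (snd t) (Some z)"
        using horizontal_at_cong[OF U(1) zU, of "fst t" "fst s" "snd t" "snd s"] tU by blast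
    qed
    ultimately show ?thesis
      using t tU[OF U(2)] by (intro bexI[of _ t]) auto
  qed

  have atq: "\<exists>F G. has_germ 0 q (fst t) F \<and> has_germ 1 q (snd t) G \<and> ord_ge 0 F \<and> ord_ge 0 G \<and>
      horizontal_series (\<Gamma> q) (flat_coeff q + \<Delta> q) F G \<and> fls_nth F 0 = 0"
    if t: "t \<in> E0 D V" and h: "\<forall>z\<in>Z. horizontal_at \<gamma> \<delta> (fst t) (snd t) (Some z)" for t
  proof -
    from E0E[OF t V(2)] obtain F G where FG: "has_germ 0 q (fst t) F" "has_germ 1 q (snd t) G"
      "ord_ge 0 F" "ord_ge (- int (count D q)) G" .
    have vG: "ord_ge 0 G" using FG(4) q by (simp add: count_eq_zero_iff[THEN iffD2])
    have nN: "near q (\<lambda>x. x \<in> N)" unfolding near_iff_ball N_def using r by blast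
    have "near q (\<lambda>x. nabla_fst (fst t) (snd t) x = 0 \<and> nabla_snd \<gamma> \<delta> (fst t) (snd t) x = 0)"
    proof (rule near_mono[OF nN])
      fix x assume "x \<in> N"
      then obtain z where z: "x = Some z" "z \<in> Z" using N(3) by (cases x) (auto simp: Z_def)
      show "nabla_fst (fst t) (snd t) x = 0 \<and> nabla_snd \<gamma> \<delta> (fst t) (snd t) x = 0"
        using h[rule_format, OF z(2)] by (auto simp: horizontal_at_def ddz_def z(1))
    qed
    then have "near q (\<lambda>x. nabla_fst (fst t) (snd t) x = 0)" "near q (\<lambda>x. nabla_snd \<gamma> \<delta> (fst t) (snd t) x = 0)"
      by (auto elim: near_mono)
    then have z: "has_germ 1 q (\<lambda>x. nabla_fst (fst t) (snd t) x) 0" "has_germ 2 q (\<lambda>x. nabla_snd \<gamma> \<delta> (fst t) (snd t) x) 0"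
      by (simp_all only: has_germ_cong[of q _ "\<lambda>_. 0"] has_germ_zero)
    have "fls_deriv F + G = 0" "\<Gamma> q * F + (fls_deriv G + flat_coeff q * G + \<Delta> q * G) = 0"
      by (rule has_germ_unique[OF conn_germs(1)[OF \<Gamma> \<Delta> FG(1,2)] z(1)]
          has_germ_unique[OF conn_germs(2)[OF \<Gamma> \<Delta> FG(1,2)] z(2)])+
    then have hz: "horizontal_series (\<Gamma> q) (flat_coeff q + \<Delta> q) F G" by (simp add: horizontal_series_def algebra_simps)
    have "fls_nth (\<Gamma> q) 0 + fls_nth (flat_coeff q + \<Delta> q) 0 * fls_nth (\<Gamma> q) (- 1) - fls_nth (\<Gamma> q) (- 1) ^ 2 \<noteq> 0"
      using napp by (simp only: diff_eq_eq eq_diff_eq right_minus_eq add_0_left not_False_eq_True)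
    then have "fls_nth F 0 = 0"
      using horizontal_series_indicial(3)[OF ord_ge res FG(3) vG hz] by (simp only: mult_eq_0_iff simp_thms)
    then show ?thesis using FG vG hz by blast
  qed
  obtain t1 where t1: "t1 \<in> E0 D V" "fst t1 x0 = 1" "snd t1 x0 = 0" "\<forall>z\<in>Z. horizontal_at \<gamma> \<delta> (fst t1) (snd t1) (Some z)"
    using local[of 1 0] by auto
  obtain t2 where t2: "t2 \<in> E0 D V" "fst t2 x0 = 0" "snd t2 x0 = 1" "\<forall>z\<in>Z. horizontal_at \<gamma> \<delta> (fst t2) (snd t2) (Some z)"
    using local[of 0 "- 1"] by auto
  from atq[OF t1(1,4)] obtain F1 G1 where 1: "has_germ 0 q (fst t1) F1" "has_germ 1 q (snd t1) G1" "ord_ge 0 F1" "ord_ge 0 G1"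
      "horizontal_series (\<Gamma> q) (flat_coeff q + \<Delta> q) F1 G1" "fls_nth F1 0 = 0" by blast
  from atq[OF t2(1,4)] obtain F2 G2 where 2: "has_germ 0 q (fst t2) F2" "has_germ 1 q (snd t2) G2" "ord_ge 0 F2" "ord_ge 0 G2"
      "horizontal_series (\<Gamma> q) (flat_coeff q + \<Delta> q) F2 G2" "fls_nth F2 0 = 0" by blast
  define w where "w = (\<lambda>x. fst t1 x * snd t2 x - fst t2 x * snd t1 x)"
  have "has_germ 1 q w (F1 * G2 - F2 * G1)"
    unfolding w_def by (intro has_germ_diff has_germ_mult_fun 1 2)
  then have "has_germ 1 q w 0"
    using wronskian_zero[OF ord_ge res 1(3-5) 2(3-5) 1(6) 2(6)] by simp
  then have "near q (\<lambda>x. w x = 0)" using near_eqI_germ[OF _ has_germ_zero] by blast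
  then obtain r' where r': "r' > 0" "\<And>x. x \<in> from_local q ` (ball 0 r' - {0}) \<Longrightarrow> w x = 0"
    unfolding near_iff_ball by blast
  define Z' where "Z' = Some -` from_local q ` (ball 0 (min r r') - {0})"
  have sub: "from_local q ` (ball 0 (min r r') - {0}) \<subseteq> N" by (auto simp: N_def)
  have Z': "open Z'" unfolding Z'_def by (intro open_Some_vimage open_from_local_image) auto
  have "Z' \<subseteq> Z" using sub by (auto simp: Z'_def Z_def)
  have "from_local q (of_real (min r r' / 2)) \<in> from_local q ` (ball 0 (min r r') - {0})"
    using r r'(1) by (intro imageI) (auto simp: min_def)
  then have "Z' \<noteq> {}"
    using sub N(3) unfolding Z'_def by (cases "from_local q (of_real (min r r' / 2))") auto
  have "(\<lambda>z. w (Some z)) analytic_on {z}" if "z \<in> Z" for z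
    unfolding w_def using t1(4) t2(4) that by (auto simp: horizontal_at_def intro!: analytic_intros)
  then have hw: "(\<lambda>z. w (Some z)) holomorphic_on Z"
    using analytic_on_analytic_at analytic_imp_holomorphic by metis
  have "w (Some z0) = 0"
  proof (rule analytic_continuation_open[OF Z' Z(1) \<open>Z' \<noteq> {}\<close> Z(2) \<open>Z' \<subseteq> Z\<close> hw, of "\<lambda>_. 0" z0])
    show "w (Some z) = 0" if "z \<in> Z'" for z
      using that by (intro r'(2)) (auto simp: Z'_def)
  qed (use z0Z in auto)
  then show False using t1 t2 by (simp add: w_def flip: x0_def)
qed

section \<open>Local conditions as interpolation data\<close>

lemma conn_eqI:
  assumes "\<And>p. has_germ 2 p \<gamma> (\<Gamma> p)" "\<And>p. has_germ 1 p \<delta> (\<Delta> p)"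
    and "\<And>p. has_germ 2 p \<gamma>' (\<Gamma> p)" "\<And>p. has_germ 1 p \<delta>' (\<Delta> p)"
  shows "conn D \<gamma> \<delta> = conn D \<gamma>' \<delta>'"
proof (intro ext)
  fix U s
  show "conn D \<gamma> \<delta> U s = conn D \<gamma>' \<delta>' U s"
  proof (cases "openin P1_top U \<and> s \<in> E0 D U")
    case True
    then have U: "openin P1_top U" and s: "s \<in> E0 D U" by auto
    have "mero_of U (\<lambda>x. nabla_snd \<gamma> \<delta> (fst s) (snd s) x) =
          mero_of U (nabla_snd \<gamma>' \<delta>' (fst s) (snd s))"
    proof (rule mero_of_cong)
      fix p assume "p \<in> U"
      from E0E[OF s this] obtain F G where g: "has_germ 0 p (fst s) F" "has_germ 1 p (snd s) G" .
      show "near p (\<lambda>x. nabla_snd \<gamma> \<delta> (fst s) (snd s) x =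
          nabla_snd \<gamma>' \<delta>' (fst s) (snd s) x)"
        by (rule near_eqI_germ[OF conn_germs(2)[OF assms(1,2) g] conn_germs(2)[OF assms(3,4) g]])
    qed
    then show ?thesis by (simp add: conn_in[OF U s])
  qed (auto simp: conn_def)
qed

lemma nth_fls_below: "fls_nth (fls_below m F) k = (if k < m then fls_nth F k else 0)"
proof -
  obtain N where N: "\<forall>k<N. fls_nth F k = 0"
    by (elim fls_nth_vanishes_belowE)
  show ?thesis unfolding fls_below_def
    by (subst nth_Abs_fls_lower_bound[of N]) (use N in auto)
qed

lemma fls_below_eq_iff:
  assumes "fls_below m a = a"
  shows "fls_below m F = a \<longleftrightarrow> ord_ge m (F - a)"
proof
  assume "fls_below m F = a"
  then show "ord_ge m (F - a)" using nth_fls_below[of m F] by (auto simp: ord_ge_def)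
next
  assume v: "ord_ge m (F - a)"
  show "fls_below m F = a"
  proof (rule fls_eqI)
    fix k
    show "fls_nth (fls_below m F) k = fls_nth a k"
      using v nth_fls_below[of m a k] unfolding assms nth_fls_below ord_ge_def by auto
  qed
qed

lemma eigenspace_lower_triangular:
  fixes R :: "complex ^ 2 ^ 2"
  assumes "R $ 1 $ 1 = 0" "R $ 1 $ 2 = 0"
  shows "x \<in> eigenspace R \<mu> \<longleftrightarrow> \<mu> * x $ 1 = 0 \<and> R $ 2 $ 1 * x $ 1 + R $ 2 $ 2 * x $ 2 = \<mu> * x $ 2"
  using assms by (auto simp: eigenspace_def vec_eq_iff forall_2 matrix_vector_mult_def sum_2)

lemma eigenspaces_iff:
  fixes R :: "complex ^ 2 ^ 2"
  assumes "R $ 1 $ 1 = 0" "R $ 1 $ 2 = 0"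
  shows "eigenspace R (- 1) = line_Omega \<and> eigenspace R 0 = line_of_point (q, v) \<longleftrightarrow>
     R $ 2 $ 1 = v \<and> R $ 2 $ 2 = - 1"
proof
  assume *: "eigenspace R (- 1) = line_Omega \<and> eigenspace R 0 = line_of_point (q, v)"
  have "vector [0, 1] \<in> eigenspace R (- 1)" "vector [1, v] \<in> eigenspace R 0"
    using * vec.span_base by (auto simp: line_Omega_def line_of_point_def)
  then show "R $ 2 $ 1 = v \<and> R $ 2 $ 2 = - 1"
    by (auto simp: eigenspace_lower_triangular[OF assms] vector_2 add_eq_0_iff)
next
  assume R: "R $ 2 $ 1 = v \<and> R $ 2 $ 2 = - 1"
  have "x \<in> eigenspace R (- 1) \<longleftrightarrow> x \<in> line_Omega" for x
    using R unfolding eigenspace_lower_triangular[OF assms] line_Omega_def vec.span_singleton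
    by (auto simp: image_iff vec_eq_iff forall_2 vector_2)
  moreover have "x \<in> eigenspace R 0 \<longleftrightarrow> x \<in> line_of_point (q, v)" for x
    using R unfolding eigenspace_lower_triangular[OF assms] line_of_point_def vec.span_singleton
    by (auto simp: image_iff vec_eq_iff forall_2 vector_2 mult.commute)
  ultimately show "eigenspace R (- 1) = line_Omega \<and> eigenspace R 0 = line_of_point (q, v)" by blast
qed

lemma eigenvalues:
  fixes R :: "complex ^ 2 ^ 2"
  assumes "R $ 1 $ 1 = 0" "R $ 1 $ 2 = 0" "R $ 2 $ 2 = - 1"
  shows "{\<mu>. eigenspace R \<mu> \<noteq> {0}} = {- 1, 0}"
proof -
  have z: "0 \<in> eigenspace R \<mu>" for \<mu>
    by (simp add: eigenspace_lower_triangular[OF assms(1,2)])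
  have "vector [0, 1] \<in> eigenspace R (- 1)" "vector [1, R $ 2 $ 1] \<in> eigenspace R 0"
    by (auto simp: eigenspace_lower_triangular[OF assms(1,2)] vector_2 assms(3))
  moreover have "(vector [0, 1] :: complex ^ 2) \<noteq> 0" "(vector [1, R $ 2 $ 1] :: complex ^ 2) \<noteq> 0"
    by (auto simp: vec_eq_iff forall_2 vector_2)
  moreover have "x = 0" if "x \<in> eigenspace R \<mu>" "\<mu> \<noteq> - 1" "\<mu> \<noteq> 0" for x \<mu>
  proof -
    have x1: "x $ 1 = 0" and "- (x $ 2) = \<mu> * x $ 2"
      using that by (auto simp: eigenspace_lower_triangular[OF assms(1,2)] assms(3))
    then have "(\<mu> + 1) * x $ 2 = 0" by (simp add: algebra_simps) (metis add.right_inverse)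
    then have "x $ 2 = 0" using that(2) by (simp add: eq_neg_iff_add_eq_0)
    then show ?thesis using x1 by (simp add: vec_eq_iff forall_2)
  qed
  ultimately show ?thesis using z by blast
qed

text \<open>The entry \<open>w\<^sup>-\<^sup>n\<close> of the matrix contributes the order of \<open>D\<close>.\<close>

lemma pole_order_conn:
  assumes "\<And>p. has_germ 2 p \<gamma> (\<Gamma> p)" "\<And>p. has_germ 1 p \<delta> (\<Delta> p)"
  shows "pole_order D (conn D \<gamma> \<delta>) p =
    max (count D p) (max (nat (- fls_subdegree (\<Gamma> p * fls_X ^ count D p))) (nat (- fls_subdegree (trace_fls D \<Delta> p))))"
proof -
  define M where "M = conn_matrix D (conn D \<gamma> \<delta>) p"
  have M: "M = vector [vector [0, fls_X_inv ^ count D p], vector [\<Gamma> p * fls_X ^ count D p, trace_fls D \<Delta> p]]"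
    unfolding M_def by (rule conn_matrix_conn[OF assms])
  have "{nat (- fls_subdegree (M $ i $ j)) |i j. True} =
     (\<lambda>(i, j). nat (- fls_subdegree (M $ i $ j))) ` (UNIV \<times> UNIV)" by auto
  also have "(UNIV :: (2 \<times> 2) set) = {(1,1), (1,2), (2,1), (2,2)}"
    using exhaust_2 by auto
  then have "(UNIV \<times> UNIV :: (2 \<times> 2) set) = {(1,1), (1,2), (2,1), (2,2)}" by simp
  finally have "{nat (- fls_subdegree (M $ i $ j)) |i j. True} =
     {0, count D p, nat (- fls_subdegree (\<Gamma> p * fls_X ^ count D p)), nat (- fls_subdegree (trace_fls D \<Delta> p))}"
    by (simp add: M vector_2)
  then show ?thesis unfolding pole_order_def M_def[symmetric] by simp
qed

lemma formal_data_at_conn: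
  assumes "\<And>p. has_germ 2 p \<gamma> (\<Gamma> p)" "\<And>p. has_germ 1 p \<delta> (\<Delta> p)"
  shows "formal_data_at D (conn D \<gamma> \<delta>) t = (fls_below 0 (trace_fls D \<Delta> t), fls_below (- int (count D t)) (- \<Gamma> t))"
proof -
  have "fls_X_inv ^ count D t * (\<Gamma> t * fls_X ^ count D t) = \<Gamma> t * (fls_X_inv ^ count D t * fls_X ^ count D t)"
    by (simp only: mult_ac)
  also have "\<dots> = \<Gamma> t" by (simp only: X_inv_X_power mult_1_right)
  finally have eq: "fls_X_inv ^ count D t * (\<Gamma> t * fls_X ^ count D t) = \<Gamma> t" .
  show ?thesis
    unfolding formal_data_at_def conn_matrix_conn[OF assms] by (simp add: trace_def sum_2 det_2 vector_2 eq)
qed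

lemma residue_matrix_conn:
  fixes R :: "complex ^ 2 ^ 2"
  assumes "\<And>p. has_germ 2 p \<gamma> (\<Gamma> p)" "\<And>p. has_germ 1 p \<delta> (\<Delta> p)" and "count D q = 0"
  defines "R \<equiv> residue_matrix D (conn D \<gamma> \<delta>) q"
  shows "R $ 1 $ 1 = 0" "R $ 1 $ 2 = 0" "R $ 2 $ 1 = fls_nth (\<Gamma> q) (- 1)" "R $ 2 $ 2 = fls_nth (flat_coeff q + \<Delta> q) (- 1)"
  unfolding R_def residue_matrix_def conn_matrix_conn[OF assms(1,2)]
  using assms(3) by (simp_all add: vector_2 trace_fls_def)

text \<open>Over a reduced divisor a point of the fibre is the graph of a function.\<close>

lemma Pi_fibre_points:
  assumes "P \<in> Pi_fibre Q" "\<And>q. count Q q \<le> 1"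
  obtains v where "P = (\<lambda>q. (q, v q)) ` set_mset Q"
proof -
  have fin: "finite P" and Q: "image_mset fst (mset_set P) = Q" using assms(1) by (auto simp: Pi_fibre_def)
  have set: "fst ` P = set_mset Q" using fin by (simp add: set_image_mset flip: Q)
  have inj: "x = y" if "x \<in> P" "y \<in> P" "fst x = fst y" for x y
  proof (rule ccontr)
    assume "x \<noteq> y"
    have "count Q (fst x) = (\<Sum>z\<in>fst -` {fst x} \<inter> set_mset (mset_set P). count (mset_set P) z)"
      by (simp only: count_image_mset flip: Q)
    also have "\<dots> \<ge> (\<Sum>z\<in>{x, y}. count (mset_set P) z)"
      using that fin by (intro sum_mono2) auto
    also have "(\<Sum>z\<in>{x, y}. count (mset_set P) z) = 2" using \<open>x \<noteq> y\<close> that fin by simp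
    finally show False using assms(2)[of "fst x"] by simp
  qed
  define v where "v = (\<lambda>q. SOME v. (q, v) \<in> P)"
  have v: "(q, v q) \<in> P" if "q \<in># Q" for q
    using that unfolding v_def set[symmetric] by (auto intro: someI)
  have "P = (\<lambda>q. (q, v q)) ` set_mset Q"
  proof (intro set_eqI iffI)
    fix x assume "x \<in> P"
    then have "fst x \<in># Q" using set by auto
    then have "x = (fst x, v (fst x))" using inj[OF \<open>x \<in> P\<close> v] by simp
    then show "x \<in> (\<lambda>q. (q, v q)) ` set_mset Q" using \<open>fst x \<in># Q\<close> by blast
  qed (use v in auto)
  then show ?thesis by (rule that)
qed

text \<open>The principal part of the trace of the connection matrix that the formal data (at \<open>D\<close>) and the
  eigenvalues (at \<open>Q\<close>) prescribe.\<close>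

definition trace_target :: "divisor \<Rightarrow> divisor \<Rightarrow> formal_data \<Rightarrow> P1 \<Rightarrow> complex fls" where
  "trace_target D Q \<Lambda> p = (if p \<in># D then fst (\<Lambda> p) else 0) - of_nat (count Q p) * fls_X_inv"

text \<open>The prescribed expansion of \<open>\<gamma>\<close>: modulo order \<open>- n\<^sub>t\<close> at \<open>t\<close> in \<open>D\<close>, and modulo order 1 at a point
  of \<open>Q\<close>, where the constant term is the one that prevents logarithms.\<close>

definition det_target :: "divisor \<Rightarrow> divisor \<Rightarrow> formal_data \<Rightarrow> (P1 \<Rightarrow> complex) \<Rightarrow> (P1 \<Rightarrow> complex fls) \<Rightarrow> P1 \<Rightarrow> complex fls" where
  "det_target D Q \<Lambda> v \<Delta> p = (if p \<in># D then - snd (\<Lambda> p)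
     else if p \<in># Q then fls_const (v p) * fls_X_inv + fls_const (v p ^ 2 - fls_nth (flat_coeff p + \<Delta> p) 0 * v p)
     else 0)"

definition solves_interpolation :: "divisor \<Rightarrow> divisor \<Rightarrow> formal_data \<Rightarrow> (P1 \<Rightarrow> complex) \<Rightarrow> (P1 \<Rightarrow> complex fls) \<Rightarrow> (P1 \<Rightarrow> complex fls) \<Rightarrow> bool" where
  "solves_interpolation D Q \<Lambda> v \<Gamma> \<Delta> \<longleftrightarrow> (\<forall>p. ord_ge 0 (trace_fls D \<Delta> p - trace_target D Q \<Lambda> p)) \<and>
     (\<forall>p. ord_ge (int (count Q p) - int (count D p)) (\<Gamma> p - det_target D Q \<Lambda> v \<Delta> p))"

lemma ord_ge_iff_pole_order: "ord_ge (- int n) F \<longleftrightarrow> nat (- fls_subdegree F) \<le> n"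
  by (auto simp: ord_ge_iff_subdegree)

lemma ord_ge_1_nths: "ord_ge 1 (A - B) \<longleftrightarrow> ord_ge 0 (A - B) \<and> fls_nth A 0 = fls_nth B 0"
proof -
  have "k < 1 \<longleftrightarrow> k < 0 \<or> k = 0" for k :: int by auto
  then show ?thesis by (auto simp: ord_ge_def)
qed

lemma ord_ge_0_nths: "ord_ge 0 A \<longleftrightarrow> ord_ge (- 1) A \<and> fls_nth A (- 1) = 0"
proof -
  have "k < 0 \<longleftrightarrow> k < - 1 \<or> k = - 1" for k :: int by auto
  then show ?thesis by (auto simp: ord_ge_def)
qed

lemma ord_ge_diff_iff: "ord_ge m B \<Longrightarrow> ord_ge m (A - B) \<longleftrightarrow> ord_ge m A"
  by (auto simp: ord_ge_def)

lemma ord_ge_1_simple_pole: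
  "ord_ge 1 (A - (fls_const a * fls_X_inv + fls_const b)) \<longleftrightarrow> ord_ge (- 1) A \<and> fls_nth A (- 1) = a \<and> fls_nth A 0 = b"
proof -
  have "ord_ge (- 1) (fls_const a * fls_X_inv + fls_const b)" by (auto simp: ord_ge_def)
  then show ?thesis
    unfolding ord_ge_1_nths ord_ge_0_nths[of "A - _"] by (auto simp: ord_ge_diff_iff)
qed

lemma ord_ge_0_simple_pole:
  "ord_ge 0 (A - (0 - 1 * fls_X_inv)) \<longleftrightarrow> ord_ge (- 1) A \<and> fls_nth A (- 1) = - 1"
proof -
  have "ord_ge (- 1) (0 - 1 * fls_X_inv)" by (auto simp: ord_ge_def)
  then show ?thesis
    unfolding ord_ge_0_nths[of "A - (0 - 1 * fls_X_inv)"] by (simp only: ord_ge_diff_iff) (simp add: eq_neg_iff_add_eq_0)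
qed

text \<open>Point by point: at \<open>D\<close> the trace and \<open>- \<gamma>\<close> are compared with the formal data; at \<open>Q\<close> the
  residue matrix gives residues \<open>-1\<close> of the trace and \<open>v\<close> of \<open>\<gamma>\<close>, and apparentness gives the constant term
  of \<open>\<gamma>\<close>; elsewhere the bound on the poles says that the coefficients are holomorphic.\<close>

theorem conn_conditions_iff:
  assumes g: "\<And>p. has_germ 2 p \<gamma> (\<Gamma> p)" "\<And>p. has_germ 1 p \<delta> (\<Delta> p)"
    and \<Lambda>: "is_formal_data D \<Lambda>" and Q1: "\<And>q. count Q q \<le> 1" and disj: "set_mset Q \<inter> set_mset D = {}"
    and P: "P = (\<lambda>q. (q, v q)) ` set_mset Q"
  defines "nabla \<equiv> conn D \<gamma> \<delta>"
  shows "connection_with_polar_divisor D (D + Q) nabla \<and>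
      (\<forall>t\<in>#D. formal_data_at D nabla t = \<Lambda> t) \<and>
      (\<forall>p\<in>P. apparent_singular_point D nabla (fst p) \<and>
         eigenspace (residue_matrix D nabla (fst p)) (- 1) = line_Omega \<and>
         eigenspace (residue_matrix D nabla (fst p)) 0 = line_of_point p)
    \<longleftrightarrow> solves_interpolation D Q \<Lambda> v \<Gamma> \<Delta>" (is "?lhs \<longleftrightarrow> _")
proof
  have po: "pole_order D nabla p = max (count D p) (max (nat (- fls_subdegree (\<Gamma> p * fls_X ^ count D p))) (nat (- fls_subdegree (trace_fls D \<Delta> p))))" for p
    unfolding nabla_def by (rule pole_order_conn[OF g])
  have fd: "formal_data_at D nabla t = (fls_below 0 (trace_fls D \<Delta> t), fls_below (- int (count D t)) (- \<Gamma> t))" for t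
    unfolding nabla_def by (rule formal_data_at_conn[OF g])
  have \<Lambda>D: "ord_ge (- int (count D t)) (fst (\<Lambda> t))" "ord_ge (- 2 * int (count D t)) (snd (\<Lambda> t))"
    "fls_below 0 (fst (\<Lambda> t)) = fst (\<Lambda> t)" "fls_below (- int (count D t)) (snd (\<Lambda> t)) = snd (\<Lambda> t)" if "t \<in># D" for t
    using \<Lambda>[unfolded is_formal_data_def, rule_format, OF that]
    by (auto simp: ord_ge_iff_subdegree Let_def case_prod_beta)
  have fd_iff: "formal_data_at D nabla t = \<Lambda> t \<longleftrightarrow> ord_ge 0 (trace_fls D \<Delta> t - fst (\<Lambda> t)) \<and>
     ord_ge (- int (count D t)) (\<Gamma> t + snd (\<Lambda> t))" if t: "t \<in># D" for t
  proof -
    have "- \<Gamma> t - snd (\<Lambda> t) = - (\<Gamma> t + snd (\<Lambda> t))" by simp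
    then have "ord_ge (- int (count D t)) (- \<Gamma> t - snd (\<Lambda> t)) \<longleftrightarrow> ord_ge (- int (count D t)) (\<Gamma> t + snd (\<Lambda> t))"
      by (simp only: ord_ge_minus)
    then show ?thesis
      unfolding fd prod_eq_iff fst_conv snd_conv
        fls_below_eq_iff[OF \<Lambda>D(3)[OF t]] fls_below_eq_iff[OF \<Lambda>D(4)[OF t]] by simp
  qed
  have Qq: "count Q q = 1" "count D q = 0" "q \<notin># D" if "q \<in># Q" for q
  proof -
    show "count Q q = 1" using Q1[of q] that by (simp add: le_antisym Suc_leI)
    show "q \<notin># D" using that disj by blast
    then show "count D q = 0" by (simp add: not_in_iff)
  qed
  have trq: "trace_fls D \<Delta> q = flat_coeff q + \<Delta> q" if "q \<in># Q" for q
    using Qq[OF that] by (simp add: trace_fls_def)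
  have tt: "trace_target D Q \<Lambda> t = fst (\<Lambda> t)" "count Q t = 0" "t \<notin># Q" if "t \<in># D" for t
  proof -
    show "t \<notin># Q" using that disj by blast
    then show "count Q t = 0" by (simp add: not_in_iff)
    then show "trace_target D Q \<Lambda> t = fst (\<Lambda> t)" using that by (simp add: trace_target_def)
  qed
  have target_q: "ord_ge 0 (trace_fls D \<Delta> q - trace_target D Q \<Lambda> q) \<longleftrightarrow> ord_ge (- 1) (trace_fls D \<Delta> q) \<and> fls_nth (trace_fls D \<Delta> q) (- 1) = - 1"
    if "q \<in># Q" for q
    using ord_ge_0_simple_pole[of "trace_fls D \<Delta> q"] Qq[OF that] by (simp add: trace_target_def)
  have target_q2: "ord_ge (int (count Q q) - int (count D q)) (\<Gamma> q - det_target D Q \<Lambda> v \<Delta> q) \<longleftrightarrow>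
     ord_ge (- 1) (\<Gamma> q) \<and> fls_nth (\<Gamma> q) (- 1) = v q \<and> fls_nth (\<Gamma> q) 0 = v q ^ 2 - fls_nth (flat_coeff q + \<Delta> q) 0 * v q"
    if "q \<in># Q" for q
    using ord_ge_1_simple_pole[of "\<Gamma> q"] Qq[OF that] that by (simp add: det_target_def)
  {
    assume L: ?lhs
    then have pol: "max (count D p) (max (nat (- fls_subdegree (\<Gamma> p * fls_X ^ count D p))) (nat (- fls_subdegree (trace_fls D \<Delta> p)))) = count (D + Q) p" for p
      unfolding connection_with_polar_divisor_def po by blast
    have vbT: "ord_ge (- int (count (D + Q) p)) (trace_fls D \<Delta> p)" and vbG: "ord_ge (- int (count (D + Q) p)) (\<Gamma> p * fls_X ^ count D p)" for p
      unfolding ord_ge_iff_pole_order pol[symmetric] by auto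
    have "ord_ge 0 (trace_fls D \<Delta> p - trace_target D Q \<Lambda> p) \<and> ord_ge (int (count Q p) - int (count D p)) (\<Gamma> p - det_target D Q \<Lambda> v \<Delta> p)" for p
    proof -
      consider "p \<in># D" | "p \<in># Q" | "p \<notin># D" "p \<notin># Q" by blast
      then show ?thesis
      proof cases
        case 1
        then have "formal_data_at D nabla p = \<Lambda> p" using L by blast
        then show ?thesis using 1 tt[OF 1] unfolding fd_iff[OF 1] by (simp add: det_target_def)
      next
        case 2
        then have "(p, v p) \<in> P" using P by blast
        then have ap: "apparent_singular_point D nabla p"
          and ei: "eigenspace (residue_matrix D nabla p) (- 1) = line_Omega"
             "eigenspace (residue_matrix D nabla p) 0 = line_of_point (p, v p)"
          using L by fastforce+
        note R = residue_matrix_conn[OF g Qq(2)[OF 2], folded nabla_def]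
        have r: "fls_nth (\<Gamma> p) (- 1) = v p" "fls_nth (flat_coeff p + \<Delta> p) (- 1) = - 1"
          using ei eigenspaces_iff[OF R(1,2), of p "v p"] unfolding R(3,4) by blast+
        have vbs: "ord_ge (- 1) (\<Gamma> p)" "ord_ge (- 1) (flat_coeff p + \<Delta> p)"
          using vbG[of p] vbT[of p] Qq[OF 2] by (simp_all add: trq[OF 2])
        have "horizontal_sections_holomorphic D (conn D \<gamma> \<delta>) p"
          using ap by (simp add: apparent_singular_point_def nabla_def)
        note c0 = horizontal_sections_holomorphicD[OF g vbs r(2) Qq(3)[OF 2] this, unfolded r(1)]
        have "ord_ge (- 1) (trace_fls D \<Delta> p)" "fls_nth (trace_fls D \<Delta> p) (- 1) = - 1"
          by (simp_all only: trq[OF 2] vbs r)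
        then show ?thesis
          unfolding target_q[OF 2] target_q2[OF 2] using vbs(1) r(1) c0 by blast
      next
        case 3
        then have "count D p = 0" "count Q p = 0" by (auto simp: not_in_iff)
        then show ?thesis using vbT[of p] vbG[of p] 3 by (simp add: trace_target_def det_target_def)
      qed
    qed
    then show "solves_interpolation D Q \<Lambda> v \<Gamma> \<Delta>" by (simp add: solves_interpolation_def)
  }
  assume S: "solves_interpolation D Q \<Lambda> v \<Gamma> \<Delta>"
  have tr: "ord_ge 0 (trace_fls D \<Delta> p - trace_target D Q \<Lambda> p)"
    and de: "ord_ge (int (count Q p) - int (count D p)) (\<Gamma> p - det_target D Q \<Lambda> v \<Delta> p)" for p
    using S by (auto simp: solves_interpolation_def)
  have vbT: "ord_ge (- int (count (D + Q) p)) (trace_fls D \<Delta> p)" for p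
  proof -
    have "ord_ge (- int (count (D + Q) p)) (trace_target D Q \<Lambda> p)"
      unfolding trace_target_def
    proof (rule ord_ge_diff)
      show "ord_ge (- int (count (D + Q) p)) (if p \<in># D then fst (\<Lambda> p) else 0)"
        using \<Lambda>D(1)[of p] by (auto intro: ord_ge_mono)
      show "ord_ge (- int (count (D + Q) p)) (of_nat (count Q p) * fls_X_inv)"
        by (cases "count Q p = 0") (auto simp: ord_ge_def)
    qed
    moreover have "ord_ge (- int (count (D + Q) p)) (trace_fls D \<Delta> p - trace_target D Q \<Lambda> p)"
      using tr[of p] by (rule ord_ge_mono) simp
    ultimately show ?thesis by (simp add: ord_ge_diff_iff)
  qed
  have vbG: "ord_ge (- int (count (D + (D + Q)) p)) (\<Gamma> p)" for p
  proof -
    have "ord_ge (- int (count (D + (D + Q)) p)) (det_target D Q \<Lambda> v \<Delta> p)"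
    proof (cases "p \<in># D")
      case True
      then show ?thesis using \<Lambda>D(2)[of p] by (auto simp: det_target_def ord_ge_minus intro: ord_ge_mono)
    next
      case False
      show ?thesis
      proof (cases "p \<in># Q")
        case True
        then show ?thesis using False Qq[OF True] by (auto simp: det_target_def ord_ge_def)
      qed (use False in \<open>simp add: det_target_def\<close>)
    qed
    moreover have "ord_ge (- int (count (D + (D + Q)) p)) (\<Gamma> p - det_target D Q \<Lambda> v \<Delta> p)"
      using de[of p] by (rule ord_ge_mono) simp
    ultimately show ?thesis by (simp add: ord_ge_diff_iff)
  qed
  have isc: "is_connection D (D + Q) nabla"
    unfolding nabla_def by (rule is_connection_conn[OF g _ vbG vbT]) simp
  have pol: "pole_order D nabla p = count (D + Q) p" for p
  proof -
    have "ord_ge (- int (count (D + Q) p)) (\<Gamma> p * fls_X ^ count D p)"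
      by (rule ord_ge_mult'[OF vbG ord_ge_X_power]) simp
    then have 1: "nat (- fls_subdegree (\<Gamma> p * fls_X ^ count D p)) \<le> count (D + Q) p"
       "nat (- fls_subdegree (trace_fls D \<Delta> p)) \<le> count (D + Q) p"
      using vbT[of p] unfolding ord_ge_iff_pole_order by auto
    show ?thesis
    proof (cases "p \<in># Q")
      case False
      then show ?thesis using 1 unfolding po by (simp add: not_in_iff)
    next
      case True
      have "fls_nth (trace_fls D \<Delta> p) (- 1) = - 1" using tr[of p] target_q[OF True] by blast
      then have "fls_subdegree (trace_fls D \<Delta> p) \<le> - 1" by (intro fls_subdegree_leI) auto
      then show ?thesis using 1 Qq[OF True] unfolding po by simp
    qed
  qed
  have "formal_data_at D nabla t = \<Lambda> t" if t: "t \<in># D" for t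
    using tr[of t] de[of t] tt[OF t] t unfolding fd_iff[OF t] by (simp add: det_target_def)
  moreover have "apparent_singular_point D nabla q \<and> eigenspace (residue_matrix D nabla q) (- 1) = line_Omega \<and>
         eigenspace (residue_matrix D nabla q) 0 = line_of_point (q, v q)" if q: "q \<in># Q" for q
  proof -
    have r: "ord_ge (- 1) (\<Gamma> q)" "fls_nth (\<Gamma> q) (- 1) = v q"
       "fls_nth (\<Gamma> q) 0 = v q ^ 2 - fls_nth (flat_coeff q + \<Delta> q) 0 * v q"
       "ord_ge (- 1) (flat_coeff q + \<Delta> q)" "fls_nth (flat_coeff q + \<Delta> q) (- 1) = - 1"
      using tr[of q, unfolded target_q[OF q], unfolded trq[OF q]] de[of q, unfolded target_q2[OF q]] by blast+
    have h: "horizontal_sections_holomorphic D nabla q"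
      unfolding nabla_def by (rule horizontal_sections_holomorphicI[OF g r(1,4,5)]) (use r in simp)
    note R = residue_matrix_conn[OF g Qq(2)[OF q], folded nabla_def]
    have "eigenspace (residue_matrix D nabla q) (- 1) = line_Omega \<and>
         eigenspace (residue_matrix D nabla q) 0 = line_of_point (q, v q)"
      unfolding eigenspaces_iff[OF R(1,2)] R(3,4) using r by blast
    moreover have "{\<mu>. eigenspace (residue_matrix D nabla q) \<mu> \<noteq> {0}} = {- 1, 0}"
      by (rule eigenvalues[OF R(1,2)]) (simp only: R(4) r)
    ultimately show ?thesis
      using h pol[of q] Qq[OF q] unfolding apparent_singular_point_def by simp
  qed
  ultimately show ?lhs
    unfolding connection_with_polar_divisor_def P using isc pol by auto
qed

section \<open>Existence and uniqueness\<close>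

lemma sum_over_P1:
  fixes f :: "P1 \<Rightarrow> 'a :: comm_monoid_add"
  assumes "finite S"
  shows "(\<Sum>a\<in>S. f (Some a)) + f None = (\<Sum>p\<in>insert None (Some ` S). f p)"
  using assms by (subst sum.insert) (auto simp: sum.reindex add.commute)

lemma sum_count_eq_size:
  assumes "finite T" "set_mset D \<subseteq> T"
  shows "(\<Sum>p\<in>T. count D p) = size D"
  using assms unfolding size_multiset_overloaded_eq
  by (intro sum.mono_neutral_right) (auto simp: not_in_iff)

theorem lemma6:
  fixes n :: nat and D Q :: divisor and \<Lambda> :: formal_data and P :: "Omega_point set"
  assumes "size D = n" and "n \<ge> 3"
    and "is_formal_data D \<Lambda>" and "reduced_data D \<Lambda>" and "fuchs_relation 1 D \<Lambda>"
    and "Q \<in> W D" and "P \<in> Pi_fibre Q"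
  shows "\<exists>!nabla :: connection.
      connection_with_polar_divisor D (D + Q) nabla \<and>
      trivial_on_O D nabla \<and> phi_is_id D nabla \<and>
      (\<forall>t\<in>#D. formal_data_at D nabla t = \<Lambda> t) \<and>
      (\<forall>p\<in>P. apparent_singular_point D nabla (fst p) \<and>
         eigenspace (residue_matrix D nabla (fst p)) (- 1) = line_Omega \<and>
         eigenspace (residue_matrix D nabla (fst p)) 0 = line_of_point p)"
proof -
  let ?spec = "\<lambda>nabla. connection_with_polar_divisor D (D + Q) nabla \<and>
      trivial_on_O D nabla \<and> phi_is_id D nabla \<and>
      (\<forall>t\<in>#D. formal_data_at D nabla t = \<Lambda> t) \<and>
      (\<forall>p\<in>P. apparent_singular_point D nabla (fst p) \<and>
         eigenspace (residue_matrix D nabla (fst p)) (- 1) = line_Omega \<and>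
         eigenspace (residue_matrix D nabla (fst p)) 0 = line_of_point p)"
  have Q: "size Q = n - 3" "\<And>q. count Q q \<le> 1" "set_mset Q \<inter> set_mset D = {}"
    using assms(1,6) by (auto simp: W_def)
  obtain v where P: "P = (\<lambda>q. (q, v q)) ` set_mset Q"
    by (rule Pi_fibre_points[OF assms(7) Q(2)])
  note iff = conn_conditions_iff[OF _ _ assms(3) Q(2,3) P]
  define S where "S = Some -` (set_mset D \<union> set_mset Q)"
  define T where "T = insert None (Some ` S)"
  have S: "finite S" unfolding S_def by (intro finite_vimageI) auto
  have T: "finite T" "set_mset D \<subseteq> T" "set_mset Q \<subseteq> T"
  proof -
    show "finite T" using S by (simp add: T_def)
    have "p \<in> T" if "p \<in># D \<or> p \<in># Q" for p
      using that by (cases p) (auto simp: T_def S_def)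
    then show "set_mset D \<subseteq> T" "set_mset Q \<subseteq> T" by auto
  qed
  have out: "Some b \<notin># D" "Some b \<notin># Q" "count D (Some b) = 0" "count Q (Some b) = 0" if "b \<notin> S" for b
    using that by (auto simp: S_def not_in_iff)
  have degD: "(\<Sum>p\<in>T. int (count D p)) = int n" and degQ: "(\<Sum>p\<in>T. int (count Q p)) = int n - 3"
    using sum_count_eq_size[OF T(1,2)] sum_count_eq_size[OF T(1,3)] assms(1,2) Q(1)
    by (simp_all flip: of_nat_sum)

  \<comment> \<open>\<open>\<gamma> dz\<^sup>2\<close> is prescribed modulo sections of \<open>(\<Omega>\<^sup>1)\<^sup>2(D - Q)\<close>\<close>
  define e where "e = (\<lambda>p. int (count Q p) - int (count D p))"
  have dege: "(\<Sum>a\<in>S. e (Some a)) + e None = - 3"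
    unfolding sum_over_P1[OF S] T_def[symmetric] by (simp add: e_def sum_subtractf degD degQ)

  \<comment> \<open>the principal parts of \<open>\<delta> dz\<close> itself\<close>
  define T1 where "T1 = (\<lambda>p. trace_target D Q \<Lambda> p - flat_coeff p + of_nat (count D p) * fls_X_inv)"
  have T1: "trace_fls D \<Delta> p - trace_target D Q \<Lambda> p = \<Delta> p - T1 p" for \<Delta> p
    by (simp add: trace_fls_def T1_def)
  have res: "(\<Sum>a\<in>S. fls_nth (T1 (Some a)) (- 1)) + fls_nth (T1 None) (- 1) = 0"
  proof -
    have r: "fls_nth (T1 p) (- 1) = (if p \<in># D then fls_nth (fst (\<Lambda> p)) (- 1) else 0) - of_int (int (count Q p))
        - (if p = None then 2 else 0) + of_int (int (count D p))" for p
      by (simp add: T1_def trace_target_def flat_coeff_def)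
    have "(\<Sum>p\<in>T. if p \<in># D then fls_nth (fst (\<Lambda> p)) (- 1) else 0) = (\<Sum>p\<in>set_mset D. fls_nth (fst (\<Lambda> p)) (- 1))"
      using T by (simp add: sum.inter_restrict[symmetric] Int_absorb1)
    also have "\<dots> = - 1" using assms(5) by (simp add: fuchs_relation_def)
    \<comment> \<open>\<open>-1\<close> from the Fuchs relation, \<open>n\<close> from the frames at \<open>D\<close>, \<open>-(n - 3)\<close> from \<open>Q\<close>, and \<open>-2\<close> from infinity\<close>
    finally have "(\<Sum>p\<in>T. fls_nth (T1 p) (- 1)) = - 1 - of_int (\<Sum>p\<in>T. int (count Q p)) - 2 + of_int (\<Sum>p\<in>T. int (count D p))"
      using T(1) unfolding r sum.distrib sum_subtractf of_int_sum
      by (simp add: sum.delta T_def)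
    then show ?thesis
      unfolding sum_over_P1[OF S, of "\<lambda>p. fls_nth (T1 p) (- 1)"] T_def[symmetric] degD degQ by simp
  qed

  show ?thesis
  proof (rule ex_ex1I)
    obtain \<delta> \<Delta> where \<delta>: "\<And>p. has_germ 1 p \<delta> (\<Delta> p)" "\<And>p. ord_ge 0 (\<Delta> p - T1 p)"
    proof (rule interpolation_of_forms[OF S _ res])
      show "T1 (Some b) = 0" if "b \<notin> S" for b
        using out[OF that] by (simp add: T1_def trace_target_def flat_coeff_def)
    qed blast
    obtain \<gamma> \<Gamma> where \<gamma>: "\<And>p. has_germ 2 p \<gamma> (\<Gamma> p)" "\<And>p. ord_ge (e p) (\<Gamma> p - det_target D Q \<Lambda> v \<Delta> p)"
    proof (rule interpolation_of_differentials[OF S, of e "det_target D Q \<Lambda> v \<Delta>" 2])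
      show "e (Some b) = 0 \<and> det_target D Q \<Lambda> v \<Delta> (Some b) = 0" if "b \<notin> S" for b
        using out[OF that] by (simp add: e_def det_target_def)
      show "(\<Sum>a\<in>S. e (Some a)) + e None + 2 * int 2 = 1" using dege by simp
    qed blast
    have "solves_interpolation D Q \<Lambda> v \<Gamma> \<Delta>" using \<gamma>(2) \<delta>(2) by (simp add: solves_interpolation_def T1 e_def)
    then show "\<exists>nabla. ?spec nabla"
      using iff[OF \<gamma>(1) \<delta>(1)] trivial_on_O_conn phi_is_id_conn by blast
  next
    have sol: "\<exists>\<gamma> \<delta> \<Gamma> \<Delta>. (\<forall>p. has_germ 2 p \<gamma> (\<Gamma> p)) \<and> (\<forall>p. has_germ 1 p \<delta> (\<Delta> p)) \<and> nabla = conn D \<gamma> \<delta>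
       \<and> solves_interpolation D Q \<Lambda> v \<Gamma> \<Delta>"
      if nab: "?spec nabla" for nabla
    proof -
      have "is_connection D (D + Q) nabla" "trivial_on_O D nabla" "phi_is_id D nabla"
        using nab by (auto simp: connection_with_polar_divisor_def)
      then obtain \<gamma> \<delta> \<Gamma> \<Delta> where g: "\<And>p. has_germ 2 p \<gamma> (\<Gamma> p)" "\<And>p. has_germ 1 p \<delta> (\<Delta> p)" "nabla = conn D \<gamma> \<delta>"
        by (rule normalized_connection_eq_conn) blast
      then show ?thesis using iff[OF g(1,2)] nab by blast
    qed
    fix nabla1 nabla2 :: connection
    assume 1: "?spec nabla1"
    assume 2: "?spec nabla2"
    obtain \<gamma>1 \<delta>1 \<Gamma>1 \<Delta>1 where g1: "\<And>p. has_germ 2 p \<gamma>1 (\<Gamma>1 p)" "\<And>p. has_germ 1 p \<delta>1 (\<Delta>1 p)" "nabla1 = conn D \<gamma>1 \<delta>1"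
       and s1: "\<And>p. ord_ge 0 (\<Delta>1 p - T1 p)" "\<And>p. ord_ge (e p) (\<Gamma>1 p - det_target D Q \<Lambda> v \<Delta>1 p)"
      using sol[OF 1] unfolding solves_interpolation_def T1 e_def by blast
    obtain \<gamma>2 \<delta>2 \<Gamma>2 \<Delta>2 where g2: "\<And>p. has_germ 2 p \<gamma>2 (\<Gamma>2 p)" "\<And>p. has_germ 1 p \<delta>2 (\<Delta>2 p)" "nabla2 = conn D \<gamma>2 \<delta>2"
       and s2: "\<And>p. ord_ge 0 (\<Delta>2 p - T1 p)" "\<And>p. ord_ge (e p) (\<Gamma>2 p - det_target D Q \<Lambda> v \<Delta>2 p)"
      using sol[OF 2] unfolding solves_interpolation_def T1 e_def by blast
    have "\<Delta>1 p - \<Delta>2 p = 0" for p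
    proof (rule vanishing_of_negative_degree[where e = "\<lambda>_. 0", OF finite.emptyI has_germ_diff[OF g1(2) g2(2)]])
      show "ord_ge 0 (\<Delta>1 p - \<Delta>2 p)" for p using ord_ge_diff[OF s1(1)[of p] s2(1)[of p]] by simp
    qed auto
    then have \<Delta>: "\<Delta>1 p = \<Delta>2 p" for p by simp
    then have tgt: "det_target D Q \<Lambda> v \<Delta>1 = det_target D Q \<Lambda> v \<Delta>2" by (simp add: det_target_def fun_eq_iff)
    have "\<Gamma>1 p - \<Gamma>2 p = 0" for p
    proof (rule vanishing_of_negative_degree[where e = e, OF S has_germ_diff[OF g1(1) g2(1)]])
      show "ord_ge (e p) (\<Gamma>1 p - \<Gamma>2 p)" for p
        using ord_ge_diff[OF s1(2)[of p] s2(2)[of p]] by (simp add: tgt)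
      show "e (Some b) = 0" if "b \<notin> S" for b using out[OF that] by (simp add: e_def)
      show "(\<Sum>a\<in>S. e (Some a)) + e None + 2 * int 2 > 0" using dege by simp
    qed
    then have \<Gamma>: "\<Gamma>1 p = \<Gamma>2 p" for p by simp
    show "nabla1 = nabla2"
      unfolding g1(3) g2(3)
      by (rule conn_eqI[OF g1(1,2)]) (use g2 in \<open>simp_all add: \<Gamma> \<Delta>\<close>)
  qed
qed

end
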